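(* The class $\mathsf{CT}^{\mathit{rest}}_{\forall}$ of all knowledge bases all of whose restricted chase sequences are finite is $\Pi^1_1$-complete.
   Context: Existential rules: a rule is a closed formula $\forall \vec x,\vec y.\, B[\vec x,\vec y]\to\exists \vec z.\, H[\vec y,\vec z]$ where $B,H$ are conjunctions of atoms without nulls, $H$ is non-empty, $B$ features exactly the variables $\vec x,\vec y$ and $H$ exactly $\vec y,\vec z$. Terms are variables, constants or nulls (pairwise disjoint countably infinite sets). A database is a finite set of variable-free, null-free atoms (facts). A knowledge base (KB) is a pair $\langle\Sigma,D\rangle$ of a finite rule set $\Sigma$ and a database $D$. A trigger is a pair $\langle R,\sigma\rangle$ of a rule $R$ and a substitution $\sigma$ defined exactly on the universally quantified variables of $R$; it is a $\Sigma$-trigger if $R\in\Sigma$. It is loaded for a fact set $F$ if $\sigma(\mathrm{body}(R))\subseteq F$, and obsolete for $F$ if some extension $\sigma'$ of $\sigma$ to the existential variables of $R$ satisfies $\sigma'(\mathrm{head}(R))\subseteq F$. Its output is $\sigma'(\mathrm{head}(R))$ where $\sigma'$ extends $\sigma$ by mapping each existential variable to a fresh null. A restricted chase derivation for $\langle\Sigma,D\rangle$ is a possibly infinite sequence $F_0,F_1,\dots$ with $F_0=D$ and, for each $i$, $F_{i+1}=F_i\cup\mathrm{output}(\lambda)$ for some $\Sigma$-trigger $\lambda$ loaded and not obsolete for $F_i$ (the sequence can only end at $F_i$ if no such trigger exists). It is a restricted chase sequence if it is fair: for every $\Sigma$-trigger $\lambda$ and every $i$ such that $\lambda$ is loaded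 for $F_i$, there is $j\ge i$ such that $\lambda$ is obsolete for $F_j$. A chase sequence terminates if it is finite. KBs are given as finite encodings, and complexity classes refer to the arithmetical/analytical hierarchies. *)

theory Defs
  imports "HOL-Library.Nat_Bijection" "HOL-Library.Extended_Nat"
begin

section \<open>Existential rules and the restricted chase\<close>

datatype trm = Var nat | Const nat | Null nat

text \<open>
  A predicate is a name together with an arity: atoms with the same name but different numbers
  of arguments belong to different predicates.
\<close>

datatype atom = Atom (pred: nat) (args: "trm list")

definition vars :: "atom set \<Rightarrow> nat set" where
  "vars A = {x. \<exists>a\<in>A. Var x \<in> set (args a)}"

definition nulls :: "atom set \<Rightarrow> nat set" where
  "nulls A = {x. \<exists>a\<in>A. Null x \<in> set (args a)}"

text \<open>
  Quantifiers are implicit: the variables of the body are universally quantified, the remaining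
  variables of the head existentially. Lists of atoms stand for conjunctions.
\<close>

datatype rule = Rule (body: "atom list") (head: "atom list")

definition uvars :: "rule \<Rightarrow> nat set" where
  "uvars R = vars (set (body R))"

definition evars :: "rule \<Rightarrow> nat set" where
  "evars R = vars (set (head R)) - uvars R"

definition is_rule :: "rule \<Rightarrow> bool" where
  "is_rule R \<longleftrightarrow> head R \<noteq> [] \<and> nulls (set (body R)) = {} \<and> nulls (set (head R)) = {}"

definition is_database :: "atom set \<Rightarrow> bool" where
  "is_database D \<longleftrightarrow> finite D \<and> vars D = {} \<and> nulls D = {}"

type_synonym kb = "rule set \<times> atom set"

definition is_kb :: "kb \<Rightarrow> bool" where
  "is_kb K \<longleftrightarrow> finite (fst K) \<and> (\<forall>R\<in>fst K. is_rule R) \<and> is_database (snd K)"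

type_synonym subst = "nat \<rightharpoonup> trm"

fun subst_trm :: "subst \<Rightarrow> trm \<Rightarrow> trm" where
  "subst_trm \<sigma> (Var x) = (case \<sigma> x of Some t \<Rightarrow> t | None \<Rightarrow> Var x)"
| "subst_trm \<sigma> (Const c) = Const c"
| "subst_trm \<sigma> (Null n) = Null n"

definition subst_atom :: "subst \<Rightarrow> atom \<Rightarrow> atom" where
  "subst_atom \<sigma> a = Atom (pred a) (map (subst_trm \<sigma>) (args a))"

type_synonym trigger = "rule \<times> subst"

definition is_trigger :: "rule set \<Rightarrow> trigger \<Rightarrow> bool" where
  "is_trigger \<Sigma> \<tau> \<longleftrightarrow> fst \<tau> \<in> \<Sigma> \<and> dom (snd \<tau>) = uvars (fst \<tau>)"

definition loaded :: "trigger \<Rightarrow> atom set \<Rightarrow> bool" where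
  "loaded \<tau> F \<longleftrightarrow> subst_atom (snd \<tau>) ` set (body (fst \<tau>)) \<subseteq> F"

definition is_extension :: "trigger \<Rightarrow> subst \<Rightarrow> bool" where
  "is_extension \<tau> \<sigma>' \<longleftrightarrow>
     snd \<tau> \<subseteq>\<^sub>m \<sigma>' \<and> dom \<sigma>' = uvars (fst \<tau>) \<union> evars (fst \<tau>)"

definition obsolete :: "trigger \<Rightarrow> atom set \<Rightarrow> bool" where
  "obsolete \<tau> F \<longleftrightarrow>
     (\<exists>\<sigma>'. is_extension \<tau> \<sigma>' \<and> subst_atom \<sigma>' ` set (head (fst \<tau>)) \<subseteq> F)"

text \<open>
  The output of a trigger is determined only up to the choice of fresh nulls, so it is a relation.
  Fact sets grow along a derivation and contain every null introduced so far, hence a null is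
  fresh iff it does not occur in the current fact set.
\<close>

definition is_output :: "atom set \<Rightarrow> trigger \<Rightarrow> atom set \<Rightarrow> bool" where
  "is_output F \<tau> H \<longleftrightarrow>
     (\<exists>\<sigma>'. is_extension \<tau> \<sigma>' \<and>
           inj_on \<sigma>' (evars (fst \<tau>)) \<and>
           (\<forall>z\<in>evars (fst \<tau>). \<exists>n. \<sigma>' z = Some (Null n) \<and> n \<notin> nulls F) \<and>
           H = subst_atom \<sigma>' ` set (head (fst \<tau>)))"

definition applicable :: "rule set \<Rightarrow> atom set \<Rightarrow> trigger \<Rightarrow> bool" where
  "applicable \<Sigma> F \<tau> \<longleftrightarrow> is_trigger \<Sigma> \<tau> \<and> loaded \<tau> F \<and> \<not> obsolete \<tau> F"

text \<open>
  A possibly infinite sequence is a pair of a function \<open>F\<close> and the index \<open>N\<close> of its last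
  element, with \<open>N = \<infinity>\<close> for infinite sequences; values of \<open>F\<close> beyond \<open>N\<close> are irrelevant.
\<close>

definition restricted_chase_derivation :: "kb \<Rightarrow> (nat \<Rightarrow> atom set) \<Rightarrow> enat \<Rightarrow> bool" where
  "restricted_chase_derivation K F N \<longleftrightarrow>
     F 0 = snd K \<and>
     (\<forall>i. enat i < N \<longrightarrow>
        (\<exists>\<tau> H. applicable (fst K) (F i) \<tau> \<and> is_output (F i) \<tau> H \<and> F (Suc i) = F i \<union> H)) \<and>
     (\<forall>n. N = enat n \<longrightarrow> \<not> (\<exists>\<tau>. applicable (fst K) (F n) \<tau>))"

definition fair :: "kb \<Rightarrow> (nat \<Rightarrow> atom set) \<Rightarrow> enat \<Rightarrow> bool" where
  "fair K F N \<longleftrightarrow>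
     (\<forall>\<tau> i. is_trigger (fst K) \<tau> \<and> enat i \<le> N \<and> loaded \<tau> (F i) \<longrightarrow>
        (\<exists>j\<ge>i. enat j \<le> N \<and> obsolete \<tau> (F j)))"

definition restricted_chase_sequence :: "kb \<Rightarrow> (nat \<Rightarrow> atom set) \<Rightarrow> enat \<Rightarrow> bool" where
  "restricted_chase_sequence K F N \<longleftrightarrow> restricted_chase_derivation K F N \<and> fair K F N"

definition CT_rest_all :: "kb set" where
  "CT_rest_all = {K. is_kb K \<and> (\<forall>F N. restricted_chase_sequence K F N \<longrightarrow> N \<noteq> \<infinity>)}"


section \<open>Encoding of knowledge bases\<close>

fun trm_encode :: "trm \<Rightarrow> nat" where
  "trm_encode (Var x) = 3 * x"
| "trm_encode (Const c) = 3 * c + 1"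
| "trm_encode (Null n) = 3 * n + 2"

definition atom_encode :: "atom \<Rightarrow> nat" where
  "atom_encode a = prod_encode (pred a, list_encode (map trm_encode (args a)))"

definition rule_encode :: "rule \<Rightarrow> nat" where
  "rule_encode R =
     prod_encode (list_encode (map atom_encode (body R)), list_encode (map atom_encode (head R)))"

definition kb_encode :: "rule list \<Rightarrow> atom list \<Rightarrow> nat" where
  "kb_encode rs fs =
     prod_encode (list_encode (map rule_encode rs), list_encode (map atom_encode fs))"

text \<open>
  The decision problem of a class of knowledge bases. Listing the rules and facts in another
  order yields another code of the same knowledge base.
\<close>

definition kb_codes :: "kb set \<Rightarrow> nat set" where
  "kb_codes C = {kb_encode rs fs | rs fs. (set rs, set fs) \<in> C}"

lemma inj_trm_encode: "inj trm_encode"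
proof (rule injI)
  fix s t assume "trm_encode s = trm_encode t"
  then show "s = t" by (cases s; cases t) (simp_all, presburger+)
qed

lemma inj_atom_encode: "inj atom_encode"
  by (rule injI)
    (auto simp: atom_encode_def list_encode_eq inj_map_eq_map[OF inj_trm_encode] intro: atom.expand)

lemma inj_rule_encode: "inj rule_encode"
  by (rule injI)
    (auto simp: rule_encode_def list_encode_eq inj_map_eq_map[OF inj_atom_encode] intro: rule.expand)

lemma kb_encode_eq_iff [simp]: "kb_encode rs fs = kb_encode rs' fs' \<longleftrightarrow> rs = rs' \<and> fs = fs'"
  by (auto simp: kb_encode_def list_encode_eq inj_map_eq_map[OF inj_atom_encode] inj_map_eq_map[OF inj_rule_encode])


section \<open>Computable functions and many-one reductions\<close>

datatype recf =
    Zero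
  | Succ
  | Proj nat
  | Comp recf "recf list"
  | PrimRec recf recf
  | Mu recf

text \<open>\<open>rec_eval f xs y\<close>: the partial recursive function \<open>f\<close> is defined on \<open>xs\<close> with value \<open>y\<close>.\<close>

inductive rec_eval :: "recf \<Rightarrow> nat list \<Rightarrow> nat \<Rightarrow> bool" where
  zero: "rec_eval Zero xs 0"
| succ: "rec_eval Succ [x] (Suc x)"
| proj: "i < length xs \<Longrightarrow> rec_eval (Proj i) xs (xs ! i)"
| comp: "list_all2 (\<lambda>g y. rec_eval g xs y) gs ys \<Longrightarrow> rec_eval f ys z \<Longrightarrow>
    rec_eval (Comp f gs) xs z"
| primrec_0: "rec_eval f xs y \<Longrightarrow> rec_eval (PrimRec f g) (0 # xs) y"
| primrec_Suc: "rec_eval (PrimRec f g) (n # xs) y \<Longrightarrow> rec_eval g (n # y # xs) z \<Longrightarrow>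
    rec_eval (PrimRec f g) (Suc n # xs) z"
| mu: "rec_eval f (n # xs) 0 \<Longrightarrow> (\<forall>m<n. \<exists>y>0. rec_eval f (m # xs) y) \<Longrightarrow>
    rec_eval (Mu f) xs n"

definition computable :: "(nat \<Rightarrow> nat) \<Rightarrow> bool" where
  "computable h \<longleftrightarrow> (\<exists>f. \<forall>x. rec_eval f [x] (h x))"

definition many_one_reducible :: "nat set \<Rightarrow> nat set \<Rightarrow> bool" where
  "many_one_reducible A B \<longleftrightarrow> (\<exists>h. computable h \<and> (\<forall>x. x \<in> A \<longleftrightarrow> h x \<in> B))"


section \<open>The class \<open>\<Pi>\<^sup>1\<^sub>1\<close> of the analytical hierarchy\<close>

text \<open>Second-order arithmetic, interpreted in the standard model.\<close>

datatype arith_trm =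
    NVar nat
  | NZero
  | NSuc arith_trm
  | NAdd arith_trm arith_trm
  | NMul arith_trm arith_trm

datatype arith_fm =
    Eq arith_trm arith_trm
  | Mem arith_trm nat
  | Neg arith_fm
  | Conj arith_fm arith_fm
  | AllNum nat arith_fm
  | AllSet nat arith_fm

fun arith_val :: "(nat \<Rightarrow> nat) \<Rightarrow> arith_trm \<Rightarrow> nat" where
  "arith_val \<nu> (NVar x) = \<nu> x"
| "arith_val \<nu> NZero = 0"
| "arith_val \<nu> (NSuc t) = Suc (arith_val \<nu> t)"
| "arith_val \<nu> (NAdd s t) = arith_val \<nu> s + arith_val \<nu> t"
| "arith_val \<nu> (NMul s t) = arith_val \<nu> s * arith_val \<nu> t"

fun arith_sat :: "(nat \<Rightarrow> nat) \<Rightarrow> (nat \<Rightarrow> nat set) \<Rightarrow> arith_fm \<Rightarrow> bool" where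
  "arith_sat \<nu> V (Eq s t) \<longleftrightarrow> arith_val \<nu> s = arith_val \<nu> t"
| "arith_sat \<nu> V (Mem t X) \<longleftrightarrow> arith_val \<nu> t \<in> V X"
| "arith_sat \<nu> V (Neg \<phi>) \<longleftrightarrow> \<not> arith_sat \<nu> V \<phi>"
| "arith_sat \<nu> V (Conj \<phi> \<psi>) \<longleftrightarrow> arith_sat \<nu> V \<phi> \<and> arith_sat \<nu> V \<psi>"
| "arith_sat \<nu> V (AllNum x \<phi>) \<longleftrightarrow> (\<forall>n. arith_sat (\<nu>(x := n)) V \<phi>)"
| "arith_sat \<nu> V (AllSet X \<phi>) \<longleftrightarrow> (\<forall>A. arith_sat \<nu> (V(X := A)) \<phi>)"

fun arithmetical :: "arith_fm \<Rightarrow> bool" where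
  "arithmetical (Eq s t) \<longleftrightarrow> True"
| "arithmetical (Mem t X) \<longleftrightarrow> True"
| "arithmetical (Neg \<phi>) \<longleftrightarrow> arithmetical \<phi>"
| "arithmetical (Conj \<phi> \<psi>) \<longleftrightarrow> arithmetical \<phi> \<and> arithmetical \<psi>"
| "arithmetical (AllNum x \<phi>) \<longleftrightarrow> arithmetical \<phi>"
| "arithmetical (AllSet X \<phi>) \<longleftrightarrow> False"

inductive pi11_fm :: "arith_fm \<Rightarrow> bool" where
  "arithmetical \<phi> \<Longrightarrow> pi11_fm \<phi>"
| "pi11_fm \<phi> \<Longrightarrow> pi11_fm (AllSet X \<phi>)"

text \<open>
  Quantifying over all valuations makes this the lightface class: membership of the value of
  variable \<open>0\<close> is expressed without number or set parameters.
\<close>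

definition pi11 :: "nat set \<Rightarrow> bool" where
  "pi11 A \<longleftrightarrow> (\<exists>\<phi>. pi11_fm \<phi> \<and> (\<forall>\<nu> V. \<nu> 0 \<in> A \<longleftrightarrow> arith_sat \<nu> V \<phi>))"

definition pi11_complete :: "nat set \<Rightarrow> bool" where
  "pi11_complete A \<longleftrightarrow> pi11 A \<and> (\<forall>B. pi11 B \<longrightarrow> many_one_reducible B A)"

end

theory Submission
  imports Defs "HOL-Library.Countable"
begin

text \<open>
  Membership. A fair infinite chase sequence is a sequence of fact sets, hence coded by a set of numbers,
  and being such a sequence is an arithmetical condition on that set.

  Hardness. The complement of a \<open>\<Pi>\<^sup>1\<^sub>1\<close> set consists of the \<open>x\<close> for which some set \<open>X\<close>, coding the set
  variables and a truth predicate for the subformulas, satisfies for all \<open>m\<close> one of finitely many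
  existentially quantified conjunctions of membership literals. The chase searches for \<open>X\<close>: it grows a
  tree, guesses for each new node of depth \<open>n\<close> whether \<open>n \<in> X\<close>, and evaluates the literals along each
  branch by Datalog rules. The search is divided into phases, and phase \<open>m\<close> may be left only when the
  condition for \<open>m\<close> has been verified. Each phase has a brake: a term that stops the phase as soon as a
  rule, whose application fairness enforces, declares it real. So in an infinite fair sequence no branch
  stays in a phase forever, and Koenig's lemma gives a branch with infinitely many phases, which is a
  solution. Conversely, a solution tells which guesses to make; the triggers for the other guesses become
  obsolete through a garbage term to which all nodes already extended are connected.
\<close>


section \<open>Chase derivations with total substitutions\<close>

text \<open>Whether a finitely branching tree has an infinite branch is, by Koenig's lemma, a
  question about every finite depth, so guessing bits and testing them stays within arithmetic. What
  lifts the problem above it is recurrence: the branch has to cross infinitely many phases, and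
  fairness can demand this. A brake is an obligation that must be met at some finite moment and then
  ends its phase; so each phase needs a brake of its own, and the rule that opens a phase invents
  it. The normal form fits because each instance of the condition, being existential, is verified by
  a finite part of the branch. Two features of the chase shape the rules. A trigger that is obsolete
  can never be applied, so garbage must stay disconnected from a node until that node has a real
  child. And all branches share one fact set, so every evaluated fact carries the world in which it
  holds.\<close>

fun tsubst :: "(nat \<Rightarrow> trm) \<Rightarrow> trm \<Rightarrow> trm" where
  "tsubst s (Var x) = s x"
| "tsubst s (Const c) = Const c"
| "tsubst s (Null n) = Null n"

definition asubst :: "(nat \<Rightarrow> trm) \<Rightarrow> atom \<Rightarrow> atom" where
  "asubst s a = Atom (pred a) (map (tsubst s) (args a))"

definition loads :: "rule \<Rightarrow> (nat \<Rightarrow> trm) \<Rightarrow> atom set \<Rightarrow> bool" where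
  "loads R s F \<longleftrightarrow> asubst s ` set (body R) \<subseteq> F"

definition blocked :: "rule \<Rightarrow> (nat \<Rightarrow> trm) \<Rightarrow> atom set \<Rightarrow> bool" where
  "blocked R s F \<longleftrightarrow> (\<exists>s'. (\<forall>x\<in>uvars R. s' x = s x) \<and> asubst s' ` set (head R) \<subseteq> F)"

definition fresh :: "rule \<Rightarrow> (nat \<Rightarrow> trm) \<Rightarrow> atom set \<Rightarrow> bool" where
  "fresh R s F \<longleftrightarrow> inj_on s (evars R) \<and> (\<forall>z\<in>evars R. \<exists>n. s z = Null n \<and> n \<notin> nulls F)"

text \<open>One substitution \<open>s\<close> serves as trigger and as output: loading and blocking
  look only at its values on the universal variables, freshness only at those on the existential
  ones.\<close>

definition step :: "rule set \<Rightarrow> atom set \<Rightarrow> atom set \<Rightarrow> bool" where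
  "step \<Sigma> F F' \<longleftrightarrow> (\<exists>R\<in>\<Sigma>. \<exists>s. loads R s F \<and> \<not> blocked R s F \<and> fresh R s F \<and>
     F' = F \<union> asubst s ` set (head R))"

definition infinite_chase :: "kb \<Rightarrow> (nat \<Rightarrow> atom set) \<Rightarrow> bool" where
  "infinite_chase K F \<longleftrightarrow> F 0 = snd K \<and> (\<forall>i. step (fst K) (F i) (F (Suc i))) \<and>
     (\<forall>R\<in>fst K. \<forall>s i. loads R s (F i) \<longrightarrow> (\<exists>j\<ge>i. blocked R s (F j)))"

lemma tsubst_cong: "(\<And>x. t = Var x \<Longrightarrow> s x = s' x) \<Longrightarrow> tsubst s t = tsubst s' t"
  by (cases t) auto

lemma asubst_cong: "(\<And>x. Var x \<in> set (args a) \<Longrightarrow> s x = s' x) \<Longrightarrow> asubst s a = asubst s' a"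
  by (auto simp: asubst_def intro!: tsubst_cong)

lemma loads_cong: "(\<And>x. x \<in> uvars R \<Longrightarrow> s x = s' x) \<Longrightarrow> loads R s F = loads R s' F"
proof -
  assume *: "\<And>x. x \<in> uvars R \<Longrightarrow> s x = s' x"
  have "asubst s ` set (body R) = asubst s' ` set (body R)"
    by (intro image_cong refl asubst_cong *) (auto simp: uvars_def vars_def)
  then show ?thesis by (simp add: loads_def)
qed

lemma blocked_cong: "(\<And>x. x \<in> uvars R \<Longrightarrow> s x = s' x) \<Longrightarrow> blocked R s F = blocked R s' F"
  by (simp add: blocked_def)

lemma blocked_mono: "blocked R s F \<Longrightarrow> F \<subseteq> F' \<Longrightarrow> blocked R s F'"
  unfolding blocked_def by blast

lemma loads_mono: "loads R s F \<Longrightarrow> F \<subseteq> F' \<Longrightarrow> loads R s F'"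
  unfolding loads_def by blast

text \<open>Cuts a total substitution down to the partial ones of triggers and extensions. Every
  partial substitution with domain \<open>U\<close> arises this way, so total ones lose
  nothing.\<close>

definition restr :: "(nat \<Rightarrow> trm) \<Rightarrow> nat set \<Rightarrow> subst" where
  "restr s U = (\<lambda>x. if x \<in> U then Some (s x) else None)"

lemma dom_restr [simp]: "dom (restr s U) = U"
  by (auto simp: restr_def dom_def)

lemma subst_atom_restr:
  assumes "\<And>x. Var x \<in> set (args a) \<Longrightarrow> x \<in> U"
  shows "subst_atom (restr s U) a = asubst s a"
proof -
  have "subst_trm (restr s U) t = tsubst s t" if "t \<in> set (args a)" for t
    using assms that by (cases t) (auto simp: restr_def)
  then show ?thesis by (simp add: subst_atom_def asubst_def)
qed

lemma restr_of_map: "dom \<sigma> = U \<Longrightarrow> \<sigma> = restr (the \<circ> \<sigma>) U"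
  by (auto simp: restr_def fun_eq_iff)

lemma is_trigger_iff:
  "is_trigger \<Sigma> \<tau> \<longleftrightarrow> (\<exists>R\<in>\<Sigma>. \<exists>s. \<tau> = (R, restr s (uvars R)))"
proof (cases \<tau>)
  case (Pair R \<sigma>)
  show ?thesis
  proof
    assume "is_trigger \<Sigma> \<tau>"
    then show "\<exists>R\<in>\<Sigma>. \<exists>s. \<tau> = (R, restr s (uvars R))"
      using restr_of_map[of \<sigma> "uvars R"] by (auto simp: Pair is_trigger_def)
  qed (clarsimp simp only: is_trigger_def fst_conv snd_conv dom_restr simp_thms)
qed

lemma loaded_restr: "loaded (R, restr s (uvars R)) F \<longleftrightarrow> loads R s F"
proof -
  have "subst_atom (restr s (uvars R)) ` set (body R) = asubst s ` set (body R)"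
    by (intro image_cong refl subst_atom_restr) (auto simp: uvars_def vars_def)
  then show ?thesis by (simp add: loaded_def loads_def)
qed

lemma head_image_restr:
  "subst_atom (restr s (uvars R \<union> evars R)) ` set (head R) = asubst s ` set (head R)"
  by (intro image_cong refl subst_atom_restr) (auto simp: evars_def vars_def)

lemma is_extension_iff:
  "is_extension (R, restr s (uvars R)) \<sigma> \<longleftrightarrow>
     (\<exists>s'. (\<forall>x\<in>uvars R. s' x = s x) \<and> \<sigma> = restr s' (uvars R \<union> evars R))"
proof
  assume a: "is_extension (R, restr s (uvars R)) \<sigma>"
  then have d: "\<sigma> = restr (the \<circ> \<sigma>) (uvars R \<union> evars R)"
    by (auto simp: is_extension_def intro: restr_of_map)
  have "(the \<circ> \<sigma>) x = s x" if "x \<in> uvars R" for x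
    using a that by (simp add: is_extension_def map_le_def) (metis option.sel restr_def)
  with d show "\<exists>s'. (\<forall>x\<in>uvars R. s' x = s x) \<and> \<sigma> = restr s' (uvars R \<union> evars R)" by blast
next
  assume "\<exists>s'. (\<forall>x\<in>uvars R. s' x = s x) \<and> \<sigma> = restr s' (uvars R \<union> evars R)"
  then show "is_extension (R, restr s (uvars R)) \<sigma>"
    by (clarsimp simp only: is_extension_def map_le_def dom_restr fst_conv snd_conv) (simp add: restr_def)
qed

lemma obsolete_restr: "obsolete (R, restr s (uvars R)) F \<longleftrightarrow> blocked R s F"
proof
  assume "obsolete (R, restr s (uvars R)) F"
  then obtain s' where "\<forall>x\<in>uvars R. s' x = s x"
    "subst_atom (restr s' (uvars R \<union> evars R)) ` set (head R) \<subseteq> F"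
    unfolding obsolete_def is_extension_iff fst_conv by blast
  then show "blocked R s F" unfolding head_image_restr blocked_def by blast
next
  assume "blocked R s F"
  then obtain s' where "\<forall>x\<in>uvars R. s' x = s x" "asubst s' ` set (head R) \<subseteq> F"
    unfolding blocked_def by blast
  then show "obsolete (R, restr s (uvars R)) F"
    unfolding obsolete_def is_extension_iff fst_conv head_image_restr[symmetric] by blast
qed

lemma is_output_restr: "is_output F (R, restr s (uvars R)) H \<longleftrightarrow>
   (\<exists>s'. (\<forall>x\<in>uvars R. s' x = s x) \<and> fresh R s' F \<and> H = asubst s' ` set (head R))"
proof -
  have 1: "inj_on (restr s' (uvars R \<union> evars R)) (evars R) = inj_on s' (evars R)" for s'
    by (auto simp: inj_on_def restr_def)
  have 2: "(\<forall>z\<in>evars R. \<exists>n. restr s' (uvars R \<union> evars R) z = Some (Null n) \<and> n \<notin> nulls F) =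
     (\<forall>z\<in>evars R. \<exists>n. s' z = Null n \<and> n \<notin> nulls F)" for s'
    by (auto simp: restr_def)
  have "is_output F (R, restr s (uvars R)) H \<longleftrightarrow>
    (\<exists>s'. (\<forall>x\<in>uvars R. s' x = s x) \<and> inj_on (restr s' (uvars R \<union> evars R)) (evars R) \<and>
      (\<forall>z\<in>evars R. \<exists>n. restr s' (uvars R \<union> evars R) z = Some (Null n) \<and> n \<notin> nulls F) \<and>
      H = subst_atom (restr s' (uvars R \<union> evars R)) ` set (head R))"
    unfolding is_output_def is_extension_iff fst_conv by blast
  then show ?thesis
    unfolding 1 2 head_image_restr fresh_def by blast
qed

lemma step_iff:
  "step \<Sigma> F F' \<longleftrightarrow> (\<exists>\<tau> H. applicable \<Sigma> F \<tau> \<and> is_output F \<tau> H \<and> F' = F \<union> H)"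
proof
  assume "step \<Sigma> F F'"
  then obtain R s where "R \<in> \<Sigma>" "loads R s F" "\<not> blocked R s F" "fresh R s F"
    "F' = F \<union> asubst s ` set (head R)" by (auto simp: step_def)
  then show "\<exists>\<tau> H. applicable \<Sigma> F \<tau> \<and> is_output F \<tau> H \<and> F' = F \<union> H"
    by (intro exI[of _ "(R, restr s (uvars R))"] exI[of _ "asubst s ` set (head R)"])
      (auto simp: applicable_def is_trigger_iff loaded_restr obsolete_restr is_output_restr)
next
  assume "\<exists>\<tau> H. applicable \<Sigma> F \<tau> \<and> is_output F \<tau> H \<and> F' = F \<union> H"
  then obtain R s s' where *: "R \<in> \<Sigma>" "loads R s F" "\<not> blocked R s F" "fresh R s' F"
    "F' = F \<union> asubst s' ` set (head R)" "\<forall>x\<in>uvars R. s' x = s x"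
    by (auto simp: applicable_def is_trigger_iff loaded_restr obsolete_restr is_output_restr)
  then have "loads R s' F" "\<not> blocked R s' F"
    using loads_cong[of R s s' F] blocked_cong[of R s s' F] by auto
  with * show "step \<Sigma> F F'" by (auto simp: step_def)
qed

lemma infinite_chase_iff: "infinite_chase K F \<longleftrightarrow> restricted_chase_sequence K F \<infinity>"
proof -
  have "fair K F \<infinity> \<longleftrightarrow>
     (\<forall>R\<in>fst K. \<forall>s i. loads R s (F i) \<longrightarrow> (\<exists>j\<ge>i. blocked R s (F j)))"
  proof
    assume f: "fair K F \<infinity>"
    show "\<forall>R\<in>fst K. \<forall>s i. loads R s (F i) \<longrightarrow> (\<exists>j\<ge>i. blocked R s (F j))"
    proof (intro ballI allI impI)
      fix R s i assume "R \<in> fst K" "loads R s (F i)"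
      then have "is_trigger (fst K) (R, restr s (uvars R))" "loaded (R, restr s (uvars R)) (F i)"
        by (auto simp: is_trigger_iff loaded_restr)
      then have "\<exists>j\<ge>i. obsolete (R, restr s (uvars R)) (F j)"
        using f unfolding fair_def by fastforce
      then show "\<exists>j\<ge>i. blocked R s (F j)" by (simp add: obsolete_restr)
    qed
  qed (auto simp: fair_def is_trigger_iff loaded_restr obsolete_restr)
  then show ?thesis
    by (simp add: infinite_chase_def restricted_chase_sequence_def restricted_chase_derivation_def
        step_iff)
qed

lemma CT_rest_all_iff: "K \<in> CT_rest_all \<longleftrightarrow> is_kb K \<and> \<not> (\<exists>F. infinite_chase K F)"
  unfolding CT_rest_all_def infinite_chase_iff mem_Collect_eq by metis

text \<open>The output of a trigger would itself witness that the trigger is obsolete, so an applied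
  trigger adds a new fact.\<close>

lemma step_growing:
  assumes "step \<Sigma> F F'" shows "F \<subset> F'"
proof -
  obtain R s where *: "\<not> blocked R s F" "F' = F \<union> asubst s ` set (head R)"
    using assms by (auto simp: step_def)
  then have "\<not> asubst s ` set (head R) \<subseteq> F" by (auto simp: blocked_def)
  with * show ?thesis by blast
qed


section \<open>The knowledge base of a clause system\<close>

datatype ptm = PV nat | PZero | PSuc ptm | PPair ptm ptm

instance ptm :: countable
  by countable_datatype

primrec peval :: "(nat \<Rightarrow> nat) \<Rightarrow> ptm \<Rightarrow> nat" where
  "peval \<nu> (PV n) = \<nu> n"
| "peval \<nu> PZero = 0"
| "peval \<nu> (PSuc t) = Suc (peval \<nu> t)"
| "peval \<nu> (PPair s t) = prod_encode (peval \<nu> s, peval \<nu> t)"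

type_synonym clause = "ptm \<times> (bool \<times> ptm) list"

text \<open>
  The variable \<open>PV 0\<close> is reserved for the input \<open>x\<close>. The number \<open>0\<close> is kept out of \<open>X\<close> because it
  will be the root of the tree, whose bit is not guessed.
\<close>

definition meets :: "nat set \<Rightarrow> nat \<Rightarrow> clause \<Rightarrow> nat \<Rightarrow> bool" where
  "meets X x c m \<longleftrightarrow> (\<exists>\<nu>. \<nu> 0 = x \<and> peval \<nu> (fst c) = m \<and>
     (\<forall>(b, t)\<in>set (snd c). (peval \<nu> t \<in> X) = b))"

definition solvable :: "clause list \<Rightarrow> nat \<Rightarrow> bool" where
  "solvable G x \<longleftrightarrow> (\<exists>X. 0 \<notin> X \<and> (\<forall>m. \<exists>c\<in>set G. meets X x c m))"

text \<open>With a pair as pattern, the variable naming the pattern occurs in the body of the clause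
  rule, which then has no existential variables, and the pairing atom ties its value to the
  branch.\<close>

definition pair_patterns :: "clause list \<Rightarrow> bool" where
  "pair_patterns G \<longleftrightarrow> (\<forall>c\<in>set G. \<exists>s t. fst c = PPair s t)"

text \<open>
  The terms of the chase are nodes and brakes. A node is a number (its depth) and also a world, namely
  the branch leading to it; \<open>rt\<close> is the root, \<open>bt\<close> the first brake, and \<open>gt\<close> a garbage term.
  \<^item> \<open>aCh v z\<close>: \<open>z\<close> is a child of \<open>v\<close>, or the brake of \<open>v\<close>;
  \<^item> \<open>aCol b q z\<close>: \<open>b\<close> is the bit guessed for \<open>z\<close>, and \<open>q\<close> says whether \<open>z\<close> opens a phase;
  \<^item> \<open>aR z\<close>: \<open>z\<close> is real; \<open>aB w\<close>: \<open>w\<close> is a brake; \<open>aK c v\<close>: the current goal in world \<open>v\<close> is \<open>c\<close>;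
  \<^item> \<open>aW t a b c v\<close>: in world \<open>v\<close> the relation tagged \<open>t\<close> holds of \<open>a, b, c\<close>, padded with \<open>gt\<close>. The tags
    stand for successor, pairing, the bits, the input, reached goals, and zero.

  Tags and bits share constants with the special terms; they never occur in the same argument place.
\<close>

abbreviation "aCh x y \<equiv> Atom 0 [x, y]"
abbreviation "aCol b q z \<equiv> Atom 6 [b, q, z]"
abbreviation "aR z \<equiv> Atom 2 [z]"
abbreviation "aB w \<equiv> Atom 3 [w]"
abbreviation "aK c v \<equiv> Atom 4 [c, v]"
abbreviation "aW t a b c v \<equiv> Atom 5 [t, a, b, c, v]"

abbreviation "gt \<equiv> Const 0"
abbreviation "rt \<equiv> Const 3"
abbreviation "bt \<equiv> Const 2"
abbreviation "tS \<equiv> Const 0"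
abbreviation "tP \<equiv> Const 6"
abbreviation "tX \<equiv> Const 2"
abbreviation "tI \<equiv> Const 3"
abbreviation "tG \<equiv> Const 4"
abbreviation "tZ \<equiv> Const 5"

definition bc :: "bool \<Rightarrow> trm" where
  "bc b = Const (if b then 2 else 0)"

lemma bc_eq_iff [simp]: "bc b = bc b' \<longleftrightarrow> b = b'"
  by (auto simp: bc_def)

lemma tsubst_bc [simp]: "tsubst s (bc b) = bc b"
  by (simp add: bc_def)

lemma Var_bc [simp]: "Var x \<noteq> bc b" "bc b \<noteq> Var x" "Null n \<noteq> bc b" "bc b \<noteq> Null n"
  by (auto simp: bc_def)

text \<open>
  The edge from a new node \<open>z\<close> to its brake \<open>w\<close> is created together with \<open>z\<close>. So as soon as \<open>w\<close> becomes
  real, \<open>w\<close> itself witnesses the heads for all present and future nodes of the phase.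
\<close>

definition choice_rule :: "bool \<Rightarrow> rule" where
  "choice_rule b = Rule [aR (Var 0), aCh (Var 0) (Var 1), aB (Var 1)]
     [aCh (Var 0) (Var 2), aCol (bc b) (bc False) (Var 2), aR (Var 2), aCh (Var 2) (Var 1)]"

text \<open>\<open>Var 4\<close> is the current goal, which must have been reached. The head gives
  the new brake the facts that the database holds for \<open>bt\<close>: its loop and its four
  colours let it stand in for any child, and the edge from \<open>gt\<close> lets \<open>gt\<close>
  stand in for a child carrying this brake.\<close>

definition phase_rule :: "bool \<Rightarrow> rule" where
  "phase_rule b = Rule
     [aR (Var 0), aCh (Var 0) (Var 1), aB (Var 1), aK (Var 4) (Var 0), aW tG (Var 4) gt gt (Var 0)]
     [aCh (Var 0) (Var 2), aCol (bc b) (bc True) (Var 2), aR (Var 2), aCh (Var 2) (Var 3),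
      aCh (Var 3) (Var 3), aB (Var 3), aCh gt (Var 3),
      aCol (bc False) (bc False) (Var 3), aCol (bc False) (bc True) (Var 3),
      aCol (bc True) (bc False) (Var 3), aCol (bc True) (bc True) (Var 3)]"

text \<open>The first rule attaches garbage only where there is a real child. The third makes a
  child the successor of its parent, since numbers are depths. The fifth and sixth walk along the
  diagonals of \<open>prod_encode\<close>: the code following that of \<open>(a, Suc b)\<close>
  belongs to \<open>(Suc a, b)\<close>, and the one following that of \<open>(a, 0)\<close> to
  \<open>(0, Suc a)\<close>. The last two keep the goal within a phase and advance it at the node
  opening the next one.\<close>

definition base_rules :: "rule list" where
  "base_rules =
    [Rule [aCh (Var 0) (Var 1), aR (Var 1)] [aCh (Var 0) gt],
     Rule [aW (Var 0) (Var 1) (Var 2) (Var 3) (Var 4), aCh (Var 4) (Var 5)]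
       [aW (Var 0) (Var 1) (Var 2) (Var 3) (Var 5)],
     Rule [aCh (Var 0) (Var 1)] [aW tS (Var 0) (Var 1) gt (Var 1)],
     Rule [aCol (Var 0) (Var 1) (Var 2)] [aW tX (Var 0) (Var 2) gt (Var 2)],
     Rule [aW tP (Var 0) (Var 1) (Var 2) (Var 6), aW tS (Var 3) (Var 1) gt (Var 6),
           aW tS (Var 0) (Var 4) gt (Var 6), aW tS (Var 2) (Var 5) gt (Var 6)]
       [aW tP (Var 4) (Var 3) (Var 5) (Var 6)],
     Rule [aW tP (Var 0) rt (Var 1) (Var 6),
           aW tS (Var 0) (Var 2) gt (Var 6), aW tS (Var 1) (Var 3) gt (Var 6)]
       [aW tP rt (Var 2) (Var 3) (Var 6)],
     Rule [aK (Var 0) (Var 1), aCh (Var 1) (Var 2), aCol (Var 3) (bc False) (Var 2)]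
       [aK (Var 0) (Var 2)],
     Rule [aK (Var 0) (Var 1), aCh (Var 1) (Var 2), aCol (Var 3) (bc True) (Var 2),
           aW tS (Var 0) (Var 4) gt (Var 2)]
       [aK (Var 4) (Var 2)]]"

definition brake_rule :: rule where
  "brake_rule = Rule [aB (Var 0)] [aR (Var 0)]"

text \<open>The input becomes a chain of successor atoms starting at zero, with \<open>Var 0\<close>
  as the world and \<open>Var (Suc i)\<close> for the number \<open>i\<close>. No other rule depends
  on the input.\<close>

fun input_body :: "nat \<Rightarrow> atom list" where
  "input_body 0 = [aW tZ (Var 1) gt gt (Var 0)]"
| "input_body (Suc i) = aW tS (Var (Suc i)) (Var (Suc (Suc i))) gt (Var 0) # input_body i"

definition input_rule :: "nat \<Rightarrow> rule" where
  "input_rule x = Rule (input_body x) [aW tI (Var (Suc x)) gt gt (Var 0)]"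

text \<open>The shift by one keeps variable \<open>0\<close> free for the world.\<close>

definition vn :: "ptm \<Rightarrow> nat" where
  "vn t = Suc (to_nat t)"

abbreviation "tv t \<equiv> Var (vn t)"

text \<open>Each subterm of a clause is named by its own variable, so that no fresh names have to be managed.\<close>

fun flat :: "ptm \<Rightarrow> atom list" where
  "flat (PV n) = []"
| "flat PZero = [aW tZ (tv PZero) gt gt (Var 0)]"
| "flat (PSuc t) = aW tS (tv t) (tv (PSuc t)) gt (Var 0) # flat t"
| "flat (PPair s t) = aW tP (tv s) (tv t) (tv (PPair s t)) (Var 0) # flat s @ flat t"

definition clause_rule :: "clause \<Rightarrow> rule" where
  "clause_rule c = Rule
     (aW tI (tv (PV 0)) gt gt (Var 0) # flat (fst c) @
        concat (map (\<lambda>(b, t). aW tX (bc b) (tv t) gt (Var 0) # flat t) (snd c)))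
     [aW tG (tv (fst c)) gt gt (Var 0)]"

definition fixed_rules :: "clause list \<Rightarrow> rule list" where
  "fixed_rules G = [choice_rule False, choice_rule True, phase_rule False, phase_rule True, brake_rule] @
     base_rules @ map clause_rule G"

text \<open>The root is the number zero: it is outside \<open>X\<close>, it is the first goal, and
  \<open>prod_encode (0, 0) = 0\<close>. It has no colour. The garbage term is a brake that is real
  from the start and has all colours; so, given the edges from \<open>gt\<close> to all brakes, an
  edge from a node to \<open>gt\<close> settles every choice and phase head at that node.\<close>

definition dbase :: "atom list" where
  "dbase =
    [aR rt, aCh rt bt, aK rt rt, aW tP rt rt rt rt, aW tX (bc False) rt gt rt, aW tZ rt gt gt rt,
     aCh bt bt, aB bt, aCh gt bt,
     aCol (bc False) (bc False) bt, aCol (bc False) (bc True) bt,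
     aCol (bc True) (bc False) bt, aCol (bc True) (bc True) bt,
     aCh gt gt, aR gt, aB gt,
     aCol (bc False) (bc False) gt, aCol (bc False) (bc True) gt,
     aCol (bc True) (bc False) gt, aCol (bc True) (bc True) gt]"

definition rules :: "clause list \<Rightarrow> nat \<Rightarrow> rule set" where
  "rules G x = set (input_rule x # fixed_rules G)"

definition datalog :: "clause list \<Rightarrow> nat \<Rightarrow> rule set" where
  "datalog G x = insert (input_rule x) (set base_rules \<union> clause_rule ` set G)"

lemma rules_eq: "rules G x = datalog G x \<union>
    {brake_rule, choice_rule False, choice_rule True, phase_rule False, phase_rule True}"
  by (auto simp: rules_def datalog_def fixed_rules_def)

lemma input_body_head: "\<exists>a\<in>set (input_body x). Var (Suc x) \<in> set (args a)"
  "\<exists>a\<in>set (input_body x). Var 0 \<in> set (args a)"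
  by (induction x) auto

lemma vars_insert: "vars (insert a (insert b A)) = vars {a} \<union> vars (insert b A)" "vars {} = {}"
  by (auto simp: vars_def)

lemma vars_atom [simp]:
  "vars {Atom p []} = {}"
  "vars {Atom p (Var x # ts)} = insert x (vars {Atom p ts})"
  "vars {Atom p (Const c # ts)} = vars {Atom p ts}"
  "vars {Atom p (bc b # ts)} = vars {Atom p ts}"
  by (auto simp: vars_def)

lemma evars_datalog:
  assumes "pair_patterns G" "R \<in> datalog G x"
  shows "evars R = {}" "\<exists>a. head R = [a]"
proof -
  have c: "evars (clause_rule c) = {}" if c: "c \<in> set G" for c
  proof -
    obtain s t where "fst c = PPair s t" using assms(1) c unfolding pair_patterns_def by blast
    then show ?thesis
      by (auto simp: evars_def uvars_def vars_def clause_rule_def)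
  qed
  have i: "evars (input_rule x) = {}"
    using input_body_head[of x] by (auto simp: evars_def uvars_def vars_def input_rule_def)
  have b: "evars R = {} \<and> (\<exists>a. head R = [a])" if "R \<in> set base_rules"
    using that unfolding base_rules_def
    by (simp only: list.set insert_iff empty_iff, elim disjE)
      (simp_all add: evars_def uvars_def vars_insert del: One_nat_def)
  show "evars R = {}" "\<exists>a. head R = [a]"
    using c i b assms(2) by (auto simp: datalog_def clause_rule_def input_rule_def)
qed

lemma uvars_choice: "uvars (choice_rule b) = {0, 1}" "evars (choice_rule b) = {2}"
  by (auto simp: uvars_def evars_def vars_insert choice_rule_def)

lemma uvars_phase: "uvars (phase_rule b) = {0, 1, 4}" "evars (phase_rule b) = {2, 3}"
  by (auto simp: uvars_def evars_def vars_insert phase_rule_def)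

lemma uvars_brake: "uvars brake_rule = {0}" "evars brake_rule = {}"
  by (auto simp: uvars_def evars_def vars_def brake_rule_def)

section \<open>Loading and blocking of the individual rules\<close>

definition cols :: "trm \<Rightarrow> atom set" where
  "cols u = {aCol (bc b) (bc q) u | b q. True}"

lemma cols_eq: "cols u = {aCol (bc False) (bc False) u, aCol (bc False) (bc True) u,
    aCol (bc True) (bc False) u, aCol (bc True) (bc True) u}"
  unfolding cols_def by (auto simp: ex_bool_eq)

definition choice_facts :: "bool \<Rightarrow> trm \<Rightarrow> trm \<Rightarrow> trm \<Rightarrow> atom set" where
  "choice_facts b v w z = {aCh v z, aCol (bc b) (bc False) z, aR z, aCh z w}"

definition phase_facts :: "bool \<Rightarrow> trm \<Rightarrow> trm \<Rightarrow> trm \<Rightarrow> atom set" where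
  "phase_facts b v z u = {aCh v z, aCol (bc b) (bc True) z, aR z, aCh z u, aCh u u, aB u, aCh gt u}
     \<union> cols u"

lemma choice_head: "asubst s ` set (head (choice_rule b)) = choice_facts b (s 0) (s 1) (s 2)"
  by (auto simp: choice_rule_def asubst_def choice_facts_def)

lemma phase_head: "asubst s ` set (head (phase_rule b)) = phase_facts b (s 0) (s 2) (s 3)"
  by (auto simp: phase_rule_def asubst_def phase_facts_def cols_eq)

lemma loads_choice: "loads (choice_rule b) s F \<longleftrightarrow> {aR (s 0), aCh (s 0) (s 1), aB (s 1)} \<subseteq> F"
  by (auto simp: loads_def choice_rule_def asubst_def)

lemma loads_phase: "loads (phase_rule b) s F \<longleftrightarrow>
    {aR (s 0), aCh (s 0) (s 1), aB (s 1), aK (s 4) (s 0), aW tG (s 4) gt gt (s 0)} \<subseteq> F"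
  by (auto simp: loads_def phase_rule_def asubst_def)

lemma blocked_choice: "blocked (choice_rule b) s F \<longleftrightarrow> (\<exists>z. choice_facts b (s 0) (s 1) z \<subseteq> F)"
proof
  assume "\<exists>z. choice_facts b (s 0) (s 1) z \<subseteq> F"
  then obtain z where "choice_facts b (s 0) (s 1) z \<subseteq> F" ..
  then show "blocked (choice_rule b) s F"
    unfolding blocked_def choice_head uvars_choice by (intro exI[of _ "s(2 := z)"]) auto
qed (unfold blocked_def choice_head uvars_choice, clarsimp, blast)

lemma blocked_phase: "blocked (phase_rule b) s F \<longleftrightarrow> (\<exists>z u. phase_facts b (s 0) z u \<subseteq> F)"
proof
  assume "\<exists>z u. phase_facts b (s 0) z u \<subseteq> F"
  then obtain z u where "phase_facts b (s 0) z u \<subseteq> F" by blast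
  then show "blocked (phase_rule b) s F"
    unfolding blocked_def phase_head uvars_phase by (intro exI[of _ "s(2 := z, 3 := u)"]) auto
qed (unfold blocked_def phase_head uvars_phase, clarsimp, blast)

lemma blocked_brake: "blocked brake_rule s F \<longleftrightarrow> aR (s 0) \<in> F"
  unfolding blocked_def uvars_brake by (auto simp: brake_rule_def asubst_def)

lemma loads_brake: "loads brake_rule s F \<longleftrightarrow> aB (s 0) \<in> F"
  by (auto simp: loads_def brake_rule_def asubst_def)

lemma blocked_datalog:
  assumes "evars R = {}" "head R = [a]"
  shows "blocked R s F \<longleftrightarrow> asubst s a \<in> F"
proof -
  have *: "asubst s' a = asubst s a" if "\<forall>x\<in>uvars R. s' x = s x" for s'
    using that assms by (intro asubst_cong) (auto simp: evars_def vars_def)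
  have "blocked R s F \<longleftrightarrow> (\<exists>s'. (\<forall>x\<in>uvars R. s' x = s x) \<and> asubst s' a \<in> F)"
    by (simp add: blocked_def assms(2))
  also have "\<dots> \<longleftrightarrow> asubst s a \<in> F" using * by metis
  finally show ?thesis .
qed

lemma step_cases:
  assumes "step (rules G x) F F'" "pair_patterns G"
  obtains
    (datalog) R s a where "R \<in> datalog G x" "loads R s F" "head R = [a]" "F' = insert (asubst s a) F"
  | (brake) w where "aB w \<in> F" "F' = insert (aR w) F"
  | (choice) b v w n where "aR v \<in> F" "aCh v w \<in> F" "aB w \<in> F"
      "\<not> (\<exists>z. choice_facts b v w z \<subseteq> F)" "n \<notin> nulls F" "F' = F \<union> choice_facts b v w (Null n)"
  | (phase) b v w c n m where "aR v \<in> F" "aCh v w \<in> F" "aB w \<in> F" "aK c v \<in> F"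
      "aW tG c gt gt v \<in> F" "\<not> (\<exists>z u. phase_facts b v z u \<subseteq> F)"
      "n \<notin> nulls F" "m \<notin> nulls F" "n \<noteq> m" "F' = F \<union> phase_facts b v (Null n) (Null m)"
proof -
  obtain R s where R: "R \<in> rules G x" "loads R s F" "\<not> blocked R s F" "fresh R s F"
    "F' = F \<union> asubst s ` set (head R)" using assms(1) by (auto simp: step_def)
  consider "R \<in> datalog G x" | "R = brake_rule" | b where "R = choice_rule b"
    | b where "R = phase_rule b"
    using R(1) unfolding rules_eq by auto
  then show thesis
  proof cases
    case 1
    then obtain a where "head R = [a]" using evars_datalog[OF assms(2)] by blast
    with 1 R datalog[of R s a] show ?thesis by auto
  next
    case 2
    have "aB (s 0) \<in> F" "F' = insert (aR (s 0)) F"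
      using R(2,5) unfolding 2 loads_brake by (auto simp: brake_rule_def asubst_def)
    then show ?thesis by (rule brake)
  next
    case 3
    obtain n where n: "s 2 = Null n" "n \<notin> nulls F"
      using R(4) unfolding 3 fresh_def uvars_choice by blast
    show ?thesis
      by (rule choice[of "s 0" "s 1" b n])
        (use R(2,3,5) n in \<open>simp_all add: 3 loads_choice blocked_choice choice_head\<close>)
  next
    case 4
    obtain n m where n: "s 2 = Null n" "n \<notin> nulls F" "s 3 = Null m" "m \<notin> nulls F"
      using R(4) unfolding 4 fresh_def uvars_phase by blast
    have "n \<noteq> m" using R(4) n unfolding 4 fresh_def uvars_phase inj_on_def by auto
    show ?thesis
      by (rule phase[of "s 0" "s 1" "s 4" b n m])
        (use R(2,3,5) n \<open>n \<noteq> m\<close> in \<open>simp_all add: 4 loads_phase blocked_phase phase_head\<close>)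
  qed
qed


section \<open>Structure of arbitrary derivations\<close>

text \<open>A crude finite bound on the facts over finitely many terms. It makes saturation between
  two node creations terminate, and it forces an infinite sequence to create infinitely many nodes.
  The longest atoms are those of \<open>aW\<close>, the largest predicate name is that of
  \<open>aCol\<close>, the largest constant is \<open>tP\<close>.\<close>

definition shaped :: "trm set \<Rightarrow> atom set" where
  "shaped T = {Atom p l | p l. p \<le> 6 \<and> length l \<le> 5 \<and> set l \<subseteq> T}"

abbreviation "const_terms \<equiv> Const ` {..<7}"

lemma finite_shaped: "finite T \<Longrightarrow> finite (shaped T)"
proof -
  assume "finite T"
  then have "finite {l. set l \<subseteq> T \<and> length l \<le> 5}" by (rule finite_lists_length_le)
  then have "finite ((\<lambda>(p, l). Atom p l) ` ({..6} \<times> {l. set l \<subseteq> T \<and> length l \<le> 5}))" by simp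
  moreover have "shaped T \<subseteq> (\<lambda>(p, l). Atom p l) ` ({..6} \<times> {l. set l \<subseteq> T \<and> length l \<le> 5})"
    by (auto simp: shaped_def)
  ultimately show ?thesis by (rule rev_finite_subset)
qed

lemma shaped_mono: "T \<subseteq> T' \<Longrightarrow> shaped T \<subseteq> shaped T'"
  by (auto simp: shaped_def)

lemma shaped_iff [simp]: "Atom p l \<in> shaped T \<longleftrightarrow> p \<le> 6 \<and> length l \<le> 5 \<and> set l \<subseteq> T"
  by (simp add: shaped_def)

lemma bc_consts [simp]: "bc b \<in> const_terms"
  by (auto simp: bc_def)

text \<open>Datalog rules create no nodes, brakes or colours, and the only edges they derive end in
  \<open>gt\<close>. So they leave the tree alone.\<close>

lemma datalog_head:
  assumes "R \<in> datalog G x" "head R = [a]"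
  shows "pred a \<in> {4, 5} \<or> (\<exists>t. a = aCh t gt)" "length (args a) \<le> 5"
    "t \<in> set (args a) \<Longrightarrow> (\<exists>y. t = Var y) \<or> t \<in> const_terms"
proof -
  have b: "(pred a \<in> {4, 5} \<or> (\<exists>t. a = aCh t gt)) \<and> length (args a) \<le> 5 \<and>
      (t \<in> set (args a) \<longrightarrow> (\<exists>y. t = Var y) \<or> t \<in> const_terms)" if "R \<in> set base_rules"
    using that assms(2) unfolding base_rules_def by auto
  show "pred a \<in> {4, 5} \<or> (\<exists>t. a = aCh t gt)" "length (args a) \<le> 5"
    "t \<in> set (args a) \<Longrightarrow> (\<exists>y. t = Var y) \<or> t \<in> const_terms"
    using b assms by (auto simp: datalog_def input_rule_def clause_rule_def)
qed

lemma datalog_shaped: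
  assumes "pair_patterns G" "R \<in> datalog G x" "head R = [a]" "loads R s F"
    "F \<subseteq> shaped T" "const_terms \<subseteq> T"
  shows "asubst s a \<in> shaped T" "pred (asubst s a) \<in> {4, 5} \<or> (\<exists>t. asubst s a = aCh t gt)"
proof -
  have "tsubst s t \<in> T" if t: "t \<in> set (args a)" for t
  proof -
    from datalog_head(3)[OF assms(2,3) t] consider y where "t = Var y" | "t \<in> const_terms" by blast
    then show ?thesis
    proof cases
      case 1
      then have "y \<in> uvars R"
        using evars_datalog(1)[OF assms(1,2)] t assms(3) by (auto simp: evars_def vars_def)
      then obtain c where "c \<in> set (body R)" "Var y \<in> set (args c)"
        by (auto simp: uvars_def vars_def)
      then have "asubst s c \<in> F" "s y \<in> set (args (asubst s c))"
        using assms(4) image_eqI[of "s y" "tsubst s" "Var y"]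
        by (auto simp: loads_def) (simp add: asubst_def)
      then have "asubst s c \<in> shaped T" "s y \<in> set (args (asubst s c))" using assms(5) by auto
      then show ?thesis using 1 by (auto simp: shaped_def)
    qed (use assms(6) in auto)
  qed
  then show "asubst s a \<in> shaped T" "pred (asubst s a) \<in> {4, 5} \<or> (\<exists>t. asubst s a = aCh t gt)"
    using datalog_head[OF assms(2,3)] by (auto simp: asubst_def)
qed

definition node_facts :: "bool \<Rightarrow> bool \<Rightarrow> trm \<Rightarrow> trm \<Rightarrow> trm \<Rightarrow> atom set" where
  "node_facts b q v z u = {aCh v z, aCol (bc b) (bc q) z, aR z, aCh z u}"

definition brake_facts :: "trm \<Rightarrow> atom set" where
  "brake_facts u = {aCh u u, aB u, aCh gt u} \<union> cols u"

lemma choice_facts_eq: "choice_facts b v w z = node_facts b False v z w"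
  by (simp add: choice_facts_def node_facts_def)

lemma phase_facts_eq: "phase_facts b v z u = node_facts b True v z u \<union> brake_facts u"
  by (auto simp: phase_facts_def node_facts_def brake_facts_def)

lemma Null_fresh: "n \<notin> nulls F \<Longrightarrow> Atom p l \<in> F \<Longrightarrow> Null n \<notin> set l"
  by (force simp: nulls_def)

text \<open>The legitimate nodes of the tree: a brake does not become one by turning real, and
  \<open>gt\<close> is not one either.\<close>

definition Leg :: "atom set \<Rightarrow> trm set" where
  "Leg F = {z. aR z \<in> F \<and> aB z \<notin> F}"

definition child :: "atom set \<Rightarrow> (trm \<times> trm) set" where
  "child F = {(v, z). aCh v z \<in> F \<and> z \<in> Leg F}"

text \<open>What survives every order of rule applications: the legitimate nodes form a tree with at
  most one child per colour, and each node has one brake apart from \<open>gt\<close>, inherited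
  within a phase. Junk edges into \<open>gt\<close> and between brakes are unavoidable, which is why
  the conditions speak of \<open>Leg\<close> or exempt \<open>gt\<close>.\<close>

locale chase_inv =
  fixes F :: "atom set"
  assumes base: "aR gt \<in> F" "aB gt \<in> F" "aB bt \<in> F" "rt \<in> Leg F"
    and brake_loop: "aB w \<in> F \<Longrightarrow> aCh w w \<in> F"
    and brake_gt: "aB w \<in> F \<Longrightarrow> aCh gt w \<in> F"
    and brake_col: "aB w \<in> F \<Longrightarrow> aCol (bc b) (bc q) w \<in> F"
    and parent_Leg: "aCh v z \<in> F \<Longrightarrow> z \<in> Leg F \<Longrightarrow> v \<in> Leg F"
    and not_root: "aCh v z \<in> F \<Longrightarrow> z \<in> Leg F \<Longrightarrow> z \<noteq> rt"
    and parent_unique: "aCh v z \<in> F \<Longrightarrow> aCh v' z \<in> F \<Longrightarrow> z \<in> Leg F \<Longrightarrow> v = v'"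
    and brake_unique: "v \<in> Leg F \<Longrightarrow> aCh v w \<in> F \<Longrightarrow> aB w \<in> F \<Longrightarrow> w \<noteq> gt \<Longrightarrow>
       aCh v w' \<in> F \<Longrightarrow> aB w' \<in> F \<Longrightarrow> w' \<noteq> gt \<Longrightarrow> w = w'"
    and col_unique: "z \<in> Leg F \<Longrightarrow> aCol b' q' z \<in> F \<Longrightarrow> aCol b'' q'' z \<in> F \<Longrightarrow> b' = b'' \<and> q' = q''"
    and col_root: "aCol b' q' z \<in> F \<Longrightarrow> z \<noteq> rt"
    and col_bits: "aCol b' q' z \<in> F \<Longrightarrow> \<exists>b q. b' = bc b \<and> q' = bc q"
    and brake_ex: "z \<in> Leg F \<Longrightarrow> \<exists>w. w \<noteq> gt \<and> aCh z w \<in> F \<and> aB w \<in> F"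
    and brake_same: "aCh v z \<in> F \<Longrightarrow> z \<in> Leg F \<Longrightarrow> aCol b' (bc False) z \<in> F \<Longrightarrow>
       aCh v w \<in> F \<Longrightarrow> aB w \<in> F \<Longrightarrow> w \<noteq> gt \<Longrightarrow> aCh z w \<in> F"
    and sibling_unique: "aCh v z \<in> F \<Longrightarrow> aCh v z' \<in> F \<Longrightarrow> aCol b' q' z \<in> F \<Longrightarrow> aCol b' q' z' \<in> F \<Longrightarrow>
       z \<in> Leg F \<Longrightarrow> z' \<in> Leg F \<Longrightarrow> z = z'"
    and reach: "z \<in> Leg F \<Longrightarrow> (rt, z) \<in> (child F)\<^sup>*"
    and col_ex: "z \<in> Leg F \<Longrightarrow> z \<noteq> rt \<Longrightarrow> \<exists>b q. aCol b q z \<in> F"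
    and shape: "F \<subseteq> shaped (Leg F \<union> {u. aB u \<in> F} \<union> const_terms)"
    and phase_goal: "aCh v z \<in> F \<Longrightarrow> z \<in> Leg F \<Longrightarrow> aCol b' (bc True) z \<in> F \<Longrightarrow>
       \<exists>c. aK c v \<in> F \<and> aW tG c gt gt v \<in> F"
begin

lemma gt_not_Leg: "gt \<notin> Leg F"
  using base by (simp add: Leg_def)

text \<open>An edge into \<open>gt\<close> does not end in a legitimate node, the conditions on the
  brakes of a node exempt \<open>gt\<close>, and the goal facts occur only positively; so nothing in
  the invariant notices the new fact.\<close>

lemma insert_irrelevant:
  assumes "a \<in> shaped (Leg F \<union> {u. aB u \<in> F} \<union> const_terms)"
    "pred a \<in> {4, 5} \<or> (\<exists>t. a = aCh t gt)"
  shows "chase_inv (insert a F)"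
proof -
  have n [simp]: "a \<noteq> aR z" "a \<noteq> aB z" "a \<noteq> aCol b q z" "aR z \<noteq> a" "aB z \<noteq> a" "aCol b q z \<noteq> a" for z b q
    using assms(2) by auto
  have c: "aCh v z \<in> insert a F \<longleftrightarrow> aCh v z \<in> F \<or> z = gt \<and> a = aCh v gt" for v z
    using assms(2) by auto
  have L [simp]: "Leg (insert a F) = Leg F" by (simp add: Leg_def)
  have cF: "aCh v z \<in> F" if "aCh v z \<in> insert a F" "z \<in> Leg F" for v z
    using that c gt_not_Leg by metis
  have cB: "aCh v z \<in> F" if "aCh v z \<in> insert a F" "z \<noteq> gt" for v z
    using that c by metis
  have "child F \<subseteq> child (insert a F)" by (auto simp: child_def)
  then have r: "(child F)\<^sup>* \<subseteq> (child (insert a F))\<^sup>*" by (rule rtrancl_mono)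
  show ?thesis
  proof (unfold_locales, unfold L)
    show "(rt, z) \<in> (child (insert a F))\<^sup>*" if "z \<in> Leg F" for z
      using reach[OF that] r by blast
    show "insert a F \<subseteq> shaped (Leg F \<union> {u. aB u \<in> insert a F} \<union> const_terms)"
      using shape assms(1) by simp
    show "v = v'" if "aCh v z \<in> insert a F" "aCh v' z \<in> insert a F" "z \<in> Leg F" for v v' z
      using that cF parent_unique by blast
    show "w = w'" if "v \<in> Leg F" "aCh v w \<in> insert a F" "aB w \<in> insert a F" "w \<noteq> gt"
       "aCh v w' \<in> insert a F" "aB w' \<in> insert a F" "w' \<noteq> gt" for v w w'
      using brake_unique[OF that(1) cB[OF that(2,4)] _ that(4) cB[OF that(5,7)] _ that(7)] that(3,6) n by blast
    show "aCh z w \<in> insert a F" if "aCh v z \<in> insert a F" "z \<in> Leg F" "aCol b' (bc False) z \<in> insert a F"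
      "aCh v w \<in> insert a F" "aB w \<in> insert a F" "w \<noteq> gt" for v z b' w
      using brake_same[OF cF[OF that(1,2)] that(2) _ cB[OF that(4,6)] _ that(6)] that(3,5) n by blast
    show "z = z'" if "aCh v z \<in> insert a F" "aCh v z' \<in> insert a F" "aCol b' q' z \<in> insert a F"
      "aCol b' q' z' \<in> insert a F" "z \<in> Leg F" "z' \<in> Leg F" for v z z' b' q'
      using sibling_unique[OF cF[OF that(1,5)] cF[OF that(2,6)] _ _ that(5,6)] that(3,4) n by blast
    show "\<exists>c. aK c v \<in> insert a F \<and> aW tG c gt gt v \<in> insert a F"
      if "aCh v z \<in> insert a F" "z \<in> Leg F" "aCol b' (bc True) z \<in> insert a F" for v z b'
      using phase_goal[of v z b'] that cF by auto
    show "v \<in> Leg F" "z \<noteq> rt" if "aCh v z \<in> insert a F" "z \<in> Leg F" for v z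
      using parent_Leg not_root cF that by blast+
    show "b' = b'' \<and> q' = q''" if "z \<in> Leg F" "aCol b' q' z \<in> insert a F" "aCol b'' q'' z \<in> insert a F"
      for z b' q' b'' q'' using col_unique[OF that(1)] that(2,3) n by blast
    show "\<exists>b q. b' = bc b \<and> q' = bc q" if "aCol b' q' z \<in> insert a F" for b' q' z
      using col_bits that n by blast
    show "\<exists>w. w \<noteq> gt \<and> aCh z w \<in> insert a F \<and> aB w \<in> insert a F" if "z \<in> Leg F" for z
      using brake_ex[OF that] by blast
    show "\<exists>b q. aCol b q z \<in> insert a F" if "z \<in> Leg F" "z \<noteq> rt" for z
      using col_ex that by blast
  qed (use base brake_loop brake_gt brake_col col_root in simp_all)
qed

text \<open>A brake that becomes real is still a brake, hence stays outside
  \<open>Leg\<close>.\<close>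

lemma insert_real:
  assumes w: "aB w \<in> F"
  shows "chase_inv (insert (aR w) F)"
proof -
  have l: "Leg (insert (aR w) F) = Leg F" using w by (auto simp: Leg_def)
  have c: "child (insert (aR w) F) = child F" unfolding child_def l by simp
  have m: "aCh v z \<in> insert (aR w) F \<longleftrightarrow> aCh v z \<in> F" "aB z \<in> insert (aR w) F \<longleftrightarrow> aB z \<in> F"
    "aCol b q z \<in> insert (aR w) F \<longleftrightarrow> aCol b q z \<in> F" "aK v z \<in> insert (aR w) F \<longleftrightarrow> aK v z \<in> F"
    "aW v z b q w' \<in> insert (aR w) F \<longleftrightarrow> aW v z b q w' \<in> F" for v z b q w'
    by simp_all
  have "insert (aR w) F \<subseteq> shaped (Leg F \<union> {u. aB u \<in> F} \<union> const_terms)"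
    using w shape by simp
  moreover have "aR gt \<in> insert (aR w) F" using base by simp
  ultimately show ?thesis
    using chase_inv_axioms unfolding chase_inv_def l c m by meson
qed

text \<open>The output of the phase rule is split into brake and node, so that
  \<open>add_node\<close> serves both node-creating rules. The brake is added first because a node
  needs an existing one.\<close>

lemma add_brake:
  assumes fr: "n \<notin> nulls F" and u: "u = Null n"
  shows "chase_inv (F \<union> brake_facts u)" "Leg (F \<union> brake_facts u) = Leg F"
proof -
  define G where "G = F \<union> brake_facts u"
  have sub [intro]: "a \<in> F \<Longrightarrow> a \<in> G" for a by (simp add: G_def)
  have nu: "u \<noteq> Const c" "u \<noteq> bc b" for c b by (simp_all add: u)
  have f: "Atom p l \<in> F \<Longrightarrow> u \<notin> set l" for p l using Null_fresh[OF fr] u by blast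
  have ch: "aCh a c \<in> G \<longleftrightarrow> aCh a c \<in> F \<or> (c = u \<and> (a = u \<or> a = gt))" for a c
    by (auto simp: G_def brake_facts_def cols_def)
  have col: "aCol b q a \<in> G \<longleftrightarrow> aCol b q a \<in> F \<or> (a = u \<and> (\<exists>b' q'. b = bc b' \<and> q = bc q'))" for b q a
    by (auto simp: G_def brake_facts_def cols_def)
  have R: "aR a \<in> G \<longleftrightarrow> aR a \<in> F" for a by (auto simp: G_def brake_facts_def cols_def)
  have B: "aB a \<in> G \<longleftrightarrow> aB a \<in> F \<or> a = u" for a by (auto simp: G_def brake_facts_def cols_def)
  have KW: "aK a c \<in> G \<longleftrightarrow> aK a c \<in> F" "aW t a b c d \<in> G \<longleftrightarrow> aW t a b c d \<in> F" for t a b c d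
    by (auto simp: G_def brake_facts_def cols_def)
  have uL: "u \<notin> Leg F" using f[of 2 "[u]"] by (auto simp: Leg_def)
  have L: "Leg G = Leg F" using f[of 2 "[u]"] by (auto simp: Leg_def R B)
  have chL: "aCh a c \<in> G \<Longrightarrow> c \<in> Leg F \<Longrightarrow> aCh a c \<in> F" for a c using uL by (auto simp: ch)
  have chL2: "aCh a c \<in> G \<Longrightarrow> a \<in> Leg F \<Longrightarrow> aCh a c \<in> F" for a c
    using uL gt_not_Leg by (auto simp: ch)
  have chB: "aCh a c \<in> F \<Longrightarrow> aB c \<in> G \<Longrightarrow> aB c \<in> F" for a c
    using f[of 0 "[a, c]"] by (auto simp: B)
  have colL: "aCol b q a \<in> G \<Longrightarrow> a \<in> Leg F \<Longrightarrow> aCol b q a \<in> F" for b q a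
    using uL by (auto simp: col)
  have cc: "child G = child F" using chL by (auto simp: child_def L)
  have sh: "G \<subseteq> shaped (Leg F \<union> {u. aB u \<in> G} \<union> const_terms)"
  proof -
    have "F \<subseteq> shaped (Leg F \<union> {u. aB u \<in> G} \<union> const_terms)"
      using shape shaped_mono[of "Leg F \<union> {u. aB u \<in> F} \<union> const_terms" "Leg F \<union> {u. aB u \<in> G} \<union> const_terms"]
      by (auto simp: B)
    moreover have "brake_facts u \<subseteq> shaped (Leg F \<union> {u. aB u \<in> G} \<union> const_terms)"
      using bc_consts B by (auto simp: brake_facts_def cols_def)
    ultimately show ?thesis by (simp add: G_def)
  qed
  show "Leg (F \<union> brake_facts u) = Leg F" using L by (simp add: G_def)
  show "chase_inv (F \<union> brake_facts u)" unfolding G_def[symmetric]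
  proof (unfold_locales, unfold L cc)
    show "aR gt \<in> G" "aB gt \<in> G" "aB bt \<in> G" "rt \<in> Leg F" using base by auto
    show "aCh w w \<in> G" "aCh gt w \<in> G" "aCol (bc b) (bc q) w \<in> G" if "aB w \<in> G" for w b q
      using that brake_loop brake_gt brake_col by (auto simp: B ch col)
    show "v \<in> Leg F" "z \<noteq> rt" if "aCh v z \<in> G" "z \<in> Leg F" for v z
      using parent_Leg not_root chL that by blast+
    show "v = v'" if "aCh v z \<in> G" "aCh v' z \<in> G" "z \<in> Leg F" for v v' z
      using that chL parent_unique by blast
    show "w = w'" if "v \<in> Leg F" "aCh v w \<in> G" "aB w \<in> G" "w \<noteq> gt"
       "aCh v w' \<in> G" "aB w' \<in> G" "w' \<noteq> gt" for v w w'
      using brake_unique[OF that(1) chL2[OF that(2,1)] _ that(4) chL2[OF that(5,1)] _ that(7)] that(3,6)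
        chB chL2[OF that(2,1)] chL2[OF that(5,1)] by blast
    show "b' = b'' \<and> q' = q''" if "z \<in> Leg F" "aCol b' q' z \<in> G" "aCol b'' q'' z \<in> G"
      for z b' q' b'' q'' using col_unique[OF that(1)] that colL by blast
    show "z \<noteq> rt" "\<exists>b q. b' = bc b \<and> q' = bc q" if "aCol b' q' z \<in> G" for b' q' z
      using col_bits col_root that nu unfolding col by blast+
    show "\<exists>w. w \<noteq> gt \<and> aCh z w \<in> G \<and> aB w \<in> G" if "z \<in> Leg F" for z
      using brake_ex[OF that] by blast
    show "aCh z w \<in> G" if "aCh v z \<in> G" "z \<in> Leg F" "aCol b' (bc False) z \<in> G"
      "aCh v w \<in> G" "aB w \<in> G" "w \<noteq> gt" for v z b' w
    proof -
      have "v \<in> Leg F" using parent_Leg chL that by blast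
      then have "aCh v w \<in> F" using chL2 that by blast
      then have "aCh z w \<in> F" using brake_same[OF chL[OF that(1,2)] that(2) colL[OF that(3,2)] _ chB[OF _ that(5)] that(6)]
        by blast
      then show ?thesis by blast
    qed
    show "z = z'" if "aCh v z \<in> G" "aCh v z' \<in> G" "aCol b' q' z \<in> G"
      "aCol b' q' z' \<in> G" "z \<in> Leg F" "z' \<in> Leg F" for v z z' b' q'
      using sibling_unique[OF chL[OF that(1,5)] chL[OF that(2,6)] colL[OF that(3,5)] colL[OF that(4,6)] that(5,6)] .
    show "(rt, z) \<in> (child F)\<^sup>*" if "z \<in> Leg F" for z
      using reach[OF that] .
    show "\<exists>b q. aCol b q z \<in> G" if "z \<in> Leg F" "z \<noteq> rt" for z
      using col_ex that by blast
    show "G \<subseteq> shaped (Leg F \<union> {u. aB u \<in> G} \<union> const_terms)" using sh .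
    show "\<exists>c. aK c v \<in> G \<and> aW tG c gt gt v \<in> G"
      if "aCh v z \<in> G" "z \<in> Leg F" "aCol b' (bc True) z \<in> G" for v z b'
      using phase_goal[OF chL[OF that(1,2)] that(2) colL[OF that(3,2)]] by blast
  qed
qed

text \<open>For \<open>q\<close> false this is the choice rule, and \<open>u\<close> is the brake of
  the parent; for \<open>q\<close> true it is the second half of the phase rule, and
  \<open>u\<close> has just been added.\<close>

lemma add_node:
  assumes fr: "n \<notin> nulls F" and z: "z = Null n" and v: "v \<in> Leg F"
    and u: "u \<noteq> gt" "aB u \<in> F" and nq: "\<not> q \<Longrightarrow> aCh v u \<in> F"
    and yq: "q \<Longrightarrow> \<exists>c. aK c v \<in> F \<and> aW tG c gt gt v \<in> F"
    and sib: "\<And>z'. z' \<in> Leg F \<Longrightarrow> aCh v z' \<in> F \<Longrightarrow> aCol (bc b) (bc q) z' \<notin> F"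
  shows "chase_inv (F \<union> node_facts b q v z u)" "Leg (F \<union> node_facts b q v z u) = insert z (Leg F)"
proof -
  define G where "G = F \<union> node_facts b q v z u"
  have sub [intro]: "a \<in> F \<Longrightarrow> a \<in> G" for a by (simp add: G_def)
  have nz: "z \<noteq> Const c" "z \<noteq> bc b" for c b by (simp_all add: z)
  have f: "Atom p l \<in> F \<Longrightarrow> z \<notin> set l" for p l using Null_fresh[OF fr] z by blast
  have ch: "aCh a c \<in> G \<longleftrightarrow> aCh a c \<in> F \<or> (a = v \<and> c = z) \<or> (a = z \<and> c = u)" for a c
    by (auto simp: G_def node_facts_def)
  have col: "aCol b' q' a \<in> G \<longleftrightarrow> aCol b' q' a \<in> F \<or> (a = z \<and> b' = bc b \<and> q' = bc q)" for b' q' a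
    by (auto simp: G_def node_facts_def)
  have R: "aR a \<in> G \<longleftrightarrow> aR a \<in> F \<or> a = z" for a by (auto simp: G_def node_facts_def)
  have B: "aB a \<in> G \<longleftrightarrow> aB a \<in> F" for a by (auto simp: G_def node_facts_def)
  have zF: "aB z \<notin> F" "aR z \<notin> F" "aCh a z \<notin> F" "aCh z a \<notin> F" "aCol b' q' z \<notin> F" for a b' q'
    using f[of 3 "[z]"] f[of 2 "[z]"] f[of 0 "[a, z]"] f[of 0 "[z, a]"] f[of 6 "[b', q', z]"] by auto
  have L: "Leg G = insert z (Leg F)" using zF by (auto simp: Leg_def R B)
  have zL: "z \<notin> Leg F" using zF by (auto simp: Leg_def)
  have uL: "u \<notin> Leg F" using u by (auto simp: Leg_def)
  have zu: "z \<noteq> u" using u zF by auto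
  have zv: "z \<noteq> v" using v zL by auto
  have chz: "aCh a z \<in> G \<longleftrightarrow> a = v" "aCh z a \<in> G \<longleftrightarrow> a = u" for a using zF zu zv by (auto simp: ch)
  have chL: "aCh a c \<in> G \<Longrightarrow> c \<in> Leg F \<Longrightarrow> aCh a c \<in> F" for a c using uL zL by (auto simp: ch)
  have chB: "aCh a c \<in> G \<Longrightarrow> aB c \<in> G \<Longrightarrow> a \<noteq> z \<Longrightarrow> aCh a c \<in> F" for a c
    using zF by (auto simp: ch B)
  have colL: "aCol b' q' a \<in> G \<Longrightarrow> a \<in> Leg F \<Longrightarrow> aCol b' q' a \<in> F" for b' q' a
    using zL by (auto simp: col)
  have colz: "aCol b' q' z \<in> G \<longleftrightarrow> b' = bc b \<and> q' = bc q" for b' q' using zF by (auto simp: col)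
  have "child F \<subseteq> child G" by (auto simp: child_def L)
  then have rm: "(child F)\<^sup>* \<subseteq> (child G)\<^sup>*" by (rule rtrancl_mono)
  have sh: "G \<subseteq> shaped (insert z (Leg F) \<union> {u. aB u \<in> G} \<union> const_terms)"
  proof -
    have "F \<subseteq> shaped (insert z (Leg F) \<union> {u. aB u \<in> G} \<union> const_terms)"
      using shape shaped_mono[of "Leg F \<union> {u. aB u \<in> F} \<union> const_terms" "insert z (Leg F) \<union> {u. aB u \<in> G} \<union> const_terms"]
      by (auto simp: B)
    moreover have "node_facts b q v z u \<subseteq> shaped (insert z (Leg F) \<union> {u. aB u \<in> G} \<union> const_terms)"
      using bc_consts u v B by (auto simp: node_facts_def)
    ultimately show ?thesis by (simp add: G_def)
  qed
  show "Leg (F \<union> node_facts b q v z u) = insert z (Leg F)" using L by (simp add: G_def)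
  show "chase_inv (F \<union> node_facts b q v z u)" unfolding G_def[symmetric]
  proof (unfold_locales, unfold L)
    show "aR gt \<in> G" "aB gt \<in> G" "aB bt \<in> G" "rt \<in> insert z (Leg F)" using base by auto
    show "aCh w w \<in> G" "aCh gt w \<in> G" "aCol (bc b') (bc q') w \<in> G" if "aB w \<in> G" for w b' q'
      using that brake_loop brake_gt brake_col by (auto simp: B)
    show "v' \<in> insert z (Leg F)" "z' \<noteq> rt" if "aCh v' z' \<in> G" "z' \<in> insert z (Leg F)" for v' z'
      using parent_Leg[OF chL[OF that(1)]] not_root[OF chL[OF that(1)]] that chz(1)[of v'] v nz(1)
      by (cases "z' = z"; simp)+
    show "a = a'" if "aCh a c \<in> G" "aCh a' c \<in> G" "c \<in> insert z (Leg F)" for a a' c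
      using parent_unique[OF chL[OF that(1)] chL[OF that(2)]] that(3) that(1,2) chz(1)[of a] chz(1)[of a']
      by (cases "c = z") simp_all
    show "w = w'" if "a \<in> insert z (Leg F)" "aCh a w \<in> G" "aB w \<in> G" "w \<noteq> gt"
       "aCh a w' \<in> G" "aB w' \<in> G" "w' \<noteq> gt" for a w w'
    proof (cases "a = z")
      case True then show ?thesis using that(2,5) chz(2)[of w] chz(2)[of w'] by simp
    next
      case False
      then have "a \<in> Leg F" "aCh a w \<in> F" "aCh a w' \<in> F"
        using that(1) chB[OF that(2,3)] chB[OF that(5,6)] by simp_all
      then show ?thesis using brake_unique[of a w w'] that(3,4,6,7) B by simp
    qed
    show "b' = b'' \<and> q' = q''" if "a \<in> insert z (Leg F)" "aCol b' q' a \<in> G" "aCol b'' q'' a \<in> G"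
      for a b' q' b'' q'' using col_unique[of a b' q' b'' q''] colL[OF that(2)] colL[OF that(3)] that colz
      by (cases "a = z") simp_all
    show "a \<noteq> rt" "\<exists>b q. b' = bc b \<and> q' = bc q" if "aCol b' q' a \<in> G" for b' q' a
      using col_bits[of b' q' a] col_root[of b' q' a] that nz(1)[of 3] unfolding col by auto
    show "\<exists>w. w \<noteq> gt \<and> aCh a w \<in> G \<and> aB w \<in> G" if "a \<in> insert z (Leg F)" for a
    proof (cases "a = z")
      case True then show ?thesis using u chz(2)[of u] by blast
    next
      case False
      then have "a \<in> Leg F" using that by simp
      then obtain w where "w \<noteq> gt" "aCh a w \<in> F" "aB w \<in> F" using brake_ex[of a] by auto
      then show ?thesis by blast
    qed
    show "aCh c w \<in> G" if "aCh a c \<in> G" "c \<in> insert z (Leg F)" "aCol b' (bc False) c \<in> G"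
      "aCh a w \<in> G" "aB w \<in> G" "w \<noteq> gt" for a c b' w
    proof (cases "c = z")
      case True
      then have q: "\<not> q" and a: "a = v" using that(1,3) colz chz(1)[of a] by auto
      have "aCh v w \<in> F" using chB[OF that(4,5)] zv a by simp
      then have "w = u" using brake_unique[OF v _ _ that(6) nq[OF q] u(2,1)] that(5) B by simp
      then show ?thesis using chz(2)[of u] True by simp
    next
      case False
      then have c: "c \<in> Leg F" using that(2) by simp
      have ac: "aCh a c \<in> F" "aCol b' (bc False) c \<in> F"
        using chL[OF that(1) c] colL[OF that(3) c] by simp_all
      have "a \<noteq> z" using zF(4)[of c] ac by auto
      then have "aCh a w \<in> F" "aB w \<in> F" using chB[OF that(4,5)] B that(5) by simp_all
      then show ?thesis using sub[OF brake_same[OF ac(1) c ac(2) _ _ that(6)]] by simp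
    qed
    show "c = c'" if "aCh a c \<in> G" "aCh a c' \<in> G" "aCol b' q' c \<in> G"
      "aCol b' q' c' \<in> G" "c \<in> insert z (Leg F)" "c' \<in> insert z (Leg F)" for a c c' b' q'
    proof (cases "c = z \<or> c' = z")
      case True
      then have e: "a = v" "b' = bc b" "q' = bc q" using that(1-4) colz chz(1)[of a] by auto
      have "c \<notin> Leg F" "c' \<notin> Leg F"
        using sib[of c] sib[of c'] chL[OF that(1)] colL[OF that(3)] chL[OF that(2)] colL[OF that(4)]
        unfolding e by auto
      then show ?thesis using that(5,6) by simp
    next
      case False
      then have c: "c \<in> Leg F" "c' \<in> Leg F" using that(5,6) by simp_all
      show ?thesis
        by (rule sibling_unique[OF chL[OF that(1) c(1)] chL[OF that(2) c(2)] colL[OF that(3) c(1)]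
              colL[OF that(4) c(2)] c])
    qed
    show "(rt, a) \<in> (child G)\<^sup>*" if "a \<in> insert z (Leg F)" for a
    proof (cases "a = z")
      case True
      have "(v, z) \<in> child G" by (simp add: child_def L chz)
      then show ?thesis using reach[OF v] rm True by (meson rtrancl.rtrancl_into_rtrancl subsetD)
    next
      case False
      then have "(rt, a) \<in> (child F)\<^sup>*" using that reach by simp
      then show ?thesis using rm by blast
    qed
    show "\<exists>b q. aCol b q a \<in> G" if "a \<in> insert z (Leg F)" "a \<noteq> rt" for a
    proof (cases "a = z")
      case True then show ?thesis using colz by blast
    next
      case False
      then show ?thesis using col_ex[of a] that by blast
    qed
    show "G \<subseteq> shaped (insert z (Leg F) \<union> {u. aB u \<in> G} \<union> const_terms)" using sh .
    show "\<exists>c. aK c a \<in> G \<and> aW tG c gt gt a \<in> G"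
      if "aCh a c \<in> G" "c \<in> insert z (Leg F)" "aCol b' (bc True) c \<in> G" for a c b'
    proof (cases "c = z")
      case True
      then have "q" "a = v" using that colz chz by auto
      then obtain c where "aK c a \<in> F" "aW tG c gt gt a \<in> F" using yq by blast
      then show ?thesis by blast
    next
      case False
      then have c: "c \<in> Leg F" using that(2) by simp
      then show ?thesis using phase_goal[OF chL[OF that(1) c] c colL[OF that(3) c]] by blast
    qed
  qed
qed

text \<open>At any other trigger the node or its brake itself witnesses the head.\<close>

lemma choice_source:
  assumes "aR v \<in> F" "aCh v w \<in> F" "aB w \<in> F" "\<not> (\<exists>z. choice_facts b v w z \<subseteq> F)"
  shows "v \<in> Leg F" "aR w \<notin> F"
    "\<And>z'. z' \<in> Leg F \<Longrightarrow> aCh v z' \<in> F \<Longrightarrow> aCol (bc b) (bc False) z' \<notin> F"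
proof -
  show "v \<in> Leg F"
  proof (rule ccontr)
    assume "v \<notin> Leg F"
    then have "aB v \<in> F" using assms(1) by (simp add: Leg_def)
    \<comment> \<open>A real brake in the place of the source is its own child, thanks to its loop
      and its colours.\<close>
    then have "choice_facts b v w v \<subseteq> F"
      using brake_loop[of v] brake_col[of v b False] assms(1,2) by (simp add: choice_facts_def)
    with assms(4) show False by blast
  qed
  show nR: "aR w \<notin> F"
  proof
    assume "aR w \<in> F"
    then have "choice_facts b v w w \<subseteq> F"
      using brake_loop[of w] brake_col[of w b False] assms(2,3) by (simp add: choice_facts_def)
    with assms(4) show False by blast
  qed
  then have "w \<noteq> gt" using base by blast
  show "aCol (bc b) (bc False) z' \<notin> F" if "z' \<in> Leg F" "aCh v z' \<in> F" for z'
  proof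
    assume c: "aCol (bc b) (bc False) z' \<in> F"
    \<comment> \<open>An existing child of the same colour would do, because within a phase it has
      inherited the brake \<open>w\<close>.\<close>
    have "choice_facts b v w z' \<subseteq> F"
      using brake_same[OF that(2,1) c assms(2,3) \<open>w \<noteq> gt\<close>] that c
      by (simp add: choice_facts_def Leg_def)
    with assms(4) show False by blast
  qed
qed

lemma phase_source:
  assumes "aR v \<in> F" "aCh v w \<in> F" "aB w \<in> F" "\<not> (\<exists>z u. phase_facts b v z u \<subseteq> F)"
  shows "v \<in> Leg F" "aR w \<notin> F"
    "\<And>z'. z' \<in> Leg F \<Longrightarrow> aCh v z' \<in> F \<Longrightarrow> aCol (bc b) (bc True) z' \<notin> F"
proof -
  have cols: "cols u \<subseteq> F" if "aB u \<in> F" for u using brake_col[OF that] by (auto simp: cols_def)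
  show "v \<in> Leg F"
  proof (rule ccontr)
    assume "v \<notin> Leg F"
    then have "aB v \<in> F" using assms(1) by (simp add: Leg_def)
    then have "phase_facts b v v v \<subseteq> F"
      using brake_loop[of v] brake_col[of v b True] brake_gt[of v] cols[of v] assms(1) by (simp add: phase_facts_def)
    with assms(4) show False by blast
  qed
  show nR: "aR w \<notin> F"
  proof
    assume "aR w \<in> F"
    then have "phase_facts b v w w \<subseteq> F"
      using brake_loop[of w] brake_col[of w b True] brake_gt[of w] cols[of w] assms(2,3) by (simp add: phase_facts_def)
    with assms(4) show False by blast
  qed
  show "aCol (bc b) (bc True) z' \<notin> F" if z': "z' \<in> Leg F" "aCh v z' \<in> F" for z'
  proof
    assume c: "aCol (bc b) (bc True) z' \<in> F"
    \<comment> \<open>The phase head does not mention the old brake, so any brake of the sibling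
      completes it.\<close>
    obtain u where "aCh z' u \<in> F" "aB u \<in> F" using brake_ex[OF z'(1)] by blast
    then have "phase_facts b v z' u \<subseteq> F"
      using z' c brake_loop[of u] brake_gt[of u] cols[of u] by (simp add: phase_facts_def Leg_def)
    with assms(4) show False by blast
  qed
qed

end

lemma chase_inv_dbase: "chase_inv (set dbase)"
proof -
  have L: "Leg (set dbase) = {rt}" by (auto simp: Leg_def dbase_def)
  show ?thesis
    by (unfold_locales, unfold L)
      (auto simp: dbase_def bc_def Leg_def ex_bool_eq all_bool_eq)
qed

text \<open>Only the choice and phase rules enlarge \<open>Leg\<close>, and where they are not
  blocked the brake is not real: this is how a real brake stops its phase. The last conclusion holds
  because a new brake always comes with a new node.\<close>

lemma chase_inv_step:
  assumes "chase_inv F" "step (rules G x) F F'" "pair_patterns G"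
  shows "chase_inv F'" "Leg F \<subseteq> Leg F'"
    "z \<in> Leg F' - Leg F \<Longrightarrow> \<exists>v w. aCh v z \<in> F' \<and> aCh v w \<in> F \<and> aB w \<in> F \<and> aR w \<notin> F"
    "Leg F' = Leg F \<Longrightarrow> {u. aB u \<in> F'} = {u. aB u \<in> F}"
proof -
  interpret chase_inv F by fact
  let ?new = "\<lambda>z. z \<in> Leg F' - Leg F \<longrightarrow> (\<exists>v w. aCh v z \<in> F' \<and> aCh v w \<in> F \<and> aB w \<in> F \<and> aR w \<notin> F)"
  from assms(2,3) have "chase_inv F' \<and> Leg F \<subseteq> Leg F' \<and> (\<forall>z. ?new z) \<and>
    (Leg F' = Leg F \<longrightarrow> {u. aB u \<in> F'} = {u. aB u \<in> F})"
  proof (cases rule: step_cases)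
    case (datalog R s a)
    have sh: "asubst s a \<in> shaped (Leg F \<union> {u. aB u \<in> F} \<union> const_terms)"
      "pred (asubst s a) \<in> {4, 5} \<or> (\<exists>t. asubst s a = aCh t gt)"
      using datalog_shaped[OF assms(3) datalog(1,3,2) shape] by blast+
    then have ne: "asubst s a \<noteq> aR z" "asubst s a \<noteq> aB z" for z by auto
    then have "Leg F' = Leg F" "{u. aB u \<in> F'} = {u. aB u \<in> F}"
      unfolding Leg_def datalog(4) insert_iff using ne[THEN not_sym] by simp_all
    then show ?thesis using insert_irrelevant[OF sh] datalog(4) by simp
  next
    case (brake w)
    then have "Leg F' = Leg F" "{u. aB u \<in> F'} = {u. aB u \<in> F}" by (auto simp: Leg_def)
    then show ?thesis using insert_real brake by simp
  next
    case (choice b v w n)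
    note src = choice_source[OF choice(1-4)]
    have w: "w \<noteq> gt" using src(2) base by blast
    have F': "F' = F \<union> node_facts b False v (Null n) w" using choice(6) choice_facts_eq by simp
    note an = add_node[OF choice(5) refl src(1) w choice(3) choice(2) _ src(3)]
    have "chase_inv F'" "Leg F' = insert (Null n) (Leg F)" using an unfolding F' by blast+
    moreover have "aCh v (Null n) \<in> F'" by (simp add: F' node_facts_def)
    moreover have "{u. aB u \<in> F'} = {u. aB u \<in> F}" by (auto simp: F' node_facts_def)
    ultimately show ?thesis using choice(2,3) src(2) by auto
  next
    case (phase b v w c n m)
    note src = phase_source[OF phase(1-3,6)]
    let ?u = "Null m" and ?F1 = "F \<union> brake_facts (Null m)"
    have L1: "Leg ?F1 = Leg F" using add_brake(2)[OF phase(8) refl] .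
    interpret F1: chase_inv ?F1 using add_brake(1)[OF phase(8) refl] .
    have mL: "Null m \<notin> Leg F" using Null_fresh[OF phase(8), of 2 "[Null m]"] by (auto simp: Leg_def)
    have nn: "n \<notin> nulls ?F1" using phase(7,9) by (auto simp: nulls_def brake_facts_def cols_def)
    have sib: "aCol (bc b) (bc True) z' \<notin> ?F1" if "z' \<in> Leg ?F1" "aCh v z' \<in> ?F1" for z'
    proof -
      have "z' \<noteq> Null m" using that(1) L1 mL by auto
      then have "aCh v z' \<in> F" "aCol (bc b) (bc True) z' \<notin> brake_facts (Null m)"
        using that(2) by (auto simp: brake_facts_def cols_def)
      then show ?thesis using src(3)[of z'] that(1) L1 by simp
    qed
    have F': "F' = ?F1 \<union> node_facts b True v (Null n) ?u" using phase(10) phase_facts_eq by auto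
    have vL: "v \<in> Leg ?F1" using src(1) L1 by simp
    have uB: "aB ?u \<in> ?F1" by (simp add: brake_facts_def)
    have gc: "\<exists>c. aK c v \<in> ?F1 \<and> aW tG c gt gt v \<in> ?F1" using phase(4,5) by blast
    note an = F1.add_node[OF nn refl vL _ uB _ gc sib]
    have "chase_inv F'" "Leg F' = insert (Null n) (Leg F)" using an unfolding F' L1 by simp_all
    moreover have "aCh v (Null n) \<in> F'" by (simp add: F' node_facts_def)
    moreover have "Null n \<notin> Leg F"
      using Null_fresh[OF phase(7), of 2 "[Null n]"] by (auto simp: Leg_def)
    ultimately show ?thesis using phase(2,3) src(2) by auto
  qed
  then show "chase_inv F'" "Leg F \<subseteq> Leg F'" "z \<in> Leg F' - Leg F \<Longrightarrow> \<exists>v w. aCh v z \<in> F' \<and> aCh v w \<in> F \<and> aB w \<in> F \<and> aR w \<notin> F"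
    "Leg F' = Leg F \<Longrightarrow> {u. aB u \<in> F'} = {u. aB u \<in> F}"
    by blast+
qed


section \<open>From infinite chase sequences to solutions\<close>

locale chase_run =
  fixes G :: "clause list" and x :: nat and F :: "nat \<Rightarrow> atom set"
  assumes G: "pair_patterns G" and run: "infinite_chase (rules G x, set dbase) F"
begin

lemma steps: "step (rules G x) (F i) (F (Suc i))"
  using run by (simp add: infinite_chase_def)

lemma inv: "chase_inv (F i)"
proof (induction i)
  case 0
  then show ?case using run chase_inv_dbase by (simp add: infinite_chase_def)
next
  case (Suc i)
  then show ?case using chase_inv_step(1) steps G by blast
qed

lemma F_mono: "i \<le> j \<Longrightarrow> F i \<subseteq> F j"
proof (rule lift_Suc_mono_le)
  show "F i \<subseteq> F (Suc i)" for i using step_growing[OF steps[of i]] by blast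
qed

text \<open>Growth of the fact sets alone does not give this, since \<open>aB z\<close> could be
  added after \<open>aR z\<close>.\<close>

lemma Leg_mono: "i \<le> j \<Longrightarrow> Leg (F i) \<subseteq> Leg (F j)"
  by (rule lift_Suc_mono_le[of "\<lambda>i. Leg (F i)"]) (rule chase_inv_step(2)[OF inv steps G])

lemma finite_F: "finite (F i)"
proof (induction i)
  case 0
  then show ?case using run by (simp add: infinite_chase_def)
next
  case (Suc i)
  then show ?case using steps[of i] by (auto simp: step_def)
qed

section \<open>The limit of the chase sequence\<close>

definition "Fo = (\<Union>i. F i)"

lemma F_Fo: "a \<in> F i \<Longrightarrow> a \<in> Fo"
  by (auto simp: Fo_def)

text \<open>Stated with an eventual quantifier so that, together with \<open>Leg_Fo_iff\<close>, the
  conditions of the invariant, even those involving the negation inside \<open>Leg\<close>, pass to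
  the limit.\<close>

lemma Fo_iff: "a \<in> Fo \<longleftrightarrow> (\<forall>\<^sub>F i in sequentially. a \<in> F i)"
proof
  assume "a \<in> Fo"
  then obtain i where "a \<in> F i" by (auto simp: Fo_def)
  then show "\<forall>\<^sub>F i in sequentially. a \<in> F i"
    using F_mono by (auto simp: eventually_sequentially intro!: exI[of _ i])
next
  assume "\<forall>\<^sub>F i in sequentially. a \<in> F i"
  then show "a \<in> Fo" by (auto simp: eventually_sequentially Fo_def)
qed

lemma Leg_Fo_iff: "z \<in> Leg Fo \<longleftrightarrow> (\<forall>\<^sub>F i in sequentially. z \<in> Leg (F i))"
proof
  assume "z \<in> Leg Fo"
  then have "\<forall>\<^sub>F i in sequentially. aR z \<in> F i" "\<And>i. aB z \<notin> F i"
    by (auto simp: Leg_def Fo_iff[symmetric] F_Fo)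
  then show "\<forall>\<^sub>F i in sequentially. z \<in> Leg (F i)" by (simp add: Leg_def)
next
  assume e: "\<forall>\<^sub>F i in sequentially. z \<in> Leg (F i)"
  have "aB z \<notin> Fo"
  proof
    assume "aB z \<in> Fo"
    then have "\<forall>\<^sub>F i in sequentially. aB z \<in> F i" by (simp add: Fo_iff)
    with e have "\<forall>\<^sub>F i in sequentially. False" by eventually_elim (simp add: Leg_def)
    then show False by simp
  qed
  moreover have "aR z \<in> Fo" unfolding Fo_iff using e by eventually_elim (simp add: Leg_def)
  ultimately show "z \<in> Leg Fo" by (simp add: Leg_def)
qed

lemma Leg_F_Fo: "z \<in> Leg (F i) \<Longrightarrow> z \<in> Leg Fo"
  unfolding Leg_Fo_iff using Leg_mono by (auto simp: eventually_sequentially)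

lemma child_F_Fo: "child (F i) \<subseteq> child Fo"
  using F_Fo Leg_F_Fo by (auto simp: child_def)

text \<open>Each condition has finitely many premises, which hold together in \<open>F i\<close>
  from some \<open>i\<close> on, where the invariant is known.\<close>

lemma inv_Fo: "chase_inv Fo"
proof
  show "aR gt \<in> Fo" "aB gt \<in> Fo" "aB bt \<in> Fo" "rt \<in> Leg Fo"
    using chase_inv.base[OF inv, of 0] F_Fo Leg_F_Fo by blast+
  show "aCh w w \<in> Fo" "aCh gt w \<in> Fo" "aCol (bc b) (bc q) w \<in> Fo" if w: "aB w \<in> Fo" for w b q
  proof -
    obtain i where i: "aB w \<in> F i" using w by (auto simp: Fo_def)
    show "aCh w w \<in> Fo" "aCh gt w \<in> Fo" "aCol (bc b) (bc q) w \<in> Fo"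
      by (rule F_Fo[OF chase_inv.brake_loop[OF inv i]] F_Fo[OF chase_inv.brake_gt[OF inv i]]
          F_Fo[OF chase_inv.brake_col[OF inv i]])+
  qed
  show "v \<in> Leg Fo" if "aCh v z \<in> Fo" "z \<in> Leg Fo" for v z
    using that unfolding Fo_iff Leg_Fo_iff
    by eventually_elim (rule chase_inv.parent_Leg[OF inv])
  show "z \<noteq> rt" if "aCh v z \<in> Fo" "z \<in> Leg Fo" for v z
  proof -
    from that have "\<forall>\<^sub>F i in sequentially. z \<noteq> rt" unfolding Fo_iff Leg_Fo_iff
      by eventually_elim (rule chase_inv.not_root[OF inv])
    then show ?thesis by simp
  qed
  show "v = v'" if "aCh v z \<in> Fo" "aCh v' z \<in> Fo" "z \<in> Leg Fo" for v v' z
  proof -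
    from that have "\<forall>\<^sub>F i in sequentially. v = v'" unfolding Fo_iff Leg_Fo_iff
      by eventually_elim (rule chase_inv.parent_unique[OF inv])
    then show ?thesis by simp
  qed
  show "w = w'" if "v \<in> Leg Fo" "aCh v w \<in> Fo" "aB w \<in> Fo" "w \<noteq> gt"
     "aCh v w' \<in> Fo" "aB w' \<in> Fo" "w' \<noteq> gt" for v w w'
  proof -
    from that(1,2,3,5,6) have "\<forall>\<^sub>F i in sequentially. w = w'" unfolding Fo_iff Leg_Fo_iff
      by eventually_elim (rule chase_inv.brake_unique[OF inv _ _ _ that(4) _ _ that(7)])
    then show ?thesis by simp
  qed
  show "b' = b'' \<and> q' = q''" if "z \<in> Leg Fo" "aCol b' q' z \<in> Fo" "aCol b'' q'' z \<in> Fo"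
    for z b' q' b'' q''
  proof -
    from that have "\<forall>\<^sub>F i in sequentially. b' = b'' \<and> q' = q''" unfolding Fo_iff Leg_Fo_iff
      by eventually_elim (rule chase_inv.col_unique[OF inv])
    then show ?thesis by simp
  qed
  show "z \<noteq> rt" "\<exists>b q. b' = bc b \<and> q' = bc q" if c: "aCol b' q' z \<in> Fo" for b' q' z
  proof -
    obtain i where i: "aCol b' q' z \<in> F i" using c by (auto simp: Fo_def)
    show "z \<noteq> rt" "\<exists>b q. b' = bc b \<and> q' = bc q"
      using chase_inv.col_root[OF inv i] chase_inv.col_bits[OF inv i] by simp_all
  qed
  show "\<exists>w. w \<noteq> gt \<and> aCh z w \<in> Fo \<and> aB w \<in> Fo" if "z \<in> Leg Fo" for z
  proof -
    obtain i where "z \<in> Leg (F i)"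
      using \<open>z \<in> Leg Fo\<close> unfolding Leg_Fo_iff by (auto simp: eventually_sequentially)
    then show ?thesis using chase_inv.brake_ex[OF inv] F_Fo by blast
  qed
  show "aCh z w \<in> Fo" if "aCh v z \<in> Fo" "z \<in> Leg Fo" "aCol b' (bc False) z \<in> Fo"
    "aCh v w \<in> Fo" "aB w \<in> Fo" "w \<noteq> gt" for v z b' w
    using that(1-5) unfolding Fo_iff Leg_Fo_iff
    by eventually_elim (rule chase_inv.brake_same[OF inv _ _ _ _ _ that(6)])
  show "z = z'" if "aCh v z \<in> Fo" "aCh v z' \<in> Fo" "aCol b' q' z \<in> Fo"
    "aCol b' q' z' \<in> Fo" "z \<in> Leg Fo" "z' \<in> Leg Fo" for v z z' b' q'
  proof -
    from that have "\<forall>\<^sub>F i in sequentially. z = z'" unfolding Fo_iff Leg_Fo_iff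
      by eventually_elim (rule chase_inv.sibling_unique[OF inv])
    then show ?thesis by simp
  qed
  show "(rt, z) \<in> (child Fo)\<^sup>*" if "z \<in> Leg Fo" for z
  proof -
    obtain i where "z \<in> Leg (F i)"
      using \<open>z \<in> Leg Fo\<close> unfolding Leg_Fo_iff by (auto simp: eventually_sequentially)
    then show ?thesis using chase_inv.reach[OF inv] rtrancl_mono[OF child_F_Fo] by blast
  qed
  show "\<exists>b q. aCol b q z \<in> Fo" if "z \<in> Leg Fo" "z \<noteq> rt" for z
  proof -
    obtain i where "z \<in> Leg (F i)"
      using \<open>z \<in> Leg Fo\<close> unfolding Leg_Fo_iff by (auto simp: eventually_sequentially)
    then show ?thesis using chase_inv.col_ex[OF inv] F_Fo \<open>z \<noteq> rt\<close> by blast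
  qed
  show "Fo \<subseteq> shaped (Leg Fo \<union> {u. aB u \<in> Fo} \<union> const_terms)"
  proof
    fix a assume "a \<in> Fo"
    then obtain i where "a \<in> F i" by (auto simp: Fo_def)
    then have "a \<in> shaped (Leg (F i) \<union> {u. aB u \<in> F i} \<union> const_terms)"
      using chase_inv.shape[OF inv] by blast
    moreover have "Leg (F i) \<union> {u. aB u \<in> F i} \<union> const_terms \<subseteq> Leg Fo \<union> {u. aB u \<in> Fo} \<union> const_terms"
      using Leg_F_Fo F_Fo by blast
    ultimately show "a \<in> shaped (Leg Fo \<union> {u. aB u \<in> Fo} \<union> const_terms)"
      using shaped_mono by blast
  qed
  show "\<exists>c. aK c v \<in> Fo \<and> aW tG c gt gt v \<in> Fo"
    if a: "aCh v z \<in> Fo" "z \<in> Leg Fo" "aCol b' (bc True) z \<in> Fo" for v z b'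
  proof -
    have "\<forall>\<^sub>F i in sequentially. \<exists>c. aK c v \<in> Fo \<and> aW tG c gt gt v \<in> Fo"
      using a unfolding Fo_iff Leg_Fo_iff
    proof eventually_elim
      case (elim i)
      then obtain c where "aK c v \<in> F i" "aW tG c gt gt v \<in> F i"
        using chase_inv.phase_goal[OF inv] by blast
      then have "aK c v \<in> Fo" "aW tG c gt gt v \<in> Fo" by (auto intro: F_Fo)
      then show ?case unfolding Fo_iff by blast
    qed
    then show ?thesis by simp
  qed
qed

sublocale fo: chase_inv Fo
  by (rule inv_Fo)

text \<open>With finitely many nodes there would be finitely many brakes as well, hence a finite
  stock of facts; but every step adds a fact.\<close>

lemma infinite_Leg: "infinite (Leg Fo)"
proof
  assume fin: "finite (Leg Fo)"
  have "\<forall>\<^sub>F i in sequentially. \<forall>z\<in>Leg Fo. z \<in> Leg (F i)"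
    using fin Leg_Fo_iff by (intro eventually_ball_finite) auto
  then obtain N where N: "Leg (F i) = Leg Fo" if "i \<ge> N" for i
    unfolding eventually_sequentially using Leg_F_Fo by blast
  have B: "{u. aB u \<in> F (N + k)} = {u. aB u \<in> F N}" for k
  proof (induction k)
    case (Suc k)
    have "Leg (F (Suc (N + k))) = Leg (F (N + k))" using N by simp
    then show ?case using chase_inv_step(4)[OF inv steps G] Suc by simp
  qed simp
  have "{u. aB u \<in> Fo} \<subseteq> {u. aB u \<in> F N}"
  proof clarify
    fix u assume "aB u \<in> Fo"
    then obtain M where "\<forall>i\<ge>M. aB u \<in> F i" unfolding Fo_iff eventually_sequentially by blast
    then have "aB u \<in> F (N + M)" by simp
    then show "aB u \<in> F N" using B by blast
  qed
  moreover have "finite {u. aB u \<in> F N}"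
    by (rule finite_subset[of _ "(\<lambda>a. hd (args a)) ` F N"]) (force, simp add: finite_F)
  ultimately have "finite {u. aB u \<in> Fo}" by (rule finite_subset)
  then have finFo: "finite Fo" using finite_subset[OF fo.shape finite_shaped] fin by simp
  have "i \<le> card (F i)" for i
  proof (induction i)
    case (Suc i)
    then show ?case using psubset_card_mono[OF finite_F step_growing[OF steps], of i] by simp
  qed simp
  moreover have "card (F i) \<le> card Fo" for i
    using finFo F_Fo by (intro card_mono) auto
  ultimately have "Suc (card Fo) \<le> card Fo" by (meson le_trans)
  then show False by simp
qed

text \<open>Siblings differ in colour, and there are four colours.\<close>

lemma finite_children: "finite {z. (v, z) \<in> child Fo}"
proof (rule inj_on_finite)
  define col where "col z = (SOME bq. aCol (bc (fst bq)) (bc (snd bq)) z \<in> Fo)" for z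
  have col: "aCol (bc (fst (col z))) (bc (snd (col z))) z \<in> Fo" if z: "(v, z) \<in> child Fo" for z
  proof -
    obtain b q where "aCol b q z \<in> Fo" using z fo.col_ex fo.not_root unfolding child_def by blast
    then obtain b q where "aCol (bc b) (bc q) z \<in> Fo" using fo.col_bits by blast
    then have "\<exists>bq. aCol (bc (fst bq)) (bc (snd bq)) z \<in> Fo" by (intro exI[of _ "(b, q)"]) simp
    then show ?thesis unfolding col_def by (rule someI_ex)
  qed
  show "inj_on col {z. (v, z) \<in> child Fo}"
  proof (rule inj_onI)
    fix z z' assume z: "z \<in> {z. (v, z) \<in> child Fo}" "z' \<in> {z. (v, z) \<in> child Fo}" "col z = col z'"
    then have e: "aCol (bc (fst (col z))) (bc (snd (col z))) z' \<in> Fo" using col[of z'] by simp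
    have "aCol (bc (fst (col z))) (bc (snd (col z))) z \<in> Fo" using col[of z] z by simp
    moreover have "aCh v z \<in> Fo" "z \<in> Leg Fo" "aCh v z' \<in> Fo" "z' \<in> Leg Fo"
      using z by (auto simp: child_def)
    ultimately show "z = z'" using fo.sibling_unique[of v z z'] e by blast
  qed
  show "finite (UNIV :: (bool \<times> bool) set)" by simp
qed simp

text \<open>A node with infinitely many descendants and finitely many children has a child with
  infinitely many descendants.\<close>

lemma path: "\<exists>p. p 0 = rt \<and> (\<forall>j. (p j, p (Suc j)) \<in> child Fo)"
proof -
  define big where "big v \<longleftrightarrow> infinite ((child Fo)\<^sup>* `` {v})" for v
  have "Leg Fo \<subseteq> (child Fo)\<^sup>* `` {rt}" using fo.reach by blast
  then have "big rt" unfolding big_def using infinite_Leg finite_subset by blast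
  moreover have "\<exists>z. big z \<and> (v, z) \<in> child Fo" if v: "big v" for v
  proof (rule ccontr)
    assume a: "\<not> (\<exists>z. big z \<and> (v, z) \<in> child Fo)"
    have "(child Fo)\<^sup>* `` {v} \<subseteq> insert v (\<Union>z\<in>{z. (v, z) \<in> child Fo}. (child Fo)\<^sup>* `` {z})"
      by (auto elim: converse_rtranclE)
    moreover have "finite (insert v (\<Union>z\<in>{z. (v, z) \<in> child Fo}. (child Fo)\<^sup>* `` {z}))"
      using a finite_children by (auto simp: big_def)
    ultimately show False using v finite_subset unfolding big_def by blast
  qed
  ultimately obtain p where "p 0 = rt" "\<And>j. big (p j) \<and> (p j, p (Suc j)) \<in> child Fo"
    using dependent_nat_choice[of "\<lambda>n v. big v \<and> (n = 0 \<longrightarrow> v = rt)" "\<lambda>n v z. (v, z) \<in> child Fo"]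
    by (metis nat.simps(3))
  then show ?thesis by blast
qed

end

section \<open>The solution on an infinite branch\<close>

locale chase_path = chase_run +
  fixes p :: "nat \<Rightarrow> trm"
  assumes p0: "p 0 = rt" and p_child: "(p j, p (Suc j)) \<in> child Fo"
begin

lemma p_edge: "aCh (p j) (p (Suc j)) \<in> Fo" and p_Leg: "p j \<in> Leg Fo"
proof -
  show "aCh (p j) (p (Suc j)) \<in> Fo" using p_child[of j] by (simp add: child_def)
  show "p j \<in> Leg Fo" using p_child[of "j - 1"] p0 fo.base by (cases j) (auto simp: child_def)
qed

lemma p_parent: "aCh v (p j) \<in> Fo \<Longrightarrow> \<exists>i. j = Suc i \<and> v = p i"
proof (cases j)
  case 0
  then show "aCh v (p j) \<in> Fo \<Longrightarrow> ?thesis" using fo.not_root[OF _ p_Leg] p0 by metis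
next
  case (Suc i)
  then show "aCh v (p j) \<in> Fo \<Longrightarrow> ?thesis" using fo.parent_unique[OF _ p_edge p_Leg] by blast
qed

lemma p_inj: "p i = p j \<longleftrightarrow> i = j"
proof
  show "p i = p j \<Longrightarrow> i = j"
  proof (induction i arbitrary: j)
    case 0
    then show ?case using p0 fo.not_root[OF p_edge p_Leg] by (cases j) auto
  next
    case (Suc i)
    then obtain k where "j = Suc k" "p i = p k" using p_parent[of "p i" j] p_edge[of i] by auto
    then show ?case using Suc.IH by blast
  qed
qed simp

definition "X = {j. \<exists>q. aCol (bc True) q (p j) \<in> Fo}"

definition "ph j \<longleftrightarrow> (\<exists>b. aCol b (bc True) (p j) \<in> Fo)"

lemma zero_X: "0 \<notin> X"
  using fo.col_root p0 by (auto simp: X_def)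

lemma p_col: "\<exists>b. aCol b (bc (ph (Suc j))) (p (Suc j)) \<in> Fo"
proof -
  obtain b q where "aCol b q (p (Suc j)) \<in> Fo"
    using fo.col_ex[OF p_Leg fo.not_root[OF p_edge p_Leg]] by blast
  then obtain b' q' where c: "aCol (bc b') (bc q') (p (Suc j)) \<in> Fo" using fo.col_bits by blast
  have "ph (Suc j) = q'"
  proof
    assume "ph (Suc j)"
    then obtain b'' where "aCol b'' (bc True) (p (Suc j)) \<in> Fo" by (auto simp: ph_def)
    then have "bc True = bc q'" using fo.col_unique[OF p_Leg c] by simp
    then show q' by simp
  next
    assume q'
    then show "ph (Suc j)" using c by (auto simp: ph_def)
  qed
  then show ?thesis using c by blast
qed

text \<open>Otherwise all nodes from \<open>p J\<close> on share one brake \<open>w\<close>.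
  Fairness makes \<open>w\<close> real at some time \<open>t\<close>, when only finitely many nodes
  exist. A later node of the branch would then have been created below a parent whose brake was
  already real.\<close>

lemma infinitely_many_phases: "\<exists>j\<ge>J. ph (Suc j)"
proof (rule ccontr)
  assume "\<not> (\<exists>j\<ge>J. ph (Suc j))"
  then have n: "\<And>j. J \<le> j \<Longrightarrow> \<not> ph (Suc j)" by blast
  obtain w where w: "w \<noteq> gt" "aCh (p J) w \<in> Fo" "aB w \<in> Fo" using fo.brake_ex[OF p_Leg] by blast
  have pw: "aCh (p (J + k)) w \<in> Fo" for k
  proof (induction k)
    case (Suc k)
    obtain b where "aCol b (bc False) (p (Suc (J + k))) \<in> Fo" using p_col[of "J + k"] n[of "J + k"] by auto
    then show ?case using fo.brake_same[OF p_edge p_Leg _ Suc w(3,1)] by simp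
  qed (use w in simp)
  obtain i where "aB w \<in> F i" using w(3) by (auto simp: Fo_def)
  then have "loads brake_rule (\<lambda>_. w) (F i)" by (simp add: loads_brake)
  moreover have "brake_rule \<in> rules G x" by (simp add: rules_eq)
  ultimately obtain t where "blocked brake_rule (\<lambda>_. w) (F t)"
    using run unfolding infinite_chase_def fst_conv by blast
  then have t: "aR w \<in> F t" by (simp add: blocked_brake)
  have "finite (Leg (F t))"
    by (rule finite_subset[of _ "(\<lambda>a. hd (args a)) ` F t"]) (force simp: Leg_def, simp add: finite_F)
  moreover have "infinite (range (\<lambda>k. p (Suc (J + k))))"
    by (intro range_inj_infinite) (simp add: inj_def p_inj)
  ultimately have "\<not> range (\<lambda>k. p (Suc (J + k))) \<subseteq> Leg (F t)" using finite_subset by blast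
  then obtain k where k: "p (Suc (J + k)) \<notin> Leg (F t)" by blast
  let ?z = "p (Suc (J + k))"
  obtain m where m: "?z \<in> Leg (F m)"
    using p_Leg[of "Suc (J + k)"] unfolding Leg_Fo_iff by (auto simp: eventually_sequentially)
  \<comment> \<open>The node is missing just before time \<open>l\<close>, so the step into
    \<open>F l\<close> creates it.\<close>
  define l where "l = (LEAST m. ?z \<in> Leg (F m))"
  have l: "?z \<in> Leg (F l)" unfolding l_def using m by (rule LeastI)
  then have "\<not> l \<le> t" using k Leg_mono by blast
  then obtain l' where l': "l = Suc l'" "t \<le> l'" by (cases l) auto
  have "?z \<notin> Leg (F l')" using not_less_Least[of l' "\<lambda>m. ?z \<in> Leg (F m)"] l'(1) by (simp add: l_def)
  then obtain v w' where vw: "aCh v ?z \<in> F (Suc l')" "aCh v w' \<in> F l'" "aB w' \<in> F l'" "aR w' \<notin> F l'"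
    using chase_inv_step(3)[OF inv steps G, of ?z l'] l l'(1) by blast
  then have "v = p (J + k)" using p_parent[OF F_Fo] by blast
  \<comment> \<open>\<open>gt\<close> is real throughout, so it cannot be the brake that was not yet
    real.\<close>
  moreover have "w' \<noteq> gt" using vw(4) chase_inv.base(1)[OF inv] by blast
  ultimately have "w' = w"
    using fo.brake_unique[OF p_Leg _ _ _ pw w(3,1)] F_Fo[OF vw(2)] F_Fo[OF vw(3)] by blast
  then show False using vw(4) t F_mono[OF l'(2)] by blast
qed

text \<open>The phase that \<open>p j\<close> lies in, the root being in phase \<open>0\<close>. It
  is also the goal in force at \<open>p j\<close>.\<close>

fun cnt :: "nat \<Rightarrow> nat" where
  "cnt 0 = 0"
| "cnt (Suc j) = (if ph (Suc j) then Suc (cnt j) else cnt j)"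

text \<open>The counter rises by at most one at a time and without bound, so every phase
  \<open>m\<close> has a last node \<open>p j\<close>, and its goal must have been reached
  there.\<close>

lemma cnt_hits: "\<exists>j. cnt j = m \<and> ph (Suc j)"
proof (induction m)
  case 0
  define j where "j = (LEAST j. ph (Suc j))"
  have j: "ph (Suc j)" unfolding j_def using infinitely_many_phases[of 0] by (auto intro: LeastI)
  have "i \<le> j \<Longrightarrow> cnt i = 0" for i
  proof (induction i)
    case (Suc i)
    then show ?case using not_less_Least[of i "\<lambda>j. ph (Suc j)"] by (simp add: j_def)
  qed simp
  then show ?case using j by blast
next
  case (Suc m)
  then obtain j0 where j0: "cnt j0 = m" "ph (Suc j0)" by blast
  define j where "j = (LEAST j. j > j0 \<and> ph (Suc j))"
  have "\<exists>j. j > j0 \<and> ph (Suc j)" using infinitely_many_phases[of "Suc j0"] by (meson Suc_le_lessD)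
  then have j: "j > j0" "ph (Suc j)" unfolding j_def by (metis (mono_tags, lifting) LeastI_ex)+
  have "Suc j0 + i \<le> j \<Longrightarrow> cnt (Suc j0 + i) = Suc m" for i
  proof (induction i)
    case (Suc i)
    then have "\<not> ph (Suc (Suc j0 + i))"
      using not_less_Least[of "Suc j0 + i" "\<lambda>j. j > j0 \<and> ph (Suc j)"] by (simp add: j_def)
    then show ?case using Suc by simp
  qed (use j0 in simp)
  from this[of "j - Suc j0"] j show ?case by auto
qed

text \<open>The intended meaning of each tag, numbers being depths on the branch. The tags are
  distinct constants, so at most one of the implications is in force.\<close>

definition Tr :: "trm \<Rightarrow> trm \<Rightarrow> trm \<Rightarrow> trm \<Rightarrow> bool" where
  "Tr t a b c \<longleftrightarrow>
    (t = tS \<longrightarrow> (\<exists>n. a = p n \<and> b = p (Suc n))) \<and>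
    (t = tP \<longrightarrow> (\<exists>m n. a = p m \<and> b = p n \<and> c = p (prod_encode (m, n)))) \<and>
    (t = tX \<longrightarrow> (\<exists>b' n. a = bc b' \<and> b = p n \<and> (n \<in> X) = b')) \<and>
    (t = tI \<longrightarrow> a = p x) \<and>
    (t = tG \<longrightarrow> (\<exists>m. a = p m \<and> (\<exists>c\<in>set G. meets X x c m))) \<and>
    (t = tZ \<longrightarrow> a = p 0)"

text \<open>Only worlds on the branch are constrained: a fact of another world speaks about another
  branch, with other guesses.\<close>

definition sound :: "atom set \<Rightarrow> bool" where
  "sound A \<longleftrightarrow> (\<forall>j t a b c. aW t a b c (p j) \<in> A \<longrightarrow> Tr t a b c) \<and>
    (\<forall>j c. aK c (p j) \<in> A \<longrightarrow> c = p (cnt j))"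

lemma sound_insert_W:
  assumes "sound A" "\<And>j. v = p j \<Longrightarrow> Tr t a b c"
  shows "sound (insert (aW t a b c v) A)"
  using assms unfolding sound_def by auto

lemma X_col:
  assumes c: "aCol b q (p n) \<in> Fo"
  shows "\<exists>b'. b = bc b' \<and> (n \<in> X) = b'"
proof -
  obtain b' where b: "b = bc b'" using fo.col_bits[OF c] by blast
  have "(n \<in> X) = b'"
  proof
    assume "n \<in> X"
    then obtain q'' where "aCol (bc True) q'' (p n) \<in> Fo" by (auto simp: X_def)
    then have "b = bc True" using fo.col_unique[OF p_Leg c] by simp
    then show b' using b by simp
  next
    assume b'
    then show "n \<in> X" using b c by (auto simp: X_def)
  qed
  with b show ?thesis by blast
qed

text \<open>Once the value of a term is on the branch, the atom for its outermost symbol places its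
  immediate subterms there too, so the induction reaches the variables. Hence \<open>\<nu>\<close>
  need be right only for variables landing on the branch.\<close>

lemma sound_flat:
  assumes "\<forall>a\<in>set (flat t). asubst s a \<in> A" "sound A" "s 0 = p j" "s (vn t) \<in> range p"
    and \<nu>: "\<And>n. s (vn (PV n)) \<in> range p \<Longrightarrow> s (vn (PV n)) = p (\<nu> n)"
  shows "s (vn t) = p (peval \<nu> t)"
  using assms(1,4)
proof (induction t)
  case (PV n)
  then show ?case using \<nu> by simp
next
  case PZero
  then have "aW tZ (s (vn PZero)) gt gt (p j) \<in> A" using assms(3) by (simp add: asubst_def)
  then have "Tr tZ (s (vn PZero)) gt gt" using assms(2) unfolding sound_def by blast
  then show ?case by (simp add: Tr_def)
next
  case (PSuc t)
  then have "aW tS (s (vn t)) (s (vn (PSuc t))) gt (p j) \<in> A" using assms(3) by (simp add: asubst_def)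
  then have "Tr tS (s (vn t)) (s (vn (PSuc t))) gt" using assms(2) unfolding sound_def by blast
  then obtain n where n: "s (vn t) = p n" "s (vn (PSuc t)) = p (Suc n)" by (auto simp: Tr_def)
  then have "p n = p (peval \<nu> t)" using PSuc by auto
  then show ?case using n p_inj by simp
next
  case (PPair t1 t2)
  then have "aW tP (s (vn t1)) (s (vn t2)) (s (vn (PPair t1 t2))) (p j) \<in> A"
    using assms(3) by (simp add: asubst_def)
  then have "Tr tP (s (vn t1)) (s (vn t2)) (s (vn (PPair t1 t2)))"
    using assms(2) unfolding sound_def by blast
  then obtain m n where n: "s (vn t1) = p m" "s (vn t2) = p n"
    "s (vn (PPair t1 t2)) = p (prod_encode (m, n))" by (auto simp: Tr_def)
  then have "p m = p (peval \<nu> t1)" "p n = p (peval \<nu> t2)" using PPair by auto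
  then show ?case using n p_inj by simp
qed

lemma sound_clause:
  assumes "c \<in> set G" "sound A" "loads (clause_rule c) s A" "s 0 = p j"
  shows "\<exists>m. s (vn (fst c)) = p m \<and> meets X x c m"
proof -
  \<comment> \<open>Reads a number off its node; for variables off the branch the value is
    arbitrary, as \<open>sound_flat\<close> permits.\<close>
  define \<nu> where "\<nu> n = (THE k. s (vn (PV n)) = p k)" for n
  have \<nu>: "s (vn (PV n)) = p (\<nu> n)" if r: "s (vn (PV n)) \<in> range p" for n
  proof -
    obtain k where "s (vn (PV n)) = p k" using r by blast
    then show ?thesis unfolding \<nu>_def by (simp add: p_inj)
  qed
  have body: "\<And>a. a \<in> set (body (clause_rule c)) \<Longrightarrow> asubst s a \<in> A"
    using assms(3) by (auto simp: loads_def)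
  have "asubst s (aW tI (tv (PV 0)) gt gt (Var 0)) \<in> A"
    by (rule body) (simp add: clause_rule_def)
  then have "aW tI (s (vn (PV 0))) gt gt (p j) \<in> A" using assms(4) by (simp add: asubst_def)
  then have "Tr tI (s (vn (PV 0))) gt gt" using assms(2) unfolding sound_def by blast
  then have i: "s (vn (PV 0)) = p x" by (simp add: Tr_def)
  then have \<nu>0: "\<nu> 0 = x" using \<nu>[of 0] p_inj by auto
  have fl: "\<forall>a\<in>set (flat (fst c)). asubst s a \<in> A"
    using body by (auto simp: clause_rule_def)
  \<comment> \<open>The pair pattern matters here: its pairing atom places the whole pattern on the
    branch.\<close>
  obtain t1 t2 where t12: "fst c = PPair t1 t2" using assms(1) G unfolding pair_patterns_def by blast
  have "asubst s (aW tP (tv t1) (tv t2) (tv (PPair t1 t2)) (Var 0)) \<in> A"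
    using fl t12 by simp
  then have "aW tP (s (vn t1)) (s (vn t2)) (s (vn (PPair t1 t2))) (p j) \<in> A"
    using assms(4) by (simp add: asubst_def)
  then have "Tr tP (s (vn t1)) (s (vn t2)) (s (vn (PPair t1 t2)))"
    using assms(2) unfolding sound_def by blast
  then have "s (vn (fst c)) \<in> range p" unfolding t12 by (auto simp: Tr_def)
  then have 1: "s (vn (fst c)) = p (peval \<nu> (fst c))"
    using sound_flat[OF fl assms(2,4) _ \<nu>] by blast
  have "(peval \<nu> t \<in> X) = b" if bt: "(b, t) \<in> set (snd c)" for b t
  proof -
    have "asubst s (aW tX (bc b) (tv t) gt (Var 0)) \<in> A"
      by (rule body) (use bt in \<open>force simp: clause_rule_def\<close>)
    then have "aW tX (bc b) (s (vn t)) gt (p j) \<in> A" using assms(4) by (simp add: asubst_def)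
    then have "Tr tX (bc b) (s (vn t)) gt" using assms(2) unfolding sound_def by blast
    then obtain n where n: "s (vn t) = p n" "(n \<in> X) = b" by (auto simp: Tr_def)
    have "\<forall>a\<in>set (flat t). asubst s a \<in> A"
      using body bt by (fastforce simp: clause_rule_def)
    then have "s (vn t) = p (peval \<nu> t)" using sound_flat[OF _ assms(2,4) _ \<nu>] n by blast
    then show ?thesis using n p_inj by simp
  qed
  then have "meets X x c (peval \<nu> (fst c))" unfolding meets_def using \<nu>0 by blast
  with 1 show ?thesis by blast
qed

lemma sound_input:
  assumes "sound A" "\<forall>a\<in>set (input_body k). asubst s a \<in> A" "s 0 = p j"
  shows "s (Suc k) = p k"
  using assms(2)
proof (induction k)
  case 0
  then have "aW tZ (s 1) gt gt (p j) \<in> A" using assms(3) by (simp add: asubst_def)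
  then have "Tr tZ (s 1) gt gt" using assms(1) unfolding sound_def by blast
  then show ?case by (simp add: Tr_def)
next
  case (Suc k)
  then have "aW tS (s (Suc k)) (s (Suc (Suc k))) gt (p j) \<in> A" using assms(3) by (simp add: asubst_def)
  then have "Tr tS (s (Suc k)) (s (Suc (Suc k))) gt" using assms(1) unfolding sound_def by blast
  then show ?case using Suc p_inj by (auto simp: Tr_def)
qed

lemma sound_base:
  assumes "R \<in> set base_rules" "loads R s A" "head R = [a]" "sound A" "A \<subseteq> Fo"
  shows "sound (insert (asubst s a) A)"
proof -
  have W: "Tr t a b c" if "aW t a b c (p j) \<in> A" for t a b c j
    using that assms(4) unfolding sound_def by blast
  have K: "c = p (cnt j)" if "aK c (p j) \<in> A" for c j
    using that assms(4) unfolding sound_def by blast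
  \<comment> \<open>Edges into the branch come from the branch, so what a world on it inherits was
    already correct one node higher.\<close>
  have P: "\<exists>i. j = Suc i \<and> v = p i" if "aCh v (p j) \<in> A" for v j
    using that assms(5) p_parent by blast
  have PH: "q = ph j" if "aCol b (bc q) (p j) \<in> A" for b q j
  proof -
    have c: "aCol b (bc q) (p j) \<in> Fo" using that assms(5) by blast
    show ?thesis
    proof (cases q)
      case True then show ?thesis using c by (auto simp: ph_def)
    next
      case False
      have "\<not> ph j"
      proof
        assume "ph j"
        then obtain b'' where "aCol b'' (bc True) (p j) \<in> Fo" by (auto simp: ph_def)
        then have "bc q = bc True" using fo.col_unique[OF p_Leg c] by simp
        then show False using False by simp
      qed
      then show ?thesis using False by simp
    qed
  qed
  have XC: "\<exists>b'. b = bc b' \<and> (n \<in> X) = b'" if "aCol b q (p n) \<in> A" for b q n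
    using that X_col assms(5) by blast
  note newW = sound_insert_W[OF assms(4)]
  have newK: "sound (insert (aK c v) A)" if "\<And>j. v = p j \<Longrightarrow> c = p (cnt j)" for c v
    using assms(4) that unfolding sound_def by auto
  show ?thesis
    using assms(1) unfolding base_rules_def
  proof (simp only: list.set insert_iff empty_iff, elim disjE FalseE, goal_cases)
    case 1
    then have "asubst s a = aCh (s 0) gt" using assms(3) by (auto simp: asubst_def)
    then show ?case using assms(4) unfolding sound_def by simp
  next
    case 2
    then have b: "aW (s 0) (s 1) (s 2) (s 3) (s 4) \<in> A" "aCh (s 4) (s 5) \<in> A"
      and a: "asubst s a = aW (s 0) (s 1) (s 2) (s 3) (s 5)"
      using assms(2,3) by (auto simp: loads_def asubst_def)
    show ?case unfolding a
    proof (rule newW)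
      fix j assume "s 5 = p j"
      then obtain i where "s 4 = p i" using P[of "s 4" j] b by auto
      then show "Tr (s 0) (s 1) (s 2) (s 3)" using W b by metis
    qed
  next
    case 3
    then have b: "aCh (s 0) (s 1) \<in> A" and a: "asubst s a = aW tS (s 0) (s 1) gt (s 1)"
      using assms(2,3) by (auto simp: loads_def asubst_def)
    show ?case unfolding a
    proof (rule newW)
      fix j assume "s 1 = p j"
      then show "Tr tS (s 0) (s 1) gt" using P[of "s 0" j] b by (auto simp: Tr_def)
    qed
  next
    case 4
    then have b: "aCol (s 0) (s 1) (s 2) \<in> A" and a: "asubst s a = aW tX (s 0) (s 2) gt (s 2)"
      using assms(2,3) by (auto simp: loads_def asubst_def)
    show ?case unfolding a
    proof (rule newW)
      fix j assume "s 2 = p j"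
      then show "Tr tX (s 0) (s 2) gt" using XC[of "s 0" "s 1" j] b by (auto simp: Tr_def)
    qed
  next
    case 5
    then have b: "aW tP (s 0) (s 1) (s 2) (s 6) \<in> A" "aW tS (s 3) (s 1) gt (s 6) \<in> A"
      "aW tS (s 0) (s 4) gt (s 6) \<in> A" "aW tS (s 2) (s 5) gt (s 6) \<in> A"
      and a: "asubst s a = aW tP (s 4) (s 3) (s 5) (s 6)"
      using assms(2,3) by (auto simp: loads_def asubst_def)
    show ?case unfolding a
    proof (rule newW)
      fix j assume "s 6 = p j"
      then have "Tr tP (s 0) (s 1) (s 2)" "Tr tS (s 3) (s 1) gt" "Tr tS (s 0) (s 4) gt" "Tr tS (s 2) (s 5) gt"
        using b W by auto
      then obtain m n where 1: "s 0 = p m" "s 1 = p n" "s 2 = p (prod_encode (m, n))"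
        by (auto simp: Tr_def)
      obtain n' where 2: "s 3 = p n'" "s 1 = p (Suc n')" using \<open>Tr tS (s 3) (s 1) gt\<close> by (auto simp: Tr_def)
      obtain m' where 3: "s 0 = p m'" "s 4 = p (Suc m')" using \<open>Tr tS (s 0) (s 4) gt\<close> by (auto simp: Tr_def)
      obtain k where 4: "s 2 = p k" "s 5 = p (Suc k)" using \<open>Tr tS (s 2) (s 5) gt\<close> by (auto simp: Tr_def)
      have "n = Suc n'" "m = m'" "k = prod_encode (m, n)" using 1 2 3 4 p_inj by metis+
      with 2 3 4 have "s 4 = p (Suc m)" "s 3 = p n'" "s 5 = p (Suc (prod_encode (m, Suc n')))"
        by auto
      moreover have "Suc (prod_encode (m, Suc n')) = prod_encode (Suc m, n')"
        by (simp add: prod_encode_def)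
      ultimately show "Tr tP (s 4) (s 3) (s 5)" by (auto simp: Tr_def)
    qed
  next
    case 6
    then have b: "aW tP (s 0) rt (s 1) (s 6) \<in> A"
      "aW tS (s 0) (s 2) gt (s 6) \<in> A" "aW tS (s 1) (s 3) gt (s 6) \<in> A"
      and a: "asubst s a = aW tP rt (s 2) (s 3) (s 6)"
      using assms(2,3) by (auto simp: loads_def asubst_def)
    show ?case unfolding a
    proof (rule newW)
      fix j assume "s 6 = p j"
      then have "Tr tP (s 0) rt (s 1)" "Tr tS (s 0) (s 2) gt" "Tr tS (s 1) (s 3) gt"
        using b W by auto
      then obtain m n where 1: "s 0 = p m" "rt = p n" "s 1 = p (prod_encode (m, n))"
        by (auto simp: Tr_def)
      obtain m' where 3: "s 0 = p m'" "s 2 = p (Suc m')" using \<open>Tr tS (s 0) (s 2) gt\<close> by (auto simp: Tr_def)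
      obtain k where 4: "s 1 = p k" "s 3 = p (Suc k)" using \<open>Tr tS (s 1) (s 3) gt\<close> by (auto simp: Tr_def)
      have "n = 0" "m = m'" "k = prod_encode (m, n)" using 1 3 4 p_inj p0 by metis+
      with 3 4 have "s 2 = p (Suc m)" "s 3 = p (Suc (prod_encode (m, 0)))" by auto
      moreover have "Suc (prod_encode (m, 0)) = prod_encode (0, Suc m)"
        by (simp add: prod_encode_def)
      ultimately have "rt = p 0 \<and> s 2 = p (Suc m) \<and> s 3 = p (prod_encode (0, Suc m))" using p0 by simp
      then have "\<exists>m n. rt = p m \<and> s 2 = p n \<and> s 3 = p (prod_encode (m, n))" by blast
      then show "Tr tP rt (s 2) (s 3)" by (simp add: Tr_def)
    qed
  next
    case 7
    then have b: "aK (s 0) (s 1) \<in> A" "aCh (s 1) (s 2) \<in> A" "aCol (s 3) (bc False) (s 2) \<in> A"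
      and a: "asubst s a = aK (s 0) (s 2)"
      using assms(2,3) by (auto simp: loads_def asubst_def)
    show ?case unfolding a
    proof (rule newK)
      fix j assume j: "s 2 = p j"
      then obtain i where "j = Suc i" "s 1 = p i" using P[of "s 1" j] b by auto
      then show "s 0 = p (cnt j)" using K b PH[of "s 3" False j] j by auto
    qed
  next
    case 8
    then have b: "aK (s 0) (s 1) \<in> A" "aCh (s 1) (s 2) \<in> A" "aCol (s 3) (bc True) (s 2) \<in> A"
      "aW tS (s 0) (s 4) gt (s 2) \<in> A" and a: "asubst s a = aK (s 4) (s 2)"
      using assms(2,3) by (auto simp: loads_def asubst_def)
    show ?case unfolding a
    proof (rule newK)
      fix j assume j: "s 2 = p j"
      then obtain i where i: "j = Suc i" "s 1 = p i" using P[of "s 1" j] b by auto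
      have "Tr tS (s 0) (s 4) gt" using W b j by metis
      then obtain n where "s 0 = p n" "s 4 = p (Suc n)" by (auto simp: Tr_def)
      moreover have "s 0 = p (cnt i)" using K b i by metis
      ultimately show "s 4 = p (cnt j)" using PH[of "s 3" True j] j b i p_inj by auto
    qed
  qed
qed

lemma sound_F: "sound (F i)"
proof (induction i)
  case 0
  have "F 0 = set dbase" using run by (simp add: infinite_chase_def)
  moreover have "Tr t a b c" if "aW t a b c (p j) \<in> set dbase" for t a b c j
  proof -
    have "Tr tP rt rt rt" unfolding Tr_def
      by (auto intro!: exI[of _ 0] simp: p0 prod_encode_def)
    moreover have "Tr tX (bc False) rt gt" unfolding Tr_def
      by (auto intro!: exI[of _ 0] simp: p0 zero_X)
    moreover have "Tr tZ rt gt gt" by (auto simp: Tr_def p0)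
    ultimately show ?thesis using that by (auto simp: dbase_def)
  qed
  moreover have "c = p (cnt j)" if "aK c (p j) \<in> set dbase" for c j
  proof -
    have "c = rt" "p j = p 0" using that p0 by (auto simp: dbase_def)
    then have "j = 0" using p_inj by blast
    then show ?thesis using \<open>c = rt\<close> p0 by simp
  qed
  ultimately show ?case by (simp add: sound_def)
next
  case (Suc i)
  from steps[of i] G show ?case
  proof (cases rule: step_cases)
    case (datalog R s a)
    from datalog(1) consider "R = input_rule x" | "R \<in> set base_rules" | c where "c \<in> set G" "R = clause_rule c"
      by (auto simp: datalog_def)
    then show ?thesis
    proof cases
      case 1
      then have a: "asubst s a = aW tI (s (Suc x)) gt gt (s 0)"
        using datalog(3) by (auto simp: input_rule_def asubst_def)
      have "Tr tI (s (Suc x)) gt gt" if "s 0 = p j" for j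
        using sound_input[OF Suc, of x s j] that datalog(2) 1 by (auto simp: loads_def input_rule_def Tr_def)
      then show ?thesis unfolding datalog(4) a by (rule sound_insert_W[OF Suc])
    next
      case 2
      then show ?thesis unfolding datalog(4) using sound_base datalog Suc F_Fo by blast
    next
      case 3
      then have a: "asubst s a = aW tG (s (vn (fst c))) gt gt (s 0)"
        using datalog(3) by (auto simp: clause_rule_def asubst_def)
      have "Tr tG (s (vn (fst c))) gt gt" if "s 0 = p j" for j
        using sound_clause[OF 3(1) Suc, of s j] that datalog(2) 3 by (auto simp: Tr_def)
      then show ?thesis unfolding datalog(4) a by (rule sound_insert_W[OF Suc])
    qed
  qed (use Suc in \<open>auto simp: sound_def choice_facts_def phase_facts_def cols_def\<close>)
qed

text \<open>The branch leaves phase \<open>m\<close>, which it can do only after the goal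
  \<open>m\<close> has been reached by some clause.\<close>

lemma solvable: "solvable G x"
proof -
  have "\<exists>c\<in>set G. meets X x c m" for m
  proof -
    obtain j where j: "cnt j = m" "ph (Suc j)" using cnt_hits by blast
    then obtain c where "aK c (p j) \<in> Fo" "aW tG c gt gt (p j) \<in> Fo"
      using fo.phase_goal[OF p_edge p_Leg] by (auto simp: ph_def)
    then obtain i i' where "aK c (p j) \<in> F i" "aW tG c gt gt (p j) \<in> F i'" by (auto simp: Fo_def)
    then have "c = p (cnt j)" "Tr tG c gt gt" using sound_F unfolding sound_def by blast+
    then obtain m' where "p m = p m'" "\<exists>c\<in>set G. meets X x c m'" using j by (auto simp: Tr_def)
    then show ?thesis using p_inj by simp
  qed
  then show ?thesis using zero_X by (auto simp: solvable_def)
qed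

end

lemma solvable_if_infinite_chase:
  assumes "pair_patterns G" "infinite_chase (rules G x, set dbase) F"
  shows "solvable G x"
proof -
  interpret chase_run G x F using assms by unfold_locales
  obtain p where p: "p 0 = rt" "\<And>j. (p j, p (Suc j)) \<in> child Fo" using path by blast
  interpret chase_path G x F p using p by unfold_locales
  show ?thesis by (rule solvable)
qed


section \<open>From solutions to infinite chase sequences\<close>

text \<open>A state is \<open>(n, l, A)\<close> with \<open>A\<close> exactly \<open>l\<close> steps
  before \<open>H n\<close>. The count \<open>l\<close> runs down, and at \<open>0\<close> the next
  run is entered; as runs are nonempty, this too is a proper step.\<close>

lemma concat_runs:
  assumes "\<And>n. r\<^sup>+\<^sup>+ (H n) (H (Suc n))"
  shows "\<exists>F. F 0 = H 0 \<and> (\<forall>i. r (F i) (F (Suc i))) \<and> (\<forall>n. \<exists>i. F i = H n) \<and>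
    (\<forall>i. \<exists>n. r\<^sup>*\<^sup>* (F i) (H n))"
proof -
  define P where "P s \<longleftrightarrow> (r ^^ fst (snd s)) (snd (snd s)) (H (fst s))" for s :: "nat \<times> nat \<times> 'a"
  define Q where "Q s s' \<longleftrightarrow> r (snd (snd s)) (snd (snd s')) \<and>
    (fst (snd s) = Suc (fst (snd s')) \<and> fst s' = fst s \<or> fst (snd s) = 0 \<and> fst s' = Suc (fst s))"
    for s s' :: "nat \<times> nat \<times> 'a"
  have "\<exists>s'. P s' \<and> Q s s'" if s: "P s" for s
  proof -
    obtain n l A where [simp]: "s = (n, l, A)" by (cases s)
    show ?thesis
    proof (cases l)
      case 0
      then have A: "A = H n" using s by (simp add: P_def)
      obtain l' where "0 < l'" "(r ^^ l') (H n) (H (Suc n))" using assms tranclp_power by metis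
      then obtain k where "(r ^^ Suc k) A (H (Suc n))" using A by (cases l') auto
      then obtain B where "r A B" "(r ^^ k) B (H (Suc n))" using relpowp_Suc_D2 by metis
      then show ?thesis using 0 by (intro exI[of _ "(Suc n, k, B)"]) (simp add: P_def Q_def)
    next
      case (Suc k)
      then have "(r ^^ Suc k) A (H n)" using s by (simp add: P_def del: relpowp.simps)
      then obtain B where "r A B" "(r ^^ k) B (H n)" using relpowp_Suc_D2 by metis
      then show ?thesis using Suc by (intro exI[of _ "(n, k, B)"]) (simp add: P_def Q_def)
    qed
  qed
  moreover have "P (0, 0, H 0)" by (simp add: P_def)
  ultimately obtain S where S: "\<And>i. P (S i)" "\<And>i. Q (S i) (S (Suc i))" "S 0 = (0, 0, H 0)"
    using dependent_nat_choice[of "\<lambda>i s. P s \<and> (i = 0 \<longrightarrow> s = (0, 0, H 0))" "\<lambda>i. Q"]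
    by (metis old.nat.distinct(2))
  have down: "fst (S (i + fst (snd (S i)))) = fst (S i) \<and> fst (snd (S (i + fst (snd (S i))))) = 0" for i
  proof (induction "fst (snd (S i))" arbitrary: i)
    case (Suc l)
    then have "fst (snd (S (Suc i))) = l" "fst (S (Suc i)) = fst (S i)" using S(2)[of i] by (auto simp: Q_def)
    then show ?case using Suc.hyps(1)[of "Suc i"] Suc.hyps(2) by (metis add_Suc add_Suc_right)
  qed simp
  have hit: "\<exists>i. fst (S i) = n \<and> fst (snd (S i)) = 0" for n
  proof (induction n)
    case 0
    then show ?case using S(3) by (intro exI[of _ 0]) simp
  next
    case (Suc n)
    then obtain i where "fst (S i) = n" "fst (snd (S i)) = 0" by blast
    then have "fst (S (Suc i)) = Suc n" using S(2)[of i] by (auto simp: Q_def)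
    with down[of "Suc i"] show ?case by (intro exI[of _ "Suc i + fst (snd (S (Suc i)))"]) simp
  qed
  let ?F = "\<lambda>i. snd (snd (S i))"
  have "?F 0 = H 0" "\<forall>i. r (?F i) (?F (Suc i))" using S(2,3) by (auto simp: Q_def)
  moreover have "\<exists>i. ?F i = H n" for n
  proof -
    obtain i where "fst (S i) = n" "fst (snd (S i)) = 0" using hit by blast
    then have "?F i = H n" using S(1)[of i] by (simp add: P_def)
    then show ?thesis ..
  qed
  moreover have "\<exists>n. r\<^sup>*\<^sup>* (?F i) (H n)" for i using S(1)[of i] unfolding P_def by (metis relpowp_imp_rtranclp)
  ultimately show ?thesis by (intro exI[of _ ?F]) blast
qed

section \<open>A run guided by a solution\<close>

locale solution =
  fixes G :: "clause list" and x :: nat and X :: "nat set"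
  assumes G: "pair_patterns G" and X0: "0 \<notin> X" and goals: "\<exists>c\<in>set G. meets X x c m"
begin

text \<open>The nulls are fixed in advance: even ones for nodes, odd ones for the brakes
  \<open>br\<close>.\<close>

definition pn :: "nat \<Rightarrow> trm" where
  "pn i = (case i of 0 \<Rightarrow> rt | Suc j \<Rightarrow> Null (2 * j))"

definition br :: "nat \<Rightarrow> trm" where
  "br i = (case i of 0 \<Rightarrow> bt | Suc j \<Rightarrow> Null (2 * j + 1))"

lemma pn_inj [simp]: "pn i = pn j \<longleftrightarrow> i = j"
  by (auto simp: pn_def split: nat.splits)

lemma br_inj [simp]: "br i = br j \<longleftrightarrow> i = j"
  by (auto simp: br_def split: nat.splits)

lemma pn_br [simp]: "pn i \<noteq> br j" "br j \<noteq> pn i" "pn i \<noteq> gt" "br i \<noteq> gt" "gt \<noteq> pn i" "gt \<noteq> br i"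
  by (auto simp: pn_def br_def split: nat.splits) presburger+

lemma pn_0: "pn 0 = rt" and br_0: "br 0 = bt"
  by (simp_all add: pn_def br_def)

text \<open>Goal \<open>m\<close> can be verified in a world of depth \<open>N\<close>. Bounding the
  pattern, the input and the literals suffices, since the value of a term bounds those of its
  subterms.\<close>

definition bounded_goal :: "nat \<Rightarrow> nat \<Rightarrow> bool" where
  "bounded_goal m N \<longleftrightarrow> x \<le> N \<and> m \<le> N \<and> (\<exists>c\<in>set G. \<exists>\<nu>. \<nu> 0 = x \<and> peval \<nu> (fst c) = m \<and>
     (\<forall>(b, t)\<in>set (snd c). (peval \<nu> t \<in> X) = b \<and> peval \<nu> t \<le> N))"

lemma bounded_goal_ex: "\<exists>N. bounded_goal m N"
proof -
  obtain c \<nu> where c: "c \<in> set G" "\<nu> 0 = x" "peval \<nu> (fst c) = m"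
    "\<forall>(b, t)\<in>set (snd c). (peval \<nu> t \<in> X) = b"
    using goals[of m] by (auto simp: meets_def)
  define N where "N = x + m + (\<Sum>bt\<in>set (snd c). peval \<nu> (snd bt))"
  have "peval \<nu> t \<le> N" if "(b, t) \<in> set (snd c)" for b t
    using member_le_sum[OF that, of "\<lambda>bt. peval \<nu> (snd bt)"] by (simp add: N_def)
  then have "\<forall>(b, t)\<in>set (snd c). (peval \<nu> t \<in> X) = b \<and> peval \<nu> t \<le> N" using c(4) by blast
  moreover have "x \<le> N" "m \<le> N" by (simp_all add: N_def)
  ultimately have "bounded_goal m N" unfolding bounded_goal_def using c(1-3) by blast
  then show ?thesis ..
qed

lemma bounded_goal_mono:
  assumes "bounded_goal m N" "N \<le> N'"
  shows "bounded_goal m N'"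
proof -
  obtain c \<nu> where c: "c \<in> set G" "\<nu> 0 = x" "peval \<nu> (fst c) = m"
    "\<forall>(b, t)\<in>set (snd c). (peval \<nu> t \<in> X) = b \<and> peval \<nu> t \<le> N"
    using assms(1) unfolding bounded_goal_def by blast
  have "\<forall>(b, t)\<in>set (snd c). (peval \<nu> t \<in> X) = b \<and> peval \<nu> t \<le> N'"
    using c(4) assms(2) by (auto dest!: bspec)
  moreover have "x \<le> N'" "m \<le> N'" using assms by (auto simp: bounded_goal_def)
  ultimately show ?thesis using c(1-3) unfolding bounded_goal_def by blast
qed

text \<open>The phase of node \<open>n\<close>. A phase is left at its first node that is deep
  enough to verify the goal.\<close>

fun k :: "nat \<Rightarrow> nat" where
  "k 0 = 0"
| "k (Suc n) = (if bounded_goal (k n) n then Suc (k n) else k n)"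

definition phq :: "nat \<Rightarrow> bool" where
  "phq n \<longleftrightarrow> bounded_goal (k n) n"

lemma k_Suc: "k (Suc n) = (if phq n then Suc (k n) else k n)"
  by (simp add: phq_def)

lemma k_le: "k n \<le> n"
  by (induction n) auto

lemma k_mono: "i \<le> j \<Longrightarrow> k i \<le> k j"
  by (rule lift_Suc_mono_le[of k]) auto

text \<open>A goal that is verifiable at some depth remains so further down, so no phase lasts
  forever.\<close>

lemma k_unbounded: "\<exists>m\<ge>n. k n < k m"
proof (rule ccontr)
  assume a: "\<not> (\<exists>m\<ge>n. k n < k m)"
  then have e: "k m = k n" if "m \<ge> n" for m using k_mono[OF that] that by (meson le_antisym not_le)
  obtain N where "bounded_goal (k n) N" using bounded_goal_ex by blast
  then have "bounded_goal (k (max n N)) (max n N)" using bounded_goal_mono[of "k n" N] e[of "max n N"] by simp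
  then have "k (Suc (max n N)) = Suc (k (max n N))" by simp
  moreover have "k (Suc (max n N)) = k n" "k (max n N) = k n" by (rule e, simp)+
  ultimately show False by simp
qed

definition T :: "nat \<Rightarrow> trm set" where
  "T n = const_terms \<union> pn ` {..n} \<union> br ` {..k n}"

text \<open>
  No more than \<open>M n\<close> is derived before node \<open>n + 1\<close> exists. Only what keeps the rule creating that node
  from being blocked is excluded; junk about other terms is harmless.
\<close>

definition M :: "nat \<Rightarrow> atom set" where
  "M n = {a \<in> shaped (T n). a \<noteq> aR (br (k n)) \<and> (\<forall>z. a = aCh (pn n) z \<longrightarrow> z = br (k n)) \<and>
     (\<forall>w. a = aB w \<longrightarrow> w = gt \<or> w \<in> br ` {..k n})}"

definition Base :: "nat \<Rightarrow> atom set" where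
  "Base n = set dbase \<union> (\<Union>i<n. node_facts (Suc i \<in> X) (phq i) (pn i) (pn (Suc i)) (br (k (Suc i)))) \<union>
     (\<Union>j\<le>k n. brake_facts (br j))"

text \<open>Stages are only enclosed between two bounds, so that neither the order of saturation nor
  the junk it derives has to be described.\<close>

definition Stage :: "nat \<Rightarrow> atom set \<Rightarrow> bool" where
  "Stage n F \<longleftrightarrow> Base n \<subseteq> F \<and> F \<subseteq> M n"

text \<open>The current brake is exempt from the brake rule: once real, it would block the next
  node.\<close>

definition closed :: "nat \<Rightarrow> atom set \<Rightarrow> bool" where
  "closed n F \<longleftrightarrow> (\<forall>R\<in>datalog G x. \<forall>s a. head R = [a] \<longrightarrow> loads R s F \<longrightarrow> asubst s a \<in> F) \<and>
     (\<forall>w. aB w \<in> F \<longrightarrow> w \<noteq> br (k n) \<longrightarrow> aR w \<in> F)"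

lemma finite_M: "finite (M n)"
  unfolding M_def T_def by (rule finite_subset[OF _ finite_shaped]) auto

lemma consts_T: "const_terms \<subseteq> T n"
  by (auto simp: T_def)

text \<open>Edges are derived only by the garbage rule, which asks for a real child. The deepest
  node has only its brake as child, which is not real, so garbage is not yet attached there.\<close>

lemma datalog_Ch:
  assumes "R \<in> datalog G x" "head R = [a]" "loads R s F" "asubst s a = aCh t u"
  shows "\<exists>z. aCh t z \<in> F \<and> aR z \<in> F"
proof -
  have "pred a = 0" using assms(4) by (simp add: asubst_def)
  then have "R = Rule [aCh (Var 0) (Var 1), aR (Var 1)] [aCh (Var 0) gt]"
    using assms(1,2) by (auto simp: datalog_def base_rules_def input_rule_def clause_rule_def)
  then have "aCh (s 0) (s 1) \<in> F" "aR (s 1) \<in> F" "t = s 0"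
    using assms by (auto simp: loads_def asubst_def)
  then show ?thesis by blast
qed

lemma datalog_M:
  assumes "R \<in> datalog G x" "head R = [a]" "loads R s F" "F \<subseteq> M n"
  shows "asubst s a \<in> M n"
proof -
  have "F \<subseteq> shaped (T n)" using assms(4) by (auto simp: M_def)
  note sh = datalog_shaped[OF G assms(1-3) this consts_T]
  have "z = br (k n)" if "asubst s a = aCh (pn n) z" for z
    using datalog_Ch[OF assms(1-3) that] assms(4) by (auto simp: M_def)
  moreover have "asubst s a \<noteq> aB w" "asubst s a \<noteq> aR w" for w using sh(2) by auto
  ultimately show ?thesis using sh(1) by (auto simp: M_def)
qed

text \<open>\<open>M n\<close> is finite and contains everything that datalog rules and the exempted
  brake rule can add, so the number of missing facts decreases.\<close>

lemma saturate:
  assumes "Stage n F"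
  shows "\<exists>F'. (step (rules G x))\<^sup>*\<^sup>* F F' \<and> Stage n F' \<and> closed n F'"
  using assms
proof (induction "card (M n - F)" arbitrary: F rule: less_induct)
  case less
  show ?case
  proof (cases "closed n F")
    case False
    have "\<exists>a. step (rules G x) F (insert a F) \<and> a \<in> M n - F"
    proof (cases "\<exists>w. aB w \<in> F \<and> w \<noteq> br (k n) \<and> aR w \<notin> F")
      case True
      then obtain w where w: "aB w \<in> F" "w \<noteq> br (k n)" "aR w \<notin> F" by blast
      have "step (rules G x) F (insert (aR w) F)"
        unfolding step_def
        by (rule bexI[of _ brake_rule], rule exI[of _ "\<lambda>_. w"])
          (use w in \<open>auto simp: loads_brake blocked_brake fresh_def uvars_brake rules_eq\<close>,
            auto simp: brake_rule_def asubst_def)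
      moreover have "aB w \<in> M n" using less.prems w by (auto simp: Stage_def)
      then have "aR w \<in> M n" using w by (auto simp: M_def)
      ultimately show ?thesis using w by blast
    next
      case nb: False
      then obtain R s a where R: "R \<in> datalog G x" "head R = [a]" "loads R s F" "asubst s a \<notin> F"
        using False unfolding closed_def by blast
      have "step (rules G x) F (insert (asubst s a) F)"
        unfolding step_def
        by (rule bexI[of _ R], rule exI[of _ s])
          (use R evars_datalog[OF G R(1)] in \<open>auto simp: blocked_datalog fresh_def rules_eq\<close>)
      moreover have "asubst s a \<in> M n" using datalog_M R less.prems by (auto simp: Stage_def)
      ultimately show ?thesis using R by blast
    qed
    then obtain a where a: "step (rules G x) F (insert a F)" "a \<in> M n - F" by blast
    then have "M n - insert a F \<subset> M n - F" by blast
    then have "card (M n - insert a F) < card (M n - F)" using finite_M by (intro psubset_card_mono) auto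
    moreover have "Stage n (insert a F)" using less.prems a by (auto simp: Stage_def)
    ultimately obtain F' where "(step (rules G x))\<^sup>*\<^sup>* (insert a F) F'" "Stage n F'" "closed n F'"
      using less.hyps by blast
    then show ?thesis using a(1) by (meson converse_rtranclp_into_rtranclp)
  qed (use less.prems in blast)
qed

lemma Base_facts:
  shows "i \<le> n \<Longrightarrow> aR (pn i) \<in> Base n" "i \<le> n \<Longrightarrow> aCh (pn i) (br (k i)) \<in> Base n"
    "i < n \<Longrightarrow> aCh (pn i) (pn (Suc i)) \<in> Base n"
    "i < n \<Longrightarrow> aCol (bc (Suc i \<in> X)) (bc (phq i)) (pn (Suc i)) \<in> Base n"
    "j \<le> k n \<Longrightarrow> brake_facts (br j) \<subseteq> Base n" "set dbase \<subseteq> Base n"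
proof -
  have *: "node_facts (Suc i \<in> X) (phq i) (pn i) (pn (Suc i)) (br (k (Suc i))) \<subseteq> Base n" if "i < n" for i
    using that unfolding Base_def by blast
  show "set dbase \<subseteq> Base n" by (auto simp: Base_def)
  then have d: "aR rt \<in> Base n" "aCh rt bt \<in> Base n" by (auto simp: dbase_def)
  show "aR (pn i) \<in> Base n" if "i \<le> n"
    using that d *[of "i - 1"] by (cases i) (auto simp: pn_0 node_facts_def)
  show "aCh (pn i) (br (k i)) \<in> Base n" if "i \<le> n"
    using that d *[of "i - 1"] by (cases i) (auto simp: pn_0 br_0 node_facts_def)
  show "aCh (pn i) (pn (Suc i)) \<in> Base n" "aCol (bc (Suc i \<in> X)) (bc (phq i)) (pn (Suc i)) \<in> Base n" if "i < n"
    using *[OF that] by (auto simp: node_facts_def)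
  show "brake_facts (br j) \<subseteq> Base n" if "j \<le> k n" using that unfolding Base_def by blast
qed

section \<open>What saturation derives along the branch\<close>

context
  fixes n F assumes st: "Stage n F" and cl: "closed n F"
begin

lemma base_F: "a \<in> Base n \<Longrightarrow> a \<in> F"
  using st by (auto simp: Stage_def)

text \<open>In its uses a substitution is a list read by index: \<open>(!) [v, z]\<close> maps
  variable \<open>0\<close> to \<open>v\<close> and variable \<open>1\<close> to
  \<open>z\<close>.\<close>

lemma closed_base:
  assumes "Rule bd [a] \<in> set base_rules" "\<forall>a'\<in>set bd. asubst s a' \<in> F"
  shows "asubst s a \<in> F"
proof -
  have "Rule bd [a] \<in> datalog G x" using assms(1) by (auto simp: datalog_def)
  moreover have "loads (Rule bd [a]) s F" using assms(2) by (auto simp: loads_def)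
  ultimately show ?thesis using cl unfolding closed_def by fastforce
qed

lemma cl_prop: "aW t a b c v \<in> F \<Longrightarrow> aCh v z \<in> F \<Longrightarrow> aW t a b c z \<in> F"
  using closed_base[of "[aW (Var 0) (Var 1) (Var 2) (Var 3) (Var 4), aCh (Var 4) (Var 5)]"
      "aW (Var 0) (Var 1) (Var 2) (Var 3) (Var 5)" "(!) [t, a, b, c, v, z]"]
  by (simp add: base_rules_def asubst_def)

lemma cl_S: "aCh v z \<in> F \<Longrightarrow> aW tS v z gt z \<in> F"
  using closed_base[of "[aCh (Var 0) (Var 1)]" "aW tS (Var 0) (Var 1) gt (Var 1)" "(!) [v, z]"]
  by (simp add: base_rules_def asubst_def)

lemma cl_X: "aCol b q z \<in> F \<Longrightarrow> aW tX b z gt z \<in> F"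
  using closed_base[of "[aCol (Var 0) (Var 1) (Var 2)]" "aW tX (Var 0) (Var 2) gt (Var 2)" "(!) [b, q, z]"]
  by (simp add: base_rules_def asubst_def)

lemma cl_P1: "aW tP a b c v \<in> F \<Longrightarrow> aW tS b' b gt v \<in> F \<Longrightarrow> aW tS a a' gt v \<in> F \<Longrightarrow>
    aW tS c c' gt v \<in> F \<Longrightarrow> aW tP a' b' c' v \<in> F"
  using closed_base[of "[aW tP (Var 0) (Var 1) (Var 2) (Var 6), aW tS (Var 3) (Var 1) gt (Var 6),
           aW tS (Var 0) (Var 4) gt (Var 6), aW tS (Var 2) (Var 5) gt (Var 6)]"
       "aW tP (Var 4) (Var 3) (Var 5) (Var 6)" "(!) [a, b, c, b', a', c', v]"]
  by (simp add: base_rules_def asubst_def)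

lemma cl_P2: "aW tP a rt c v \<in> F \<Longrightarrow> aW tS a a' gt v \<in> F \<Longrightarrow>
    aW tS c c' gt v \<in> F \<Longrightarrow> aW tP rt a' c' v \<in> F"
  \<comment> \<open>Variables \<open>4\<close> and \<open>5\<close> do not occur in this rule; the
    two extra entries \<open>a\<close> put the world at index \<open>6\<close>.\<close>
  using closed_base[of "[aW tP (Var 0) rt (Var 1) (Var 6),
           aW tS (Var 0) (Var 2) gt (Var 6), aW tS (Var 1) (Var 3) gt (Var 6)]"
       "aW tP rt (Var 2) (Var 3) (Var 6)" "(!) [a, c, a', c', a, a, v]"]
  by (simp add: base_rules_def asubst_def)

lemma cl_K0: "aK c v \<in> F \<Longrightarrow> aCh v z \<in> F \<Longrightarrow> aCol b (bc False) z \<in> F \<Longrightarrow> aK c z \<in> F"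
  using closed_base[of "[aK (Var 0) (Var 1), aCh (Var 1) (Var 2), aCol (Var 3) (bc False) (Var 2)]"
       "aK (Var 0) (Var 2)" "(!) [c, v, z, b]"]
  by (simp add: base_rules_def asubst_def)

lemma cl_K1: "aK c v \<in> F \<Longrightarrow> aCh v z \<in> F \<Longrightarrow> aCol b (bc True) z \<in> F \<Longrightarrow> aW tS c c' gt z \<in> F \<Longrightarrow>
    aK c' z \<in> F"
  using closed_base[of "[aK (Var 0) (Var 1), aCh (Var 1) (Var 2), aCol (Var 3) (bc True) (Var 2),
           aW tS (Var 0) (Var 4) gt (Var 2)]"
       "aK (Var 4) (Var 2)" "(!) [c, v, z, b, c']"]
  by (simp add: base_rules_def asubst_def)

lemma cl_gt: "aCh v z \<in> F \<Longrightarrow> aR z \<in> F \<Longrightarrow> aCh v gt \<in> F"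
  using closed_base[of "[aCh (Var 0) (Var 1), aR (Var 1)]" "aCh (Var 0) gt" "(!) [v, z]"]
  by (simp add: base_rules_def asubst_def)

lemma persist: "aW t a b c (pn i) \<in> F \<Longrightarrow> i \<le> j \<Longrightarrow> j \<le> n \<Longrightarrow> aW t a b c (pn j) \<in> F"
proof (induction j)
  case (Suc j)
  show ?case
  proof (cases "i = Suc j")
    case False
    then have "aW t a b c (pn j) \<in> F" using Suc by simp
    then show ?thesis using cl_prop base_F[OF Base_facts(3)] Suc.prems(3) by simp
  qed (use Suc in simp)
qed simp

lemma all_S: "i < j \<Longrightarrow> j \<le> n \<Longrightarrow> aW tS (pn i) (pn (Suc i)) gt (pn j) \<in> F"
  using persist[of tS "pn i" "pn (Suc i)" gt "Suc i" j] cl_S[OF base_F[OF Base_facts(3)]] by simp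

lemma all_X: "i \<le> j \<Longrightarrow> j \<le> n \<Longrightarrow> aW tX (bc (i \<in> X)) (pn i) gt (pn j) \<in> F"
proof (rule persist[of _ _ _ _ i])
  assume "i \<le> j" "j \<le> n"
  then show "aW tX (bc (i \<in> X)) (pn i) gt (pn i) \<in> F"
    using cl_X[OF base_F[OF Base_facts(4)], of "i - 1"] base_F[OF set_mp[OF Base_facts(6)]] X0
    by (cases i) (auto simp: pn_0 dbase_def)
qed

lemma all_Z: "j \<le> n \<Longrightarrow> aW tZ rt gt gt (pn j) \<in> F"
  using persist[of tZ rt gt gt 0 j] base_F[OF set_mp[OF Base_facts(6)]] by (simp add: pn_0 dbase_def)

text \<open>Induction on the code: the preceding code belongs to the preceding pair of the diagonal
  walk, and all successor facts up to depth \<open>j\<close> are available in the world of node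
  \<open>j\<close>.\<close>

lemma all_P: "prod_encode (a, b) \<le> j \<Longrightarrow> j \<le> n \<Longrightarrow>
    aW tP (pn a) (pn b) (pn (prod_encode (a, b))) (pn j) \<in> F"
proof (induction "prod_encode (a, b)" arbitrary: a b)
  case 0
  then have "a = 0" "b = 0" using le_prod_encode_1[of a b] le_prod_encode_2[of b a] by simp_all
  moreover have "aW tP rt rt rt (pn j) \<in> F"
    using persist[of tP rt rt rt 0 j] base_F[OF set_mp[OF Base_facts(6)]] 0 by (simp add: pn_0 dbase_def)
  ultimately show ?case by (simp add: pn_0 prod_encode_def)
next
  case (Suc m)
  show ?case
  proof (cases a)
    case a: (Suc a')
    have e: "prod_encode (a, b) = Suc (prod_encode (a', Suc b))" using a by (simp add: prod_encode_def)
    then have m: "m = prod_encode (a', Suc b)" "prod_encode (a', Suc b) \<le> j" using Suc by simp_all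
    then have "aW tP (pn a') (pn (Suc b)) (pn (prod_encode (a', Suc b))) (pn j) \<in> F"
      using Suc by simp
    moreover have "a' < j" "b < j" "prod_encode (a', Suc b) < j"
      using le_prod_encode_1[of a b] le_prod_encode_2[of "Suc b" a'] m a e Suc.prems(1) by linarith+
    ultimately show ?thesis using cl_P1 all_S Suc.prems(2) a e by simp
  next
    case a: 0
    then obtain b' where b: "b = Suc b'" using Suc(2) by (cases b) (auto simp: prod_encode_def)
    have e: "prod_encode (a, b) = Suc (prod_encode (b', 0))" using a b by (simp add: prod_encode_def)
    then have m: "m = prod_encode (b', 0)" "prod_encode (b', 0) \<le> j" using Suc by simp_all
    then have "aW tP (pn b') rt (pn (prod_encode (b', 0))) (pn j) \<in> F"
      using Suc(1)[of b' 0] Suc.prems by (simp add: pn_0)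
    moreover have "b' < j" "prod_encode (b', 0) < j"
      using le_prod_encode_2[of b a] m b e Suc.prems(1) by linarith+
    ultimately show ?thesis using cl_P2 all_S Suc.prems(2) a b e by (simp add: pn_0)
  qed
qed

lemma all_I:
  assumes "x \<le> j" "j \<le> n"
  shows "aW tI (pn x) gt gt (pn j) \<in> F"
proof -
  \<comment> \<open>The numbering of \<open>input_body\<close>: variable \<open>0\<close> is the
    world, variable \<open>Suc i\<close> the number \<open>i\<close>.\<close>
  define s where "s i = (case i of 0 \<Rightarrow> pn j | Suc i \<Rightarrow> pn i)" for i
  have "\<forall>a\<in>set (input_body y). asubst s a \<in> F" if "y \<le> x" for y
    using that
  proof (induction y)
    case 0
    then show ?case using all_Z[OF assms(2)] by (simp add: asubst_def s_def pn_0)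
  next
    case (Suc y)
    then show ?case using all_S[of y j] assms by (simp add: asubst_def s_def)
  qed
  then have "loads (input_rule x) s F" by (auto simp: loads_def input_rule_def)
  moreover have "input_rule x \<in> datalog G x" "head (input_rule x) = [aW tI (Var (Suc x)) gt gt (Var 0)]"
    by (auto simp: datalog_def input_rule_def)
  ultimately have "asubst s (aW tI (Var (Suc x)) gt gt (Var 0)) \<in> F" using cl unfolding closed_def by blast
  then show ?thesis by (simp add: asubst_def s_def)
qed

lemma all_G:
  assumes "bounded_goal m j" "j \<le> n"
  shows "aW tG (pn m) gt gt (pn j) \<in> F"
proof -
  obtain c \<nu> where c: "x \<le> j" "m \<le> j" "c \<in> set G" "\<nu> 0 = x" "peval \<nu> (fst c) = m"
    "\<And>b t. (b, t) \<in> set (snd c) \<Longrightarrow> (peval \<nu> t \<in> X) = b \<and> peval \<nu> t \<le> j"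
    using assms(1) unfolding bounded_goal_def by blast
  \<comment> \<open>Variable \<open>vn t\<close> is \<open>Suc (to_nat t)\<close>, so
    \<open>from_nat\<close> recovers the term and each term variable receives the value of its
    term.\<close>
  define s where "s i = (case i of 0 \<Rightarrow> pn j | Suc i \<Rightarrow> pn (peval \<nu> (from_nat i)))" for i
  have sv: "s (vn t) = pn (peval \<nu> t)" for t by (simp add: s_def vn_def)
  have s0: "s 0 = pn j" by (simp add: s_def)
  have fl: "\<forall>a\<in>set (flat t). asubst s a \<in> F" if "peval \<nu> t \<le> j" for t
    using that
  proof (induction t)
    case PZero
    then show ?case using all_Z[OF assms(2)] by (simp add: asubst_def sv s0 pn_0)
  next
    case (PSuc t)
    then show ?case using all_S[of "peval \<nu> t" j] assms by (simp add: asubst_def sv s0)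
  next
    case (PPair t1 t2)
    then have "peval \<nu> t1 \<le> j" "peval \<nu> t2 \<le> j"
      using le_prod_encode_1[of "peval \<nu> t1" "peval \<nu> t2"] le_prod_encode_2[of "peval \<nu> t2" "peval \<nu> t1"]
      by (auto intro: order_trans)
    then show ?case using PPair all_P[of "peval \<nu> t1" "peval \<nu> t2" j] assms
      by (auto simp: asubst_def sv s0)
  qed simp
  have I: "asubst s (aW tI (tv (PV 0)) gt gt (Var 0)) \<in> F"
    using all_I[OF c(1) assms(2)] c(4) by (simp add: asubst_def sv s0)
  have L: "asubst s a \<in> F" if bt: "(b, t) \<in> set (snd c)" and a: "a = aW tX (bc b) (tv t) gt (Var 0) \<or> a \<in> set (flat t)" for a b t
  proof -
    have t: "(peval \<nu> t \<in> X) = b" "peval \<nu> t \<le> j" using c(6)[OF bt] by simp_all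
    then have "asubst s (aW tX (bc b) (tv t) gt (Var 0)) \<in> F"
      using all_X[of "peval \<nu> t" j] assms(2) by (simp add: asubst_def sv s0)
    then show ?thesis using a fl[OF t(2)] by blast
  qed
  have "loads (clause_rule c) s F"
    using I L fl[of "fst c"] c(2,5) by (fastforce simp: loads_def clause_rule_def)
  moreover have "clause_rule c \<in> datalog G x" "head (clause_rule c) = [aW tG (tv (fst c)) gt gt (Var 0)]"
    using c(3) by (auto simp: datalog_def clause_rule_def)
  ultimately have "asubst s (aW tG (tv (fst c)) gt gt (Var 0)) \<in> F" using cl unfolding closed_def by blast
  then show ?thesis using c(5) by (simp add: asubst_def sv s0)
qed

lemma all_K: "j \<le> n \<Longrightarrow> aK (pn (k j)) (pn j) \<in> F"
proof (induction j)
  case 0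
  then show ?case using base_F[OF set_mp[OF Base_facts(6)]] by (simp add: pn_0 dbase_def)
next
  case (Suc j)
  then have K: "aK (pn (k j)) (pn j) \<in> F" and Ch: "aCh (pn j) (pn (Suc j)) \<in> F"
    and C: "aCol (bc (Suc j \<in> X)) (bc (phq j)) (pn (Suc j)) \<in> F"
    using base_F[OF Base_facts(3)] base_F[OF Base_facts(4)] by simp_all
  show ?case
  proof (cases "phq j")
    case True
    \<comment> \<open>The successor of \<open>k j\<close> is known in the world of node
      \<open>Suc j\<close> because \<open>k j \<le> j\<close>.\<close>
    then show ?thesis using cl_K1[OF K Ch] C all_S[of "k j" "Suc j"] k_le[of j] Suc.prems
      by (simp add: k_Suc del: k.simps)
  next
    case False
    then show ?thesis using cl_K0[OF K Ch] C by (simp add: k_Suc del: k.simps)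
  qed
qed

end

section \<open>Extension of the branch, and fairness\<close>

lemma Stage_0: "Stage 0 (set dbase)"
proof -
  have "brake_facts bt \<subseteq> set dbase" by (auto simp: brake_facts_def cols_eq dbase_def)
  then have "Base 0 \<subseteq> set dbase" by (auto simp: Base_def br_0)
  moreover have "set dbase \<subseteq> shaped (T 0)"
    using bc_consts consts_T[of 0] by (auto simp: dbase_def image_iff T_def pn_0 br_0)
  then have "set dbase \<subseteq> M 0" by (auto simp: M_def pn_0 br_0 dbase_def)
  ultimately show ?thesis by (simp add: Stage_def)
qed

lemma M_fresh:
  assumes "F \<subseteq> M n" "Atom q l \<in> F"
  shows "pn (Suc n) \<notin> set l" "br (Suc (k n)) \<notin> set l"
proof -
  have "Atom q l \<in> shaped (T n)" using assms by (auto simp: M_def simp del: shaped_iff)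
  then have "set l \<subseteq> T n" by simp
  moreover have "pn (Suc n) \<notin> const_terms" "br (Suc (k n)) \<notin> const_terms" by (auto simp: pn_def br_def)
  then have "pn (Suc n) \<notin> T n" "br (Suc (k n)) \<notin> T n" by (auto simp: T_def)
  ultimately show "pn (Suc n) \<notin> set l" "br (Suc (k n)) \<notin> set l" by auto
qed

lemma T_mono: "T n \<subseteq> T (Suc n)"
  using k_mono[of n "Suc n"] by (force simp: T_def)

text \<open>The exclusions in \<open>M\<close> move with \<open>n\<close>: those of the next stage
  concern a new node and either the same brake or a new one, and \<open>F\<close> contains no fact
  about new terms.\<close>

lemma M_step:
  assumes "F \<subseteq> M n"
  shows "F \<subseteq> M (Suc n)"
proof
  fix a assume a: "a \<in> F"
  obtain q l where [simp]: "a = Atom q l" by (cases a)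
  note fr = M_fresh[OF assms a[simplified]]
  have aM: "a \<in> M n" using assms a by blast
  then have "a \<in> shaped (T n)" by (auto simp: M_def simp del: shaped_iff)
  then have "a \<in> shaped (T (Suc n))" using shaped_mono[OF T_mono[of n]] by blast
  moreover have "a \<noteq> aR (br (k (Suc n)))"
    using aM fr(2) by (auto simp: M_def k_Suc simp del: k.simps)
  moreover have "a \<noteq> aCh (pn (Suc n)) z" for z using fr(1) by auto
  moreover have "w = gt \<or> w \<in> br ` {..k (Suc n)}" if "a = aB w" for w
    using aM that k_mono[of n "Suc n"] by (force simp: M_def simp del: k.simps)
  ultimately show "a \<in> M (Suc n)" unfolding M_def by blast
qed

lemma node_facts_M:
  "node_facts (Suc n \<in> X) (phq n) (pn n) (pn (Suc n)) (br (k (Suc n))) \<subseteq> M (Suc n)"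
  using bc_consts consts_T by (auto simp: node_facts_def M_def T_def simp del: k.simps)

lemma brake_facts_M: "brake_facts (br (k (Suc n))) \<subseteq> M (Suc n)"
  using bc_consts consts_T
  by (auto simp: brake_facts_def cols_def M_def T_def simp del: k.simps)

lemma Base_Suc: "Base (Suc n) \<subseteq> Base n \<union>
    node_facts (Suc n \<in> X) (phq n) (pn n) (pn (Suc n)) (br (k (Suc n))) \<union>
    (if phq n then brake_facts (br (k (Suc n))) else {})"
proof -
  have "{..k (Suc n)} = {..k n} \<union> (if phq n then {k (Suc n)} else {})"
    by (auto simp: k_Suc simp del: k.simps)
  then show ?thesis
    unfolding Base_def lessThan_Suc by (auto simp del: k.simps)
qed

lemma Stage_Suc:
  assumes "Stage n F" "F' = F \<union> node_facts (Suc n \<in> X) (phq n) (pn n) (pn (Suc n)) (br (k (Suc n))) \<union>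
    (if phq n then brake_facts (br (k (Suc n))) else {})"
  shows "Stage (Suc n) F'"
proof -
  have "Base (Suc n) \<subseteq> F'" using Base_Suc[of n] assms unfolding Stage_def by blast
  moreover have "F' \<subseteq> M (Suc n)"
    using assms M_step[of F n] node_facts_M[of n] brake_facts_M[of n] unfolding Stage_def by (auto simp del: k.simps)
  ultimately show ?thesis by (simp add: Stage_def)
qed

lemma pn_Suc: "pn (Suc n) = Null (2 * n)" and br_Suc: "br (Suc n) = Null (2 * n + 1)"
  by (simp_all add: pn_def br_def)

lemma fresh_nulls:
  assumes "F \<subseteq> M n"
  shows "2 * n \<notin> nulls F" "2 * k n + 1 \<notin> nulls F"
  using M_fresh[OF assms] unfolding pn_Suc br_Suc nulls_def
  by (auto, (metis atom.collapse)+)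

lemma create:
  assumes st: "Stage n F" and cl: "closed n F"
  shows "\<exists>F'. step (rules G x) F F' \<and> Stage (Suc n) F'"
proof -
  have FM: "F \<subseteq> M n" using st by (simp add: Stage_def)
  have ld: "aR (pn n) \<in> F" "aCh (pn n) (br (k n)) \<in> F" "aB (br (k n)) \<in> F"
    using base_F[OF st cl] Base_facts(1,2,5)[of n n] Base_facts(5)[of "k n" n] by (auto simp: brake_facts_def)
  \<comment> \<open>The deepest node has no real child, so neither \<open>gt\<close> nor the brake
    nor any other term can witness a choice or phase head.\<close>
  have nb: "\<not> (aCh (pn n) z \<in> F \<and> aR z \<in> F)" for z using FM by (auto simp: M_def)
  show ?thesis
  proof (cases "phq n")
    case False
    define s where "s = (!) [pn n, br (k n), pn (Suc n)]"
    have ks: "k (Suc n) = k n" using False by (simp add: k_Suc del: k.simps)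
    have "step (rules G x) F (F \<union> choice_facts (Suc n \<in> X) (pn n) (br (k n)) (pn (Suc n)))"
      unfolding step_def
    proof (rule bexI[of _ "choice_rule (Suc n \<in> X)"], rule exI[of _ s], intro conjI)
      show "loads (choice_rule (Suc n \<in> X)) s F" using ld by (simp add: loads_choice s_def)
      show "\<not> blocked (choice_rule (Suc n \<in> X)) s F"
        unfolding blocked_choice using nb by (auto simp: s_def choice_facts_def)
      show "fresh (choice_rule (Suc n \<in> X)) s F"
        using fresh_nulls(1)[OF FM] by (simp add: fresh_def uvars_choice s_def pn_Suc)
    next
      show "choice_rule (Suc n \<in> X) \<in> rules G x" by (cases "Suc n \<in> X") (simp_all add: rules_eq)
    qed (simp add: choice_head s_def)
    moreover have "Stage (Suc n) (F \<union> choice_facts (Suc n \<in> X) (pn n) (br (k n)) (pn (Suc n)))"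
      by (rule Stage_Suc[OF st]) (simp add: False ks choice_facts_eq del: k.simps)
    ultimately show ?thesis by blast
  next
    case True
    define s where "s = (!) [pn n, br (k n), pn (Suc n), br (Suc (k n)), pn (k n)]"
    have ks: "k (Suc n) = Suc (k n)" using True by (simp add: k_Suc del: k.simps)
    have K: "aK (pn (k n)) (pn n) \<in> F" "aW tG (pn (k n)) gt gt (pn n) \<in> F"
      using all_K[OF st cl, of n] all_G[OF st cl, of "k n" n] True by (auto simp: phq_def)
    have "step (rules G x) F (F \<union> phase_facts (Suc n \<in> X) (pn n) (pn (Suc n)) (br (Suc (k n))))"
      unfolding step_def
    proof (rule bexI[of _ "phase_rule (Suc n \<in> X)"], rule exI[of _ s], intro conjI)
      show "loads (phase_rule (Suc n \<in> X)) s F" using ld K by (simp add: loads_phase s_def)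
      show "\<not> blocked (phase_rule (Suc n \<in> X)) s F"
        unfolding blocked_phase using nb by (auto simp: s_def phase_facts_def)
      show "fresh (phase_rule (Suc n \<in> X)) s F"
        using fresh_nulls[OF FM] by (auto simp: fresh_def uvars_phase s_def pn_Suc br_Suc) presburger?
    next
      show "phase_rule (Suc n \<in> X) \<in> rules G x" by (cases "Suc n \<in> X") (simp_all add: rules_eq)
    qed (simp add: phase_head s_def)
    moreover have "Stage (Suc n) (F \<union> phase_facts (Suc n \<in> X) (pn n) (pn (Suc n)) (br (Suc (k n))))"
      by (rule Stage_Suc[OF st]) (simp add: True ks phase_facts_eq Un_assoc del: k.simps)
    ultimately show ?thesis by blast
  qed
qed

text \<open>By a stage \<open>m\<close> of a later phase, all brakes known at stage \<open>n\<close>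
  are real. So every node with such a brake has an edge to \<open>gt\<close>, which witnesses the
  heads of both guesses and of both phase rules; the other triggers are settled by closure.\<close>

lemma fairness:
  assumes H: "\<And>n. Stage n (H n)" "\<And>n. closed n (H n)" "\<And>i j. i \<le> j \<Longrightarrow> H i \<subseteq> H j"
    and R: "R \<in> rules G x" "loads R s (H n)"
  shows "\<exists>m. blocked R s (H m)"
proof -
  obtain m where m: "n \<le> m" "k n < k m" using k_unbounded by blast
  have Hm: "a \<in> H m" if "a \<in> H n" for a using H(3)[OF m(1)] that by blast
  have old: "w = gt \<or> w \<in> br ` {..k n}" if "aB w \<in> H n" for w
    using H(1)[of n] that by (auto simp: Stage_def M_def)
  have real: "aR w \<in> H m" "aCh gt w \<in> H m" if "aB w \<in> H n" for w
  proof -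
    have "w \<noteq> br (k m)" using old[OF that] m(2) by auto
    then show "aR w \<in> H m" using H(2)[of m] Hm[OF that] by (auto simp: closed_def)
    have "aCh gt w \<in> Base m"
    proof (cases "w = gt")
      case True
      then show ?thesis using Base_facts(6)[of m] by (auto simp: dbase_def)
    next
      case False
      then obtain j where "j \<le> k n" "w = br j" using old[OF \<open>aB w \<in> H n\<close>] by auto
      then show ?thesis using Base_facts(5)[of j m] m(2) by (auto simp: brake_facts_def)
    qed
    then show "aCh gt w \<in> H m" using base_F[OF H(1,2)] by blast
  qed
  have D: "a \<in> H m" if "a \<in> set dbase" for a using base_F[OF H(1,2)] Base_facts(6) that by blast
  have gtc: "aCh gt gt \<in> H m" "aR gt \<in> H m" "aB gt \<in> H m" "aCol (bc b) (bc q) gt \<in> H m" for b q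
    by (rule D, cases b; cases q; simp add: dbase_def)+
  have vg: "aCh v gt \<in> H m" if "aCh v w \<in> H n" "aB w \<in> H n" for v w
    using cl_gt[OF H(1,2) Hm[OF that(1)] real(1)[OF that(2)]] .
  consider "R \<in> datalog G x" | "R = brake_rule" | b where "R = choice_rule b" | b where "R = phase_rule b"
    using R(1) unfolding rules_eq by auto
  then have "blocked R s (H m)"
  proof cases
    case 1
    then obtain a where a: "head R = [a]" using evars_datalog[OF G] by blast
    have "loads R s (H m)" using loads_mono[OF R(2) H(3)[OF m(1)]] .
    then have "asubst s a \<in> H m" using H(2)[of m] 1 a unfolding closed_def by blast
    then show ?thesis using blocked_datalog evars_datalog[OF G 1] a by blast
  next
    case 2
    then show ?thesis using real R(2) by (simp add: blocked_brake loads_brake)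
  next
    case 3
    then have "choice_facts b (s 0) (s 1) gt \<subseteq> H m"
      using R(2) real[of "s 1"] gtc vg[of "s 0" "s 1"] by (simp add: choice_facts_def loads_choice)
    then show ?thesis unfolding 3 blocked_choice by blast
  next
    case 4
    then have "phase_facts b (s 0) gt gt \<subseteq> H m"
      using R(2) real[of "s 1"] gtc vg[of "s 0" "s 1"] by (simp add: phase_facts_def loads_phase cols_eq)
    then show ?thesis unfolding 4 blocked_phase by blast
  qed
  then show ?thesis ..
qed

lemma rtranclp_step_mono: "(step \<Sigma>)\<^sup>*\<^sup>* A B \<Longrightarrow> A \<subseteq> B"
  by (induction rule: rtranclp_induct) (auto dest: step_growing)

lemma infinite_chase_ex: "\<exists>F. infinite_chase (rules G x, set dbase) F"
proof -
  let ?r = "step (rules G x)"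
  obtain A where A: "?r\<^sup>*\<^sup>* (set dbase) A" "Stage 0 A" "closed 0 A" using saturate[OF Stage_0] by blast
  have "\<exists>F'. (Stage (Suc n) F' \<and> closed (Suc n) F') \<and> ?r\<^sup>+\<^sup>+ F F'" if st: "Stage n F \<and> closed n F" for n F
  proof -
    obtain B where B: "?r F B" "Stage (Suc n) B" using create st by blast
    obtain C where "?r\<^sup>*\<^sup>* B C" "Stage (Suc n) C" "closed (Suc n) C" using saturate[OF B(2)] by blast
    then show ?thesis using B(1) by (meson rtranclp_into_tranclp2)
  qed
  then obtain H where H: "\<And>n. Stage n (H n) \<and> closed n (H n)" "\<And>n. ?r\<^sup>+\<^sup>+ (H n) (H (Suc n))" "H 0 = A"
    using dependent_nat_choice[of "\<lambda>n F. (Stage n F \<and> closed n F) \<and> (n = 0 \<longrightarrow> F = A)" "\<lambda>n F F'. ?r\<^sup>+\<^sup>+ F F'"] A(2,3)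
    by (metis old.nat.distinct(2))
  \<comment> \<open>The sequence must start from the database itself, not from its saturation
    \<open>H 0\<close>.\<close>
  define H' where "H' n = (if n = 0 then set dbase else H n)" for n
  have "?r\<^sup>+\<^sup>+ (H' n) (H' (Suc n))" for n
    using H(2)[of n] H(2)[of 0] H(3) A(1) by (auto simp: H'_def)
  from concat_runs[of ?r H', OF this] obtain F where
    F: "F 0 = H' 0" "\<And>i. ?r (F i) (F (Suc i))" "\<And>n. \<exists>i. F i = H' n" "\<And>i. \<exists>n. ?r\<^sup>*\<^sup>* (F i) (H' n)" by blast
  have Hm: "H i \<subseteq> H j" if "i \<le> j" for i j
    using that H(2)[THEN tranclp_into_rtranclp, THEN rtranclp_step_mono] by (rule lift_Suc_mono_le[rotated])
  have HH': "H' n \<subseteq> H n" for n using A(1) H(3) rtranclp_step_mono by (auto simp: H'_def)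
  have Fm: "F i \<subseteq> F j" if "i \<le> j" for i j
    by (rule lift_Suc_mono_le[OF _ that]) (use step_growing[OF F(2)] in blast)
  have "\<exists>j\<ge>i. blocked R s (F j)" if R: "R \<in> rules G x" "loads R s (F i)" for R s i
  proof -
    obtain n where "?r\<^sup>*\<^sup>* (F i) (H' n)" using F(4) by blast
    then have "F i \<subseteq> H n" using rtranclp_step_mono HH' by blast
    then have "loads R s (H n)" using loads_mono R(2) by blast
    then obtain m where "blocked R s (H m)" using fairness[of H R s n] H(1) Hm R(1) by blast
    then have "blocked R s (H (Suc m))" using blocked_mono Hm[of m "Suc m"] by simp
    moreover obtain j where "F j = H' (Suc m)" using F(3) by blast
    ultimately have "blocked R s (F j)" by (simp add: H'_def)
    then have "blocked R s (F (max i j))" using blocked_mono Fm[of j "max i j"] by simp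
    then show ?thesis by (intro exI[of _ "max i j"]) simp
  qed
  then have "infinite_chase (rules G x, set dbase) F"
    using F(1,2) by (simp add: infinite_chase_def H'_def)
  then show ?thesis by blast
qed

end

lemma infinite_chase_iff_solvable:
  assumes "pair_patterns G"
  shows "(\<exists>F. infinite_chase (rules G x, set dbase) F) \<longleftrightarrow> solvable G x"
proof
  assume "solvable G x"
  then obtain X where "0 \<notin> X" "\<forall>m. \<exists>c\<in>set G. meets X x c m" by (auto simp: solvable_def)
  then interpret solution G x X using assms by unfold_locales auto
  show "\<exists>F. infinite_chase (rules G x, set dbase) F" by (rule infinite_chase_ex)
qed (use solvable_if_infinite_chase assms in blast)


section \<open>From second-order formulas to clause systems\<close>

instance arith_trm :: countable
  by countable_datatype

instance arith_fm :: countable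
  by countable_datatype

text \<open>Quantifiers may be vacuous or bind the same variable again, so the matrix is tied to the
  formula by two one-sided statements: instantiating with the current value gives the first, and the
  second compares validity for all \<open>V\<close>.\<close>

lemma pi11_matrix:
  assumes "pi11_fm \<phi>"
  shows "\<exists>\<theta>. arithmetical \<theta> \<and> (\<forall>\<nu> V. arith_sat \<nu> V \<phi> \<longrightarrow> arith_sat \<nu> V \<theta>) \<and>
    (\<forall>\<nu>. (\<forall>V. arith_sat \<nu> V \<theta>) \<longrightarrow> (\<forall>V. arith_sat \<nu> V \<phi>))"
  using assms
proof induction
  case (2 \<phi> X)
  then obtain \<theta> where \<theta>: "arithmetical \<theta>" "\<And>\<nu> V. arith_sat \<nu> V \<phi> \<Longrightarrow> arith_sat \<nu> V \<theta>"
    "\<And>\<nu>. (\<forall>V. arith_sat \<nu> V \<theta>) \<Longrightarrow> (\<forall>V. arith_sat \<nu> V \<phi>)" by blast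
  have "arith_sat \<nu> V \<theta>" if "arith_sat \<nu> V (AllSet X \<phi>)" for \<nu> V
  proof -
    from that have "arith_sat \<nu> (V(X := V X)) \<phi>" by (simp only: arith_sat.simps)
    then show ?thesis using \<theta>(2) by simp
  qed
  moreover have "\<forall>V. arith_sat \<nu> V (AllSet X \<phi>)" if "\<forall>V. arith_sat \<nu> V \<theta>" for \<nu>
    using \<theta>(3)[OF that] by (simp only: arith_sat.simps) blast
  ultimately show ?case using \<theta>(1) by blast
qed blast

text \<open>Membership does not depend on number variables other than \<open>0\<close>, so a
  falsifying assignment may choose them freely.\<close>

lemma pi11_iff_matrix:
  assumes "pi11 B"
  shows "\<exists>\<theta>. arithmetical \<theta> \<and> (\<forall>x. x \<notin> B \<longleftrightarrow> (\<exists>\<nu> V. \<nu> 0 = x \<and> \<not> arith_sat \<nu> V \<theta>))"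
proof -
  obtain \<phi> where \<phi>: "pi11_fm \<phi>" "\<And>\<nu> V. \<nu> 0 \<in> B \<longleftrightarrow> arith_sat \<nu> V \<phi>"
    using assms by (auto simp: pi11_def)
  obtain \<theta> where \<theta>: "arithmetical \<theta>" "\<And>\<nu> V. arith_sat \<nu> V \<phi> \<Longrightarrow> arith_sat \<nu> V \<theta>"
    "\<And>\<nu>. (\<forall>V. arith_sat \<nu> V \<theta>) \<Longrightarrow> (\<forall>V. arith_sat \<nu> V \<phi>)" using pi11_matrix[OF \<phi>(1)] by blast
  have "x \<notin> B \<longleftrightarrow> (\<exists>\<nu> V. \<nu> 0 = x \<and> \<not> arith_sat \<nu> V \<theta>)" for x
  proof
    assume "x \<notin> B"
    then have "\<not> arith_sat (\<lambda>_. x) V \<phi>" for V using \<phi>(2)[of "\<lambda>_. x" V] by simp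
    then have "\<not> (\<forall>V. arith_sat (\<lambda>_. x) V \<theta>)" using \<theta>(3)[of "\<lambda>_. x"] by blast
    then obtain V where "\<not> arith_sat (\<lambda>_. x) V \<theta>" by blast
    then show "\<exists>\<nu> V. \<nu> 0 = x \<and> \<not> arith_sat \<nu> V \<theta>" by (intro exI[of _ "\<lambda>_. x"] exI[of _ V]) simp
  next
    assume "\<exists>\<nu> V. \<nu> 0 = x \<and> \<not> arith_sat \<nu> V \<theta>"
    then show "x \<notin> B" using \<phi>(2) \<theta>(2) by blast
  qed
  with \<theta>(1) show ?thesis by blast
qed

section \<open>Variables, subformulas and coded assignments\<close>

primrec tmax :: "arith_trm \<Rightarrow> nat" where
  "tmax (NVar x) = x"
| "tmax NZero = 0"
| "tmax (NSuc t) = tmax t"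
| "tmax (NAdd s t) = max (tmax s) (tmax t)"
| "tmax (NMul s t) = max (tmax s) (tmax t)"

text \<open>Bound variables count as well, so one tuple length serves a formula and all its
  subformulas.\<close>

primrec fmax :: "arith_fm \<Rightarrow> nat" where
  "fmax (Eq s t) = max (tmax s) (tmax t)"
| "fmax (Mem t X) = tmax t"
| "fmax (Neg \<phi>) = fmax \<phi>"
| "fmax (Conj \<phi> \<psi>) = max (fmax \<phi>) (fmax \<psi>)"
| "fmax (AllNum x \<phi>) = max x (fmax \<phi>)"
| "fmax (AllSet X \<phi>) = fmax \<phi>"

lemma arith_val_cong: "(\<And>i. i \<le> tmax t \<Longrightarrow> \<nu> i = \<nu>' i) \<Longrightarrow> arith_val \<nu> t = arith_val \<nu>' t"
proof (induction t)
  case (NAdd s t)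
  then show ?case by (metis arith_val.simps(4) max.coboundedI1 max.coboundedI2 tmax.simps(4))
next
  case (NMul s t)
  then show ?case by (metis arith_val.simps(5) max.coboundedI1 max.coboundedI2 tmax.simps(5))
qed auto

lemma arith_sat_cong: "(\<And>i. i \<le> fmax \<phi> \<Longrightarrow> \<nu> i = \<nu>' i) \<Longrightarrow> arith_sat \<nu> V \<phi> = arith_sat \<nu>' V \<phi>"
proof (induction \<phi> arbitrary: \<nu> \<nu>' V)
  case (Eq s t)
  then show ?case using arith_val_cong[of s \<nu> \<nu>'] arith_val_cong[of t \<nu> \<nu>'] by simp
next
  case (Mem t X)
  then show ?case using arith_val_cong[of t \<nu> \<nu>'] by simp
next
  case (Neg \<phi>)
  then show ?case by (metis arith_sat.simps(3) fmax.simps(3))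
next
  case (Conj \<phi> \<psi>)
  then have "arith_sat \<nu> V \<phi> = arith_sat \<nu>' V \<phi>" "arith_sat \<nu> V \<psi> = arith_sat \<nu>' V \<psi>"
    by (metis fmax.simps(4) max.coboundedI1, metis fmax.simps(4) max.coboundedI2)
  then show ?case by simp
next
  case (AllNum x \<phi>)
  have "arith_sat (\<nu>(x := n)) V \<phi> = arith_sat (\<nu>'(x := n)) V \<phi>" for n
    by (rule AllNum.IH) (use AllNum.prems in auto)
  then show ?case by simp
next
  case (AllSet X \<phi>)
  have "arith_sat \<nu> (V(X := A)) \<phi> = arith_sat \<nu>' (V(X := A)) \<phi>" for A
    by (rule AllSet.IH) (use AllSet.prems in auto)
  then show ?case by simp
qed

primrec subs :: "arith_fm \<Rightarrow> arith_fm list" where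
  "subs (Eq s t) = [Eq s t]"
| "subs (Mem t X) = [Mem t X]"
| "subs (Neg \<phi>) = Neg \<phi> # subs \<phi>"
| "subs (Conj \<phi> \<psi>) = Conj \<phi> \<psi> # subs \<phi> @ subs \<psi>"
| "subs (AllNum x \<phi>) = AllNum x \<phi> # subs \<phi>"
| "subs (AllSet X \<phi>) = AllSet X \<phi> # subs \<phi>"

lemma subs_self: "\<phi> \<in> set (subs \<phi>)"
  by (cases \<phi>) auto

lemma subs_fmax: "\<psi> \<in> set (subs \<phi>) \<Longrightarrow> fmax \<psi> \<le> fmax \<phi>"
  by (induction \<phi>) auto

lemma subs_arithmetical: "arithmetical \<phi> \<Longrightarrow> \<psi> \<in> set (subs \<phi>) \<Longrightarrow> arithmetical \<psi>"
  by (induction \<phi>) auto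

lemma subs_trans: "\<chi> \<in> set (subs \<psi>) \<Longrightarrow> \<psi> \<in> set (subs \<phi>) \<Longrightarrow> \<chi> \<in> set (subs \<phi>)"
  by (induction \<phi>) auto

definition num :: "nat \<Rightarrow> ptm" where
  "num i = (PSuc ^^ i) PZero"

lemma peval_PSuc_pow [simp]: "peval \<nu> ((PSuc ^^ i) t) = peval \<nu> t + i"
  by (induction i) auto

lemma peval_num [simp]: "peval \<nu> (num i) = i"
  by (simp add: num_def)

text \<open>The pattern whose value is \<open>etup\<close>, the code of an assignment cut off after
  index \<open>k\<close>. Every number is such a code.\<close>

fun tup :: "nat \<Rightarrow> (nat \<Rightarrow> ptm) \<Rightarrow> ptm" where
  "tup 0 f = f 0"
| "tup (Suc k) f = PPair (f (Suc k)) (tup k f)"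

fun etup :: "nat \<Rightarrow> (nat \<Rightarrow> nat) \<Rightarrow> nat" where
  "etup 0 a = a 0"
| "etup (Suc k) a = prod_encode (a (Suc k), etup k a)"

lemma peval_tup [simp]: "peval \<nu> (tup k f) = etup k (\<lambda>i. peval \<nu> (f i))"
  by (induction k) auto

lemma etup_eq_iff: "etup k a = etup k b \<longleftrightarrow> (\<forall>i\<le>k. a i = b i)"
  by (induction k) (auto simp: le_Suc_eq)

lemma etup_surj: "\<exists>a. etup k a = r"
proof (induction k arbitrary: r)
  case 0
  then show ?case by (intro exI[of _ "\<lambda>_. r"]) simp
next
  case (Suc k)
  obtain m n where r: "r = prod_encode (m, n)" by (metis prod_decode_inverse surj_pair)
  obtain a where a: "etup k a = n" using Suc by blast
  have "etup k (a(Suc k := m)) = etup k a" by (simp add: etup_eq_iff)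
  then have "etup (Suc k) (a(Suc k := m)) = r" using r a by (simp only: etup.simps fun_upd_same)
  then show ?case by blast
qed

text \<open>
  The set \<open>X\<close> of a clause system has to hold the truth predicate for the subformulas, the set variables,
  and the graphs of addition and multiplication; they are told apart by a non-zero first component.
\<close>

definition "cT \<phi> t = PPair (num 1) (PPair (num (to_nat (\<phi> :: arith_fm))) t)"
definition "cV j t = PPair (num 2) (PPair (num j) t)"
definition "cA a b c = PPair (num 3) (PPair a (PPair b c))"
definition "cM a b c = PPair (num 4) (PPair a (PPair b c))"

text \<open>A division of the clause variables: \<open>PV 0\<close> is the input, odd ones are the
  number variables of the formula, even ones from \<open>6\<close> on name sums and products, and
  \<open>PV 2\<close> and \<open>PV 4\<close> are left for differences, instances and
  counterexamples.\<close>

definition "uv i = PV (Suc (2 * i))"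
definition "wv (t :: arith_trm) = PV (2 * to_nat t + 6)"

text \<open>Clause terms have no addition or multiplication: a sum or product is named by a
  variable, and \<open>lits\<close> collects the literals that force its value.\<close>

fun vt :: "arith_trm \<Rightarrow> ptm" where
  "vt (NVar x) = uv x"
| "vt NZero = PZero"
| "vt (NSuc t) = PSuc (vt t)"
| "vt (NAdd s t) = wv (NAdd s t)"
| "vt (NMul s t) = wv (NMul s t)"

fun lits :: "arith_trm \<Rightarrow> (bool \<times> ptm) list" where
  "lits (NVar x) = []"
| "lits NZero = []"
| "lits (NSuc t) = lits t"
| "lits (NAdd s t) = (True, cA (vt s) (vt t) (wv (NAdd s t))) # lits s @ lits t"
| "lits (NMul s t) = (True, cM (vt s) (vt t) (wv (NMul s t))) # lits s @ lits t"

text \<open>Tarski's condition for one subformula. The number to be met codes an assignment, and the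
  alternatives list the ways in which the truth predicate can be right there. A false equation shows
  a positive difference \<open>PSuc (PV 2)\<close> in one direction or the other. For a quantifier
  the number also contains an instance \<open>PV 2\<close>, and \<open>PV 4\<close> is the
  counterexample if the formula is false.\<close>

fun req :: "nat \<Rightarrow> arith_fm \<Rightarrow> clause list" where
  "req k (Eq s t) =
    [(tup k uv, (True, cT (Eq s t) (tup k uv)) # (True, cA (vt s) PZero (vt t)) # lits s @ lits t),
     (tup k uv, (False, cT (Eq s t) (tup k uv)) # (True, cA (vt s) (PSuc (PV 2)) (vt t)) # lits s @ lits t),
     (tup k uv, (False, cT (Eq s t) (tup k uv)) # (True, cA (vt t) (PSuc (PV 2)) (vt s)) # lits s @ lits t)]"
| "req k (Mem t X) =
    [(tup k uv, (True, cT (Mem t X) (tup k uv)) # (True, cV X (vt t)) # lits t),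
     (tup k uv, (False, cT (Mem t X) (tup k uv)) # (False, cV X (vt t)) # lits t)]"
| "req k (Neg \<phi>) =
    [(tup k uv, [(True, cT (Neg \<phi>) (tup k uv)), (False, cT \<phi> (tup k uv))]),
     (tup k uv, [(False, cT (Neg \<phi>) (tup k uv)), (True, cT \<phi> (tup k uv))])]"
| "req k (Conj \<phi> \<psi>) =
    [(tup k uv, [(True, cT (Conj \<phi> \<psi>) (tup k uv)), (True, cT \<phi> (tup k uv)), (True, cT \<psi> (tup k uv))]),
     (tup k uv, [(False, cT (Conj \<phi> \<psi>) (tup k uv)), (False, cT \<phi> (tup k uv))]),
     (tup k uv, [(False, cT (Conj \<phi> \<psi>) (tup k uv)), (False, cT \<psi> (tup k uv))])]"
| "req k (AllNum x \<phi>) =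
    [(PPair (PV 2) (tup k uv),
       [(True, cT (AllNum x \<phi>) (tup k uv)), (True, cT \<phi> (tup k (uv(x := PV 2))))]),
     (PPair (PV 2) (tup k uv),
       [(False, cT (AllNum x \<phi>) (tup k uv)), (False, cT \<phi> (tup k (uv(x := PV 4))))])]"
| "req k (AllSet X \<phi>) = []"

text \<open>One-sided recursion on the second summand: each triple in the graph must be justified,
  but triples may be missing. This suffices because all other clauses only assert sums and
  products.\<close>

definition reqA :: "clause list" where
  "reqA =
    [(PPair (uv 0) (PPair (uv 1) (uv 2)), [(False, cA (uv 0) (uv 1) (uv 2))]),
     (PPair (uv 0) (PPair PZero (uv 0)), []),
     (PPair (uv 0) (PPair (PSuc (uv 1)) (PSuc (uv 2))), [(True, cA (uv 0) (uv 1) (uv 2))])]"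

definition reqM :: "clause list" where
  "reqM =
    [(PPair (uv 0) (PPair (uv 1) (uv 2)), [(False, cM (uv 0) (uv 1) (uv 2))]),
     (PPair (uv 0) (PPair PZero PZero), []),
     (PPair (uv 0) (PPair (PSuc (uv 1)) (uv 2)),
       [(True, cM (uv 0) (uv 1) (uv 3)), (True, cA (uv 3) (uv 0) (uv 2))])]"

text \<open>The pattern \<open>PV 2\<close> accepts every number, so the demand is just that the
  formula fails for some assignment that maps variable \<open>0\<close> to the input.\<close>

definition reqR :: "nat \<Rightarrow> arith_fm \<Rightarrow> clause list" where
  "reqR k \<phi> = [(PV 2, [(False, cT \<phi> (tup k (uv(0 := PV 0))))])]"

definition sat_req :: "nat set \<Rightarrow> nat \<Rightarrow> clause list \<Rightarrow> bool" where
  "sat_req X x r \<longleftrightarrow> (\<forall>m. \<exists>c\<in>set r. meets X x c m)"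

text \<open>Numbers with first component \<open>i\<close> serve the \<open>i\<close>-th requirement;
  if the first component is at least \<open>length rs\<close>, the leading clause is met without
  literals.\<close>

definition tagged :: "clause list list \<Rightarrow> clause list" where
  "tagged rs = (PPair ((PSuc ^^ length rs) (PV 2)) (PV 4), []) #
     concat (map (\<lambda>i. map (\<lambda>c. (PPair (num i) (fst c), snd c)) (rs ! i)) [0..<length rs])"

lemma pair_patterns_tagged: "pair_patterns (tagged rs)"
  by (auto simp: pair_patterns_def tagged_def)

lemma meets_tagged: "meets X x (PPair (num i) p, L) (prod_encode (j, r)) \<longleftrightarrow> i = j \<and> meets X x (p, L) r"
  by (auto simp: meets_def)

lemma tagged_iff: "(\<forall>m. \<exists>c\<in>set (tagged rs). meets X x c m) \<longleftrightarrow> (\<forall>r\<in>set rs. sat_req X x r)"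
proof
  assume a: "\<forall>m. \<exists>c\<in>set (tagged rs). meets X x c m"
  show "\<forall>r\<in>set rs. sat_req X x r"
    unfolding sat_req_def
  proof (intro ballI allI)
    fix r m assume "r \<in> set rs"
    then obtain i where i: "i < length rs" "r = rs ! i" by (auto simp: in_set_conv_nth)
    obtain c where c: "c \<in> set (tagged rs)" "meets X x c (prod_encode (i, m))" using a by blast
    have "\<not> meets X x (PPair ((PSuc ^^ length rs) (PV 2)) (PV 4), []) (prod_encode (i, m))"
      using i by (auto simp: meets_def)
    then obtain j c' where "j < length rs" "c' \<in> set (rs ! j)" "c = (PPair (num j) (fst c'), snd c')"
      using c by (auto simp: tagged_def)
    then show "\<exists>c\<in>set r. meets X x c m" using c(2) i by (auto simp: meets_tagged)
  qed
next
  assume a: "\<forall>r\<in>set rs. sat_req X x r"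
  show "\<forall>m. \<exists>c\<in>set (tagged rs). meets X x c m"
  proof
    fix m
    obtain i r where m: "m = prod_encode (i, r)" by (metis prod_decode_inverse surj_pair)
    show "\<exists>c\<in>set (tagged rs). meets X x c m"
    proof (cases "i < length rs")
      case True
      then obtain c where c: "c \<in> set (rs ! i)" "meets X x c r" using a unfolding sat_req_def by (meson nth_mem)
      have "(PPair (num i) (fst c), snd c) \<in> set (tagged rs)" using True c(1) by (auto simp: tagged_def)
      moreover have "meets X x (PPair (num i) (fst c), snd c) m" using c(2) m by (simp add: meets_tagged)
      ultimately show ?thesis by blast
    next
      case False
      then have "meets X x (PPair ((PSuc ^^ length rs) (PV 2)) (PV 4), []) m"
        unfolding meets_def m
        by (intro exI[of _ "\<lambda>n. if n = 0 then x else if n = 2 then i - length rs else r"]) simp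
      then show ?thesis by (auto simp: tagged_def)
    qed
  qed
qed

definition reqs :: "nat \<Rightarrow> arith_fm \<Rightarrow> clause list list" where
  "reqs k \<phi> = [reqA, reqM, reqR k \<phi>] @ map (req k) (subs \<phi>)"

section \<open>Soundness of the requirements\<close>

locale satisfied =
  fixes X :: "nat set" and x k :: nat and \<phi> :: arith_fm
  assumes A: "sat_req X x reqA" and M: "sat_req X x reqM" and R: "sat_req X x (reqR k \<phi>)"
    and S: "\<psi> \<in> set (subs \<phi>) \<Longrightarrow> sat_req X x (req k \<psi>)"
    and k: "fmax \<phi> \<le> k" and ar: "arithmetical \<phi>"
begin

text \<open>Membership rules out the first clause of \<open>reqA\<close>, and the form of the second
  summand selects one of the other two.\<close>

lemma add_sound: "prod_encode (3, prod_encode (a, prod_encode (b, c))) \<in> X \<Longrightarrow> c = a + b"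
proof (induction b arbitrary: c)
  case 0
  then show ?case using A[unfolded sat_req_def, rule_format, of "prod_encode (a, prod_encode (0, c))"]
    by (auto simp: reqA_def meets_def cA_def)
next
  case (Suc b)
  then show ?case using A[unfolded sat_req_def, rule_format, of "prod_encode (a, prod_encode (Suc b, c))"]
    by (auto simp: reqA_def meets_def cA_def)
qed

lemma mul_sound: "prod_encode (4, prod_encode (a, prod_encode (b, c))) \<in> X \<Longrightarrow> c = a * b"
proof (induction b arbitrary: c)
  case 0
  then show ?case using M[unfolded sat_req_def, rule_format, of "prod_encode (a, prod_encode (0, c))"]
    by (auto simp: reqM_def meets_def cM_def)
next
  case (Suc b)
  then obtain d where "prod_encode (4, prod_encode (a, prod_encode (b, d))) \<in> X"
    "prod_encode (3, prod_encode (d, prod_encode (a, c))) \<in> X"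
    using M[unfolded sat_req_def, rule_format, of "prod_encode (a, prod_encode (Suc b, c))"]
    by (auto simp: reqM_def meets_def cM_def cA_def)
  then have "d = a * b" "c = d + a" using Suc.IH add_sound by blast+
  then show ?case by simp
qed

lemma val_sound:
  "\<forall>(b, u)\<in>set (lits t). (peval \<nu> u \<in> X) = b \<Longrightarrow> peval \<nu> (vt t) = arith_val (\<lambda>i. \<nu> (Suc (2 * i))) t"
proof (induction t)
  case (NAdd s t)
  then show ?case by (auto simp: cA_def dest!: add_sound)
next
  case (NMul s t)
  then show ?case by (auto simp: cM_def dest!: mul_sound)
qed (auto simp: uv_def)

definition "V j = {n. prod_encode (2, prod_encode (j, n)) \<in> X}"

abbreviation "holds \<psi> a \<equiv> prod_encode (1, prod_encode (to_nat \<psi>, etup k a)) \<in> X"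

lemma peval_cT: "peval \<nu> (cT \<psi> (tup k f)) = prod_encode (1, prod_encode (to_nat \<psi>, etup k (\<lambda>i. peval \<nu> (f i))))"
  by (simp add: cT_def)

text \<open>The clause meeting the code of \<open>a\<close> reproduces the truth condition of the
  outermost symbol, and by the induction hypothesis only alternatives with the correct truth value
  can hold.\<close>

lemma truth: "\<psi> \<in> set (subs \<phi>) \<Longrightarrow> holds \<psi> a \<longleftrightarrow> arith_sat a V \<psi>"
proof (induction \<psi> arbitrary: a)
  case (Eq s t)
  obtain c where c: "c \<in> set (req k (Eq s t))" "meets X x c (etup k a)"
    using S[OF Eq] unfolding sat_req_def by blast
  then obtain \<nu> where \<nu>: "peval \<nu> (fst c) = etup k a" "\<forall>(b, t)\<in>set (snd c). (peval \<nu> t \<in> X) = b"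
    by (auto simp: meets_def)
  have e: "etup k (\<lambda>i. \<nu> (Suc (2 * i))) = etup k a" using \<nu>(1) c(1) by (auto simp: uv_def)
  have ls: "\<forall>(b, u)\<in>set (lits s). (peval \<nu> u \<in> X) = b" "\<forall>(b, u)\<in>set (lits t). (peval \<nu> u \<in> X) = b"
    using \<nu>(2) c(1) by auto
  have "tmax s \<le> k" "tmax t \<le> k" using subs_fmax[OF Eq] k by auto
  then have v: "peval \<nu> (vt s) = arith_val a s" "peval \<nu> (vt t) = arith_val a t"
    using val_sound[OF ls(1)] val_sound[OF ls(2)] e unfolding etup_eq_iff
    by (auto intro: arith_val_cong)
  have "peval \<nu> (cT (Eq s t) (tup k uv)) = prod_encode (1, prod_encode (to_nat (Eq s t), etup k a))"
    using e by (simp add: peval_cT uv_def)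
  then show ?case using c(1) \<nu>(2) v by (auto simp: cA_def dest!: add_sound)
next
  case (Mem t Y)
  obtain c where c: "c \<in> set (req k (Mem t Y))" "meets X x c (etup k a)"
    using S[OF Mem] unfolding sat_req_def by blast
  then obtain \<nu> where \<nu>: "peval \<nu> (fst c) = etup k a" "\<forall>(b, t)\<in>set (snd c). (peval \<nu> t \<in> X) = b"
    by (auto simp: meets_def)
  have e: "etup k (\<lambda>i. \<nu> (Suc (2 * i))) = etup k a" using \<nu>(1) c(1) by (auto simp: uv_def)
  have ls: "\<forall>(b, u)\<in>set (lits t). (peval \<nu> u \<in> X) = b"
    using \<nu>(2) c(1) by auto
  have "tmax t \<le> k" using subs_fmax[OF Mem] k by auto
  then have v: "peval \<nu> (vt t) = arith_val a t"
    using val_sound[OF ls] e unfolding etup_eq_iff by (auto intro: arith_val_cong)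
  have "peval \<nu> (cT (Mem t Y) (tup k uv)) = prod_encode (1, prod_encode (to_nat (Mem t Y), etup k a))"
    using e by (simp add: peval_cT uv_def)
  then show ?case using c(1) \<nu>(2) v by (auto simp: cV_def V_def)
next
  case (Neg \<psi>)
  obtain c where c: "c \<in> set (req k (Neg \<psi>))" "meets X x c (etup k a)"
    using S[OF Neg.prems] unfolding sat_req_def by blast
  then obtain \<nu> where \<nu>: "peval \<nu> (fst c) = etup k a" "\<forall>(b, t)\<in>set (snd c). (peval \<nu> t \<in> X) = b"
    by (auto simp: meets_def)
  have e: "etup k (\<lambda>i. \<nu> (Suc (2 * i))) = etup k a" using \<nu>(1) c(1) by (auto simp: uv_def)
  then have p: "peval \<nu> (cT \<chi> (tup k uv)) = prod_encode (1, prod_encode (to_nat \<chi>, etup k a))" for \<chi>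
    by (simp add: peval_cT uv_def)
  have "\<psi> \<in> set (subs \<phi>)" using subs_trans[OF _ Neg.prems] subs_self by simp
  then show ?case using Neg.IH[of a] c(1) \<nu>(2) p by auto
next
  case (Conj \<psi> \<psi>')
  obtain c where c: "c \<in> set (req k (Conj \<psi> \<psi>'))" "meets X x c (etup k a)"
    using S[OF Conj.prems] unfolding sat_req_def by blast
  then obtain \<nu> where \<nu>: "peval \<nu> (fst c) = etup k a" "\<forall>(b, t)\<in>set (snd c). (peval \<nu> t \<in> X) = b"
    by (auto simp: meets_def)
  have e: "etup k (\<lambda>i. \<nu> (Suc (2 * i))) = etup k a" using \<nu>(1) c(1) by (auto simp: uv_def)
  then have p: "peval \<nu> (cT \<chi> (tup k uv)) = prod_encode (1, prod_encode (to_nat \<chi>, etup k a))" for \<chi>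
    by (simp add: peval_cT uv_def)
  have "\<psi> \<in> set (subs \<phi>)" "\<psi>' \<in> set (subs \<phi>)" using subs_trans[OF _ Conj.prems] subs_self by simp_all
  then show ?case using Conj.IH[of a] c(1) \<nu>(2) p by auto
next
  case (AllNum y \<psi>)
  have sub: "\<psi> \<in> set (subs \<phi>)" using subs_trans[OF _ AllNum.prems] subs_self by simp
  have "y \<le> k" using subs_fmax[OF AllNum.prems] k by simp
  \<comment> \<open>If the predicate accepts the universal formula, each \<open>n\<close> tests its
    own instance; if it rejects it, any \<open>n\<close> yields a counterexample.\<close>
  have main: "(holds (AllNum y \<psi>) a \<and> holds \<psi> (a(y := n))) \<or>
     (\<not> holds (AllNum y \<psi>) a \<and> (\<exists>n'. \<not> holds \<psi> (a(y := n'))))" for n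
  proof -
    obtain c where c: "c \<in> set (req k (AllNum y \<psi>))" "meets X x c (prod_encode (n, etup k a))"
      using S[OF AllNum.prems] unfolding sat_req_def by blast
    then obtain \<nu> where \<nu>: "peval \<nu> (fst c) = prod_encode (n, etup k a)"
      "\<forall>(b, t)\<in>set (snd c). (peval \<nu> t \<in> X) = b"
      by (auto simp: meets_def)
    have e: "etup k (\<lambda>i. \<nu> (Suc (2 * i))) = etup k a" "\<nu> 2 = n" using \<nu>(1) c(1) by (auto simp: uv_def)
    then have p: "peval \<nu> (cT \<chi> (tup k uv)) = prod_encode (1, prod_encode (to_nat \<chi>, etup k a))" for \<chi>
      by (simp add: peval_cT uv_def)
    have "etup k (\<lambda>i. peval \<nu> ((uv(y := PV j)) i)) = etup k (a(y := \<nu> j))" for j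
      using e unfolding etup_eq_iff by (simp add: uv_def)
    then have "peval \<nu> (cT \<chi> (tup k (uv(y := PV j)))) =
        prod_encode (1, prod_encode (to_nat \<chi>, etup k (a(y := \<nu> j))))" for \<chi> j
      by (simp only: peval_cT)
    then show ?thesis using c(1) \<nu>(2) p e by auto
  qed
  have h: "holds \<psi> (a(y := n)) \<longleftrightarrow> arith_sat (a(y := n)) V \<psi>" for n by (rule AllNum.IH[OF sub])
  show ?case unfolding arith_sat.simps h[symmetric] using main by blast
next
  case (AllSet Y \<psi>)
  then show ?case using subs_arithmetical[OF ar AllSet.prems] by simp
qed

lemma falsified: "\<exists>\<nu>. \<nu> 0 = x \<and> \<not> arith_sat \<nu> V \<phi>"
proof -
  \<comment> \<open>Any number would do in place of \<open>0\<close>.\<close>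
  obtain c where c: "c \<in> set (reqR k \<phi>)" "meets X x c 0" using R unfolding sat_req_def by blast
  then obtain \<nu> where \<nu>: "\<nu> 0 = x" "\<forall>(b, t)\<in>set (snd c). (peval \<nu> t \<in> X) = b" by (auto simp: meets_def)
  then have "\<not> holds \<phi> (\<lambda>i. peval \<nu> ((uv(0 := PV 0)) i))" using c(1) peval_cT by (auto simp: reqR_def)
  then have "\<not> arith_sat (\<lambda>i. peval \<nu> ((uv(0 := PV 0)) i)) V \<phi>" using truth[OF subs_self] by blast
  then show ?thesis using \<nu>(1) by (intro exI[of _ "\<lambda>i. peval \<nu> ((uv(0 := PV 0)) i)"]) simp
qed

end

text \<open>The standard solution. The bound on \<open>fmax \<psi>\<close> ensures that the
  truncated assignment \<open>etup k a\<close> determines the truth of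
  \<open>\<psi>\<close>.\<close>

definition truth_set :: "nat \<Rightarrow> (nat \<Rightarrow> nat set) \<Rightarrow> nat set" where
  "truth_set k V =
     {prod_encode (1, prod_encode (to_nat \<psi>, etup k a)) | \<psi> a. fmax \<psi> \<le> k \<and> arith_sat a V \<psi>} \<union>
     {prod_encode (2, prod_encode (j, n)) | j n. n \<in> V j} \<union>
     {prod_encode (3, prod_encode (a, prod_encode (b, a + b))) | a b. True} \<union>
     {prod_encode (4, prod_encode (a, prod_encode (b, a * b))) | a b. True}"

lemma truth_set_iff:
  "fmax \<psi> \<le> k \<Longrightarrow>
    prod_encode (Suc 0, prod_encode (to_nat \<psi>, etup k a)) \<in> truth_set k V \<longleftrightarrow> arith_sat a V \<psi>"
  "prod_encode (2, prod_encode (j, n)) \<in> truth_set k V \<longleftrightarrow> n \<in> V j"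
  "prod_encode (3, prod_encode (l, prod_encode (m, n))) \<in> truth_set k V \<longleftrightarrow> n = l + m"
  "prod_encode (4, prod_encode (l, prod_encode (m, n))) \<in> truth_set k V \<longleftrightarrow> n = l * m"
proof -
  assume k: "fmax \<psi> \<le> k"
  show "prod_encode (Suc 0, prod_encode (to_nat \<psi>, etup k a)) \<in> truth_set k V \<longleftrightarrow> arith_sat a V \<psi>"
  proof
    assume "prod_encode (Suc 0, prod_encode (to_nat \<psi>, etup k a)) \<in> truth_set k V"
    then obtain b where "etup k a = etup k b" "arith_sat b V \<psi>" by (auto simp: truth_set_def)
    then show "arith_sat a V \<psi>" using arith_sat_cong[of \<psi> a b V] k by (auto simp: etup_eq_iff)
  qed (use k in \<open>auto simp: truth_set_def\<close>)
qed (auto simp: truth_set_def)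

text \<open>A pair code is at least its first component, and all four tags are positive.\<close>

lemma zero_truth_set: "0 \<notin> truth_set k V"
proof -
  have "prod_encode (Suc i, j) \<noteq> 0" "0 \<noteq> prod_encode (Suc i, j)" for i j
    using le_prod_encode_1[of "Suc i" j] by auto
  then show ?thesis by (auto simp: truth_set_def numeral_eq_Suc)
qed

text \<open>Follows the division of the variables; subtracting \<open>3\<close> undoes the offset
  \<open>6\<close> of \<open>wv\<close>.\<close>

definition asg :: "nat \<Rightarrow> (nat \<Rightarrow> nat) \<Rightarrow> nat \<Rightarrow> nat \<Rightarrow> nat \<Rightarrow> nat" where
  "asg x a d d' n = (if n = 0 then x else if odd n then a (n div 2) else if n = 2 then d
     else if n = 4 then d' else arith_val a (from_nat (n div 2 - 3)))"

lemma asg_simps [simp]: "asg x a d d' 0 = x" "asg x a d d' (Suc (2 * i)) = a i" "asg x a d d' 2 = d"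
  "asg x a d d' 4 = d'" "peval (asg x a d d') (wv t) = arith_val a t" "peval (asg x a d d') (uv i) = a i"
  by (auto simp: asg_def wv_def uv_def)

lemma asg_vt [simp]: "peval (asg x a d d') (vt t) = arith_val a t"
  by (induction t) auto

lemma asg_lits: "(b, u) \<in> set (lits t) \<Longrightarrow> (peval (asg x a d d') u \<in> truth_set k V) = b"
  by (induction t) (auto simp: cA_def cM_def truth_set_iff)

lemma asg_tup_upd: "etup k (\<lambda>i. peval (asg x a d d') ((uv(y := t)) i)) = etup k (a(y := peval (asg x a d d') t))"
  unfolding etup_eq_iff by simp

lemma asg_cT:
  assumes "fmax \<psi> \<le> k"
  shows "peval (asg x a d d') (cT \<psi> (tup k uv)) \<in> truth_set k V \<longleftrightarrow> arith_sat a V \<psi>"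
    "peval (asg x a d d') (cT \<psi> (tup k (uv(y := t)))) \<in> truth_set k V \<longleftrightarrow>
      arith_sat (a(y := peval (asg x a d d') t)) V \<psi>"
proof -
  show "peval (asg x a d d') (cT \<psi> (tup k uv)) \<in> truth_set k V \<longleftrightarrow> arith_sat a V \<psi>"
    using assms by (simp add: cT_def truth_set_iff)
  have "peval (asg x a d d') (cT \<psi> (tup k (uv(y := t)))) =
    prod_encode (Suc 0, prod_encode (to_nat \<psi>, etup k (a(y := peval (asg x a d d') t))))"
    unfolding cT_def peval.simps peval_tup asg_tup_upd by simp
  then show "peval (asg x a d d') (cT \<psi> (tup k (uv(y := t)))) \<in> truth_set k V \<longleftrightarrow>
      arith_sat (a(y := peval (asg x a d d') t)) V \<psi>"
    using assms by (simp only: truth_set_iff)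
qed

lemma meets_asg:
  assumes "c \<in> set r" "peval (asg x a d d') (fst c) = m"
    "\<And>b t. (b, t) \<in> set (snd c) \<Longrightarrow> (peval (asg x a d d') t \<in> X) = b"
  shows "\<exists>c\<in>set r. meets X x c m"
  unfolding meets_def using assms by (intro bexI[of _ c] exI[of _ "asg x a d d'"]) auto

lemma sat_req_formula:
  assumes "arithmetical \<psi>" "fmax \<psi> \<le> k"
  shows "sat_req (truth_set k V) x (req k \<psi>)"
  unfolding sat_req_def
proof
  fix m
  let ?X = "truth_set k V"
  show "\<exists>c\<in>set (req k \<psi>). meets ?X x c m"
  proof (cases \<psi>)
    case (Eq s t)
    obtain a where a: "etup k a = m" using etup_surj by blast
    show ?thesis
    proof (cases "arith_val a s" "arith_val a t" rule: linorder_cases)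
      case less
      \<comment> \<open>\<open>d\<close> is one less than the difference, because the clause adds
        \<open>PSuc (PV 2)\<close>.\<close>
      then obtain d where d: "arith_val a t = arith_val a s + Suc d" using less_imp_Suc_add by fastforce
      show ?thesis
        by (rule meets_asg[of "req k \<psi> ! 1" _ x a d 0])
          (use a d assms Eq in \<open>auto simp: cA_def truth_set_iff asg_cT asg_lits\<close>)
    next
      case equal
      show ?thesis
        by (rule meets_asg[of "req k \<psi> ! 0" _ x a 0 0])
          (use a equal assms Eq in \<open>auto simp: cA_def truth_set_iff asg_cT asg_lits\<close>)
    next
      case greater
      then obtain d where d: "arith_val a s = arith_val a t + Suc d" using less_imp_Suc_add by fastforce
      show ?thesis
        by (rule meets_asg[of "req k \<psi> ! 2" _ x a d 0])
          (use a d assms Eq in \<open>auto simp: cA_def truth_set_iff asg_cT asg_lits\<close>)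
    qed
  next
    case (Mem t Y)
    obtain a where a: "etup k a = m" using etup_surj by blast
    let ?b = "arith_val a t \<in> V Y"
    show ?thesis
      by (rule meets_asg[of "(tup k uv, (?b, cT (Mem t Y) (tup k uv)) # (?b, cV Y (vt t)) # lits t)" _ x a 0 0])
        (use a assms Mem in \<open>auto simp: cV_def truth_set_iff asg_cT asg_lits\<close>)
  next
    case (Neg \<chi>)
    obtain a where a: "etup k a = m" using etup_surj by blast
    let ?b = "arith_sat a V \<chi>"
    show ?thesis
      by (rule meets_asg[of "(tup k uv, [(\<not> ?b, cT (Neg \<chi>) (tup k uv)), (?b, cT \<chi> (tup k uv))])" _ x a 0 0])
        (use a assms Neg in \<open>auto simp: asg_cT\<close>)
  next
    case (Conj \<chi> \<chi>')
    obtain a where a: "etup k a = m" using etup_surj by blast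
    consider "arith_sat a V \<chi>" "arith_sat a V \<chi>'" | "\<not> arith_sat a V \<chi>" | "\<not> arith_sat a V \<chi>'" by blast
    then show ?thesis
    proof cases
      case 1
      show ?thesis
        by (rule meets_asg[of "req k \<psi> ! 0" _ x a 0 0])
          (use a 1 assms Conj in \<open>auto simp: asg_cT\<close>)
    next
      case 2
      show ?thesis
        by (rule meets_asg[of "req k \<psi> ! 1" _ x a 0 0])
          (use a 2 assms Conj in \<open>auto simp: asg_cT\<close>)
    next
      case 3
      show ?thesis
        by (rule meets_asg[of "req k \<psi> ! 2" _ x a 0 0])
          (use a 3 assms Conj in \<open>auto simp: asg_cT\<close>)
    qed
  next
    case (AllNum y \<chi>)
    obtain n r where m: "m = prod_encode (n, r)" by (metis prod_decode_inverse surj_pair)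
    obtain a where a: "etup k a = r" using etup_surj by blast
    have k: "fmax \<chi> \<le> k" "fmax (AllNum y \<chi>) \<le> k" using assms AllNum by auto
    show ?thesis
    proof (cases "arith_sat a V (AllNum y \<chi>)")
      case True
      then have n: "arith_sat (a(y := n)) V \<chi>" by (simp only: arith_sat.simps)
      show ?thesis
      proof (rule meets_asg[of "req k \<psi> ! 0" _ x a n 0])
        fix b t assume "(b, t) \<in> set (snd (req k \<psi> ! 0))"
        then show "(peval (asg x a n 0) t \<in> ?X) = b"
          using asg_cT(1)[OF k(2), of x a n 0 V] asg_cT(2)[OF k(1), of x a n 0 y "PV 2" V] True n
          by (auto simp: AllNum simp del: arith_sat.simps fun_upd_apply)
      qed (use m a AllNum in auto)
    next
      case False
      then obtain n' where n: "\<not> arith_sat (a(y := n')) V \<chi>" by auto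
      show ?thesis
      proof (rule meets_asg[of "req k \<psi> ! 1" _ x a n n'])
        fix b t assume "(b, t) \<in> set (snd (req k \<psi> ! 1))"
        then show "(peval (asg x a n n') t \<in> ?X) = b"
          using asg_cT(1)[OF k(2), of x a n n' V] asg_cT(2)[OF k(1), of x a n n' y "PV 4" V] False n
          by (auto simp: AllNum simp del: arith_sat.simps fun_upd_apply)
      qed (use m a AllNum in auto)
    qed
  qed (use assms in simp)
qed

lemma sat_req_arithmetic: "sat_req (truth_set k V) x reqA" "sat_req (truth_set k V) x reqM"
proof -
  have tr: "\<exists>a b c. m = prod_encode (a, prod_encode (b, c))" for m
    by (metis prod_decode_inverse surj_pair)
  show "sat_req (truth_set k V) x reqA"
    unfolding sat_req_def
  proof
    fix m
    obtain a b c where m: "m = prod_encode (a, prod_encode (b, c))" using tr by blast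
    consider "c \<noteq> a + b" | "b = 0" "c = a" | b' where "b = Suc b'" "c = Suc (a + b')" by (cases b) auto
    then show "\<exists>c\<in>set reqA. meets (truth_set k V) x c m"
    proof cases
      case 1
      show ?thesis
        by (rule meets_asg[of "reqA ! 0" _ x "(!) [a, b, c]" 0 0])
          (use m 1 in \<open>auto simp: reqA_def cA_def truth_set_iff\<close>)
    next
      case 2
      show ?thesis
        by (rule meets_asg[of "reqA ! 1" _ x "(!) [a]" 0 0])
          (use m 2 in \<open>auto simp: reqA_def cA_def truth_set_iff\<close>)
    next
      case 3
      show ?thesis
        by (rule meets_asg[of "reqA ! 2" _ x "(!) [a, b', a + b']" 0 0])
          (use m 3 in \<open>auto simp: reqA_def cA_def truth_set_iff\<close>)
    qed
  qed
  show "sat_req (truth_set k V) x reqM"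
    unfolding sat_req_def
  proof
    fix m
    obtain a b c where m: "m = prod_encode (a, prod_encode (b, c))" using tr by blast
    consider "c \<noteq> a * b" | "b = 0" "c = 0" | b' where "b = Suc b'" "c = a * b' + a"
      by (cases b) (force simp: add.commute)+
    then show "\<exists>c\<in>set reqM. meets (truth_set k V) x c m"
    proof cases
      case 1
      show ?thesis
        by (rule meets_asg[of "reqM ! 0" _ x "(!) [a, b, c]" 0 0])
          (use m 1 in \<open>auto simp: reqM_def cM_def truth_set_iff\<close>)
    next
      case 2
      show ?thesis
        by (rule meets_asg[of "reqM ! 1" _ x "(!) [a]" 0 0])
          (use m 2 in \<open>auto simp: reqM_def cM_def truth_set_iff\<close>)
    next
      case 3
      show ?thesis
        by (rule meets_asg[of "reqM ! 2" _ x "(!) [a, b', c, a * b']" 0 0])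
          (use m 3 in \<open>auto simp: reqM_def cM_def cA_def truth_set_iff\<close>)
    qed
  qed
qed

lemma sat_req_root:
  assumes "\<nu> 0 = x" "\<not> arith_sat \<nu> V \<phi>" "fmax \<phi> \<le> k"
  shows "sat_req (truth_set k V) x (reqR k \<phi>)"
  unfolding sat_req_def
proof
  fix m
  have "\<nu>(0 := x) = \<nu>" using assms(1) by auto
  then show "\<exists>c\<in>set (reqR k \<phi>). meets (truth_set k V) x c m"
    using assms(2) asg_cT(2)[OF assms(3), of x \<nu> m 0 0 "PV 0" V]
    by (intro meets_asg[of "reqR k \<phi> ! 0" _ x \<nu> m 0]) (auto simp: reqR_def simp del: fun_upd_apply)
qed

lemma pi11_solvable:
  assumes "pi11 B"
  shows "\<exists>G. pair_patterns G \<and> (\<forall>x. x \<notin> B \<longleftrightarrow> solvable G x)"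
proof -
  obtain \<phi> where \<phi>: "arithmetical \<phi>" "\<And>x. x \<notin> B \<longleftrightarrow> (\<exists>\<nu> V. \<nu> 0 = x \<and> \<not> arith_sat \<nu> V \<phi>)"
    using pi11_iff_matrix[OF assms] by blast
  let ?G = "tagged (reqs (fmax \<phi>) \<phi>)"
  have "(\<exists>\<nu> V. \<nu> 0 = x \<and> \<not> arith_sat \<nu> V \<phi>) \<longleftrightarrow> solvable ?G x" for x
  proof
    assume "\<exists>\<nu> V. \<nu> 0 = x \<and> \<not> arith_sat \<nu> V \<phi>"
    then obtain \<nu> V where \<nu>: "\<nu> 0 = x" "\<not> arith_sat \<nu> V \<phi>" by blast
    have "\<forall>r\<in>set (reqs (fmax \<phi>) \<phi>). sat_req (truth_set (fmax \<phi>) V) x r"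
      using sat_req_root[OF \<nu>] sat_req_arithmetic sat_req_formula subs_fmax subs_arithmetical[OF \<phi>(1)]
      by (auto simp: reqs_def)
    then have "\<forall>m. \<exists>c\<in>set ?G. meets (truth_set (fmax \<phi>) V) x c m" unfolding tagged_iff .
    then show "solvable ?G x" unfolding solvable_def using zero_truth_set[of "fmax \<phi>" V] by blast
  next
    assume "solvable ?G x"
    then obtain X where "\<forall>r\<in>set (reqs (fmax \<phi>) \<phi>). sat_req X x r"
      unfolding solvable_def tagged_iff by blast
    then interpret satisfied X x "fmax \<phi>" \<phi>
      by unfold_locales (auto simp: reqs_def \<phi>(1))
    show "\<exists>\<nu> V. \<nu> 0 = x \<and> \<not> arith_sat \<nu> V \<phi>" using falsified by blast
  qed
  then show ?thesis using pair_patterns_tagged \<phi>(2) by blast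
qed


section \<open>Computability of the reduction\<close>

definition computes :: "nat \<Rightarrow> (nat list \<Rightarrow> nat) \<Rightarrow> bool" where
  "computes n f \<longleftrightarrow> (\<exists>r. \<forall>xs. length xs = n \<longrightarrow> rec_eval r xs (f xs))"

lemma computes_nth: "i < n \<Longrightarrow> computes n (\<lambda>xs. xs ! i)"
  unfolding computes_def by (auto intro: rec_eval.proj)

lemma computes_comp1:
  assumes "computes 1 g" "computes n f"
  shows "computes n (\<lambda>xs. g [f xs])"
proof -
  obtain r q where r: "\<And>xs. length xs = 1 \<Longrightarrow> rec_eval r xs (g xs)"
    and q: "\<And>xs. length xs = n \<Longrightarrow> rec_eval q xs (f xs)" using assms by (auto simp: computes_def)
  have "rec_eval (Comp r [q]) xs (g [f xs])" if "length xs = n" for xs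
    by (rule rec_eval.comp[where ys = "[f xs]"]) (use r[of "[f xs]"] q[OF that] in auto)
  then show ?thesis unfolding computes_def by blast
qed

lemma computes_comp2:
  assumes "computes 2 g" "computes n f" "computes n f'"
  shows "computes n (\<lambda>xs. g [f xs, f' xs])"
proof -
  obtain r q q' where r: "\<And>xs. length xs = 2 \<Longrightarrow> rec_eval r xs (g xs)"
    and q: "\<And>xs. length xs = n \<Longrightarrow> rec_eval q xs (f xs)" "\<And>xs. length xs = n \<Longrightarrow> rec_eval q' xs (f' xs)"
    using assms by (auto simp: computes_def)
  have "rec_eval (Comp r [q, q']) xs (g [f xs, f' xs])" if "length xs = n" for xs
    by (rule rec_eval.comp[where ys = "[f xs, f' xs]"]) (use r[of "[f xs, f' xs]"] q[OF that] in auto)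
  then show ?thesis unfolding computes_def by blast
qed

lemma computes_Suc: "computes n f \<Longrightarrow> computes n (\<lambda>xs. Suc (f xs))"
proof -
  have "computes 1 (\<lambda>xs. Suc (hd xs))"
    unfolding computes_def by (auto simp: length_Suc_conv intro!: exI[of _ Succ] rec_eval.succ)
  then show "computes n f \<Longrightarrow> computes n (\<lambda>xs. Suc (f xs))"
    using computes_comp1[of "\<lambda>xs. Suc (hd xs)" n f] by simp
qed

lemma computes_const: "computes n (\<lambda>xs. c)"
proof (induction c)
  case 0
  then show ?case unfolding computes_def by (auto intro: rec_eval.zero)
next
  case (Suc c)
  then show ?case using computes_Suc by fastforce
qed

text \<open>The equations follow the argument order of \<open>PrimRec\<close>: recursion argument,
  previous value, parameters.\<close>

lemma computes_primrec:
  assumes "computes n f" "computes (Suc (Suc n)) g"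
    "\<And>xs. length xs = n \<Longrightarrow> h (0 # xs) = f xs"
    "\<And>m xs. length xs = n \<Longrightarrow> h (Suc m # xs) = g (m # h (m # xs) # xs)"
  shows "computes (Suc n) h"
proof -
  obtain r q where r: "\<And>xs. length xs = n \<Longrightarrow> rec_eval r xs (f xs)"
    and q: "\<And>xs. length xs = Suc (Suc n) \<Longrightarrow> rec_eval q xs (g xs)" using assms(1,2) by (auto simp: computes_def)
  have "rec_eval (PrimRec r q) (m # xs) (h (m # xs))" if "length xs = n" for m xs
  proof (induction m)
    case 0
    then show ?case using r[OF that] assms(3)[OF that] by (auto intro: rec_eval.primrec_0)
  next
    case (Suc m)
    then show ?case using q[of "m # h (m # xs) # xs"] assms(4)[OF that] that
      by (auto intro: rec_eval.primrec_Suc)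
  qed
  then show ?thesis unfolding computes_def by (auto simp: length_Suc_conv intro!: exI[of _ "PrimRec r q"])
qed

lemma computes_add:
  assumes "computes n f" "computes n g"
  shows "computes n (\<lambda>xs. f xs + g xs)"
proof -
  have "computes (Suc 1) (\<lambda>xs. xs ! 0 + xs ! 1)"
    by (rule computes_primrec[of _ "\<lambda>xs. xs ! 0" "\<lambda>xs. Suc (xs ! 1)"])
      (auto intro: computes_nth computes_Suc)
  then show ?thesis using computes_comp2[OF _ assms, of "\<lambda>xs. xs ! 0 + xs ! 1"] by (simp add: numeral_2_eq_2)
qed

lemma computes_triangle:
  assumes "computes n f"
  shows "computes n (\<lambda>xs. triangle (f xs))"
proof -
  have "computes (Suc 0) (\<lambda>xs. triangle (xs ! 0))"
    by (rule computes_primrec[of _ "\<lambda>xs. 0" "\<lambda>xs. xs ! 1 + Suc (xs ! 0)"])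
      (auto intro!: computes_nth computes_Suc computes_add computes_const)
  then show ?thesis using computes_comp1[OF _ assms, of "\<lambda>xs. triangle (xs ! 0)"] by simp
qed

lemma computes_prod_encode:
  assumes "computes n f" "computes n g"
  shows "computes n (\<lambda>xs. prod_encode (f xs, g xs))"
  unfolding prod_encode_def using assms by (auto intro!: computes_add computes_triangle)

lemma computes_thrice: "computes n f \<Longrightarrow> computes n (\<lambda>xs. 3 * f xs)"
  using computes_add[of n f "\<lambda>xs. f xs + f xs"] computes_add[of n f f]
  by (simp add: algebra_simps numeral_3_eq_3)

lemmas computes_intros = computes_nth computes_Suc computes_const computes_add computes_prod_encode computes_thrice

lemma computable_if: "computes 1 (\<lambda>xs. h (xs ! 0)) \<Longrightarrow> computable h"
  unfolding computes_def computable_def by (metis One_nat_def length_Cons list.size(3) nth_Cons_0)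

text \<open>The only list in the reduction whose length depends on the input; it grows by one cell
  per recursion step.\<close>

lemma computes_input_body: "computes 1 (\<lambda>xs. list_encode (map atom_encode (input_body (xs ! 0))))"
proof -
  have "computes (Suc 0) (\<lambda>xs. list_encode (map atom_encode (input_body (xs ! 0))))"
  proof (rule computes_primrec[of _ "\<lambda>xs. list_encode (map atom_encode (input_body 0))"
      "\<lambda>xs. Suc (prod_encode (atom_encode (aW tS (Var (Suc (xs ! 0))) (Var (Suc (Suc (xs ! 0)))) gt (Var 0)), xs ! 1))"])
    show "computes (Suc (Suc 0)) (\<lambda>xs. Suc (prod_encode
        (atom_encode (aW tS (Var (Suc (xs ! 0))) (Var (Suc (Suc (xs ! 0)))) gt (Var 0)), xs ! 1)))"
      unfolding atom_encode_def by (auto intro!: computes_intros simp del: mult_Suc_right)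
  qed (auto intro: computes_const)
  then show ?thesis by simp
qed

lemma computable_kb: "computable (\<lambda>x. kb_encode (input_rule x # rs) fs)"
proof (rule computable_if)
  \<comment> \<open>With the head spelled out: \<open>5\<close> is the predicate of
    \<open>aW\<close>, \<open>10\<close> the code of \<open>tI\<close>, \<open>3 * Suc x\<close>
    that of the head variable, and each \<open>Suc (prod_encode ...)\<close> a list cell.\<close>
  have "kb_encode (input_rule x # rs) fs =
    prod_encode (Suc (prod_encode (prod_encode (list_encode (map atom_encode (input_body x)),
      Suc (prod_encode (prod_encode (5, Suc (prod_encode (10, Suc (prod_encode (3 * Suc x,
        list_encode (map trm_encode [gt, gt, Var 0])))))), 0))),
      list_encode (map rule_encode rs))), list_encode (map atom_encode fs))" for x
    by (simp add: kb_encode_def rule_encode_def input_rule_def atom_encode_def)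
  then show "computes 1 (\<lambda>xs. kb_encode (input_rule (xs ! 0) # rs) fs)"
    by (simp only:) (intro computes_intros computes_input_body; simp)
qed


section \<open>Membership in the class\<close>

primrec trn :: "(nat \<Rightarrow> nat) \<Rightarrow> arith_trm \<Rightarrow> arith_trm" where
  "trn \<rho> (NVar x) = NVar (\<rho> x)"
| "trn \<rho> NZero = NZero"
| "trn \<rho> (NSuc t) = NSuc (trn \<rho> t)"
| "trn \<rho> (NAdd s t) = NAdd (trn \<rho> s) (trn \<rho> t)"
| "trn \<rho> (NMul s t) = NMul (trn \<rho> s) (trn \<rho> t)"

primrec frn :: "(nat \<Rightarrow> nat) \<Rightarrow> arith_fm \<Rightarrow> arith_fm" where
  "frn \<rho> (Eq s t) = Eq (trn \<rho> s) (trn \<rho> t)"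
| "frn \<rho> (Mem t X) = Mem (trn \<rho> t) X"
| "frn \<rho> (Neg \<phi>) = Neg (frn \<rho> \<phi>)"
| "frn \<rho> (Conj \<phi> \<psi>) = Conj (frn \<rho> \<phi>) (frn \<rho> \<psi>)"
| "frn \<rho> (AllNum x \<phi>) = AllNum (\<rho> x) (frn \<rho> \<phi>)"
| "frn \<rho> (AllSet X \<phi>) = AllSet X (frn \<rho> \<phi>)"

lemma arith_val_trn: "arith_val \<nu> (trn \<rho> t) = arith_val (\<lambda>i. \<nu> (\<rho> i)) t"
  by (induction t) auto

lemma arithmetical_frn: "arithmetical (frn \<rho> \<phi>) = arithmetical \<phi>"
  by (induction \<phi>) auto

text \<open>Bound variables are renamed together with free ones, and injectivity prevents
  capture.\<close>

lemma arith_sat_frn: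
  assumes "inj_on \<rho> {..k}" "fmax \<phi> \<le> k"
  shows "arith_sat \<nu> V (frn \<rho> \<phi>) = arith_sat (\<lambda>i. \<nu> (\<rho> i)) V \<phi>"
  using assms(2)
proof (induction \<phi> arbitrary: \<nu> V)
  case (AllNum x \<phi>)
  have "arith_sat (\<nu>(\<rho> x := n)) V (frn \<rho> \<phi>) = arith_sat ((\<lambda>i. \<nu> (\<rho> i))(x := n)) V \<phi>" for n
  proof -
    have "arith_sat (\<nu>(\<rho> x := n)) V (frn \<rho> \<phi>) = arith_sat (\<lambda>i. (\<nu>(\<rho> x := n)) (\<rho> i)) V \<phi>"
      using AllNum by (simp only: fmax.simps max.bounded_iff)
    also have "\<dots> = arith_sat ((\<lambda>i. \<nu> (\<rho> i))(x := n)) V \<phi>"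
    proof (rule arith_sat_cong)
      fix i assume "i \<le> fmax \<phi>"
      then have "\<rho> i = \<rho> x \<longleftrightarrow> i = x" using AllNum.prems assms(1) by (auto simp: inj_on_def)
      then show "(\<nu>(\<rho> x := n)) (\<rho> i) = ((\<lambda>i. \<nu> (\<rho> i))(x := n)) i" by simp
    qed
    finally show ?thesis .
  qed
  then show ?case by (simp only: frn.simps arith_sat.simps)
qed (auto simp: arith_val_trn)

type_synonym pred2 = "(nat \<Rightarrow> nat) \<Rightarrow> (nat \<Rightarrow> nat set) \<Rightarrow> bool"

text \<open>The condition \<open>\<Gamma>\<close> will fix set variable \<open>0\<close> to the table of list lookup.\<close>

definition adef :: "((nat \<Rightarrow> nat set) \<Rightarrow> bool) \<Rightarrow> pred2 \<Rightarrow> bool" where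
  "adef \<Gamma> P \<longleftrightarrow> (\<exists>\<phi>. arithmetical \<phi> \<and> (\<forall>\<nu> V. \<Gamma> V \<longrightarrow> arith_sat \<nu> V \<phi> = P \<nu> V))"

lemma adef_cong: "adef \<Gamma> P \<Longrightarrow> (\<And>\<nu> V. \<Gamma> V \<Longrightarrow> P \<nu> V = Q \<nu> V) \<Longrightarrow> adef \<Gamma> Q"
  unfolding adef_def by blast

lemma adef_fm: "arithmetical \<phi> \<Longrightarrow> adef \<Gamma> (\<lambda>\<nu> V. arith_sat \<nu> V \<phi>)"
  unfolding adef_def by blast

lemma adef_not: "adef \<Gamma> P \<Longrightarrow> adef \<Gamma> (\<lambda>\<nu> V. \<not> P \<nu> V)"
  unfolding adef_def by (metis arith_sat.simps(3) arithmetical.simps(3))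

lemma adef_and: "adef \<Gamma> P \<Longrightarrow> adef \<Gamma> Q \<Longrightarrow> adef \<Gamma> (\<lambda>\<nu> V. P \<nu> V \<and> Q \<nu> V)"
  unfolding adef_def by (metis arith_sat.simps(4) arithmetical.simps(4))

lemma adef_or: "adef \<Gamma> P \<Longrightarrow> adef \<Gamma> Q \<Longrightarrow> adef \<Gamma> (\<lambda>\<nu> V. P \<nu> V \<or> Q \<nu> V)"
  by (rule adef_cong[OF adef_not[OF adef_and[OF adef_not adef_not]]]) auto

lemma adef_imp: "adef \<Gamma> P \<Longrightarrow> adef \<Gamma> Q \<Longrightarrow> adef \<Gamma> (\<lambda>\<nu> V. P \<nu> V \<longrightarrow> Q \<nu> V)"
  by (rule adef_cong[OF adef_or[OF adef_not]]) auto

lemma adef_iff: "adef \<Gamma> P \<Longrightarrow> adef \<Gamma> Q \<Longrightarrow> adef \<Gamma> (\<lambda>\<nu> V. P \<nu> V \<longleftrightarrow> Q \<nu> V)"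
  by (rule adef_cong[OF adef_and[OF adef_imp[of \<Gamma> P Q] adef_imp[of \<Gamma> Q P]]]) auto

text \<open>In the premise the quantified variable has index \<open>0\<close> and the others are
  shifted up. The renaming shifts them down, to indices below \<open>k = fmax \<phi>\<close>, so
  \<open>k\<close> is free to become the bound variable.\<close>

lemma adef_all:
  assumes "adef \<Gamma> (\<lambda>\<nu> V. Q (\<nu> 0) (\<lambda>i. \<nu> (Suc i)) V)"
  shows "adef \<Gamma> (\<lambda>\<nu> V. \<forall>n. Q n \<nu> V)"
proof -
  obtain \<phi> where \<phi>: "arithmetical \<phi>"
    "\<And>\<nu> V. \<Gamma> V \<Longrightarrow> arith_sat \<nu> V \<phi> = Q (\<nu> 0) (\<lambda>i. \<nu> (Suc i)) V" using assms unfolding adef_def by blast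
  define k where "k = fmax \<phi>"
  define \<rho> where "\<rho> i = (case i of 0 \<Rightarrow> k | Suc j \<Rightarrow> j)" for i
  have inj: "inj_on \<rho> {..k}" by (auto simp: inj_on_def \<rho>_def split: nat.splits)
  have "arith_sat (\<nu>(k := n)) V (frn \<rho> \<phi>) = Q n \<nu> V" if "\<Gamma> V" for n \<nu> V
  proof -
    have "arith_sat (\<nu>(k := n)) V (frn \<rho> \<phi>) = arith_sat (\<lambda>i. (\<nu>(k := n)) (\<rho> i)) V \<phi>"
      by (rule arith_sat_frn[OF inj]) (simp add: k_def)
    also have "\<dots> = arith_sat (case_nat n \<nu>) V \<phi>"
      by (rule arith_sat_cong) (auto simp: \<rho>_def k_def[symmetric] split: nat.splits)
    also have "\<dots> = Q n \<nu> V" using \<phi>(2)[OF that, of "case_nat n \<nu>"] by simp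
    finally show ?thesis .
  qed
  then have "\<forall>\<nu> V. \<Gamma> V \<longrightarrow> arith_sat \<nu> V (AllNum k (frn \<rho> \<phi>)) = (\<forall>n. Q n \<nu> V)"
    by (simp only: arith_sat.simps) blast
  moreover have "arithmetical (AllNum k (frn \<rho> \<phi>))" using \<phi>(1) by (simp add: arithmetical_frn)
  ultimately show ?thesis unfolding adef_def by blast
qed

lemma adef_ex:
  assumes "adef \<Gamma> (\<lambda>\<nu> V. Q (\<nu> 0) (\<lambda>i. \<nu> (Suc i)) V)"
  shows "adef \<Gamma> (\<lambda>\<nu> V. \<exists>n. Q n \<nu> V)"
  by (rule adef_cong[OF adef_not[OF adef_all[of _ "\<lambda>n \<nu> V. \<not> Q n \<nu> V"]]])
    (auto intro: adef_not assms)

lemma adef_rename: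
  assumes "adef \<Gamma> P" "inj \<rho>"
  shows "adef \<Gamma> (\<lambda>\<nu> V. P (\<lambda>i. \<nu> (\<rho> i)) V)"
proof -
  obtain \<phi> where \<phi>: "arithmetical \<phi>" "\<And>\<nu> V. \<Gamma> V \<Longrightarrow> arith_sat \<nu> V \<phi> = P \<nu> V"
    using assms(1) unfolding adef_def by blast
  have "arith_sat \<nu> V (frn \<rho> \<phi>) = P (\<lambda>i. \<nu> (\<rho> i)) V" if "\<Gamma> V" for \<nu> V
    using arith_sat_frn[of \<rho> "fmax \<phi>" \<phi> \<nu> V] \<phi>(2)[OF that] assms(2) by (simp add: inj_on_def inj_def)
  then show ?thesis using \<phi>(1) arithmetical_frn unfolding adef_def by blast
qed

text \<open>Definability of the graph, with the value in variable \<open>0\<close>; it lets compound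
  terms stand inside definable predicates.\<close>

definition df :: "((nat \<Rightarrow> nat set) \<Rightarrow> bool) \<Rightarrow> ((nat \<Rightarrow> nat) \<Rightarrow> nat) \<Rightarrow> bool" where
  "df \<Gamma> f \<longleftrightarrow> adef \<Gamma> (\<lambda>\<nu> V. \<nu> 0 = f (\<lambda>i. \<nu> (Suc i)))"

lemma adef_eq:
  assumes "df \<Gamma> f" "df \<Gamma> g"
  shows "adef \<Gamma> (\<lambda>\<nu> V. f \<nu> = g \<nu>)"
proof -
  have "adef \<Gamma> (\<lambda>\<nu> V. \<exists>n. n = f \<nu> \<and> n = g \<nu>)"
    by (rule adef_ex) (use assms in \<open>auto simp: df_def intro: adef_and\<close>)
  then show ?thesis by (rule adef_cong) auto
qed

lemma adef_mem:
  assumes "df \<Gamma> f"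
  shows "adef \<Gamma> (\<lambda>\<nu> V. f \<nu> \<in> V j)"
proof -
  have "adef \<Gamma> (\<lambda>\<nu> V. \<nu> 0 \<in> V j)" using adef_fm[of "Mem (NVar 0) j"] by simp
  then have "adef \<Gamma> (\<lambda>\<nu> V. \<exists>n. n = f \<nu> \<and> n \<in> V j)"
    by (intro adef_ex adef_and) (use assms in \<open>auto simp: df_def\<close>)
  then show ?thesis by (rule adef_cong) auto
qed

lemma df_var: "df \<Gamma> (\<lambda>\<nu>. \<nu> i)"
  unfolding df_def using adef_fm[of "Eq (NVar 0) (NVar (Suc i))"] by simp

lemma df_op:
  assumes "df \<Gamma> f" "df \<Gamma> g" "adef \<Gamma> (\<lambda>\<nu> V. \<nu> 2 = op (\<nu> 1) (\<nu> 0))"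
  shows "df \<Gamma> (\<lambda>\<nu>. op (f \<nu>) (g \<nu>))"
proof -
  \<comment> \<open>Indices \<open>0\<close> and \<open>1\<close> hold the operands, which are then
    quantified away, and \<open>2\<close> the result, so the arguments start at
    \<open>3\<close>.\<close>
  define \<rho>1 where "\<rho>1 i = (case i of 0 \<Rightarrow> 1 | Suc j \<Rightarrow> j + 3)" for i :: nat
  define \<rho>0 where "\<rho>0 i = (case i of 0 \<Rightarrow> 0 | Suc j \<Rightarrow> j + 3)" for i :: nat
  have "inj \<rho>1" "inj \<rho>0" by (auto simp: inj_def \<rho>1_def \<rho>0_def split: nat.splits)
  then have "adef \<Gamma> (\<lambda>\<nu> V. \<nu> 1 = f (\<lambda>i. \<nu> (i + 3)))" "adef \<Gamma> (\<lambda>\<nu> V. \<nu> 0 = g (\<lambda>i. \<nu> (i + 3)))"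
    using adef_rename[OF assms(1)[unfolded df_def], of \<rho>1] adef_rename[OF assms(2)[unfolded df_def], of \<rho>0]
    by (simp_all add: \<rho>1_def \<rho>0_def)
  then have "adef \<Gamma> (\<lambda>\<nu> V. (\<nu> 1 = f (\<lambda>i. \<nu> (i + 3)) \<and> \<nu> 0 = g (\<lambda>i. \<nu> (i + 3))) \<and> \<nu> 2 = op (\<nu> 1) (\<nu> 0))"
    using assms(3) by (intro adef_and)
  then have "adef \<Gamma> (\<lambda>\<nu> V. \<exists>a b. (a = f (\<lambda>i. \<nu> (Suc i)) \<and> b = g (\<lambda>i. \<nu> (Suc i))) \<and> \<nu> 0 = op a b)"
    by (intro adef_ex) (simp add: numeral_3_eq_3 numeral_2_eq_2)
  then show ?thesis unfolding df_def by (rule adef_cong) auto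
qed

lemma df_Suc: "df \<Gamma> f \<Longrightarrow> df \<Gamma> (\<lambda>\<nu>. Suc (f \<nu>))"
  by (rule df_op[of _ f f "\<lambda>a b. Suc a"]) (use adef_fm[of "Eq (NVar 2) (NSuc (NVar 1))"] in auto)

lemma df_add: "df \<Gamma> f \<Longrightarrow> df \<Gamma> g \<Longrightarrow> df \<Gamma> (\<lambda>\<nu>. f \<nu> + g \<nu>)"
  by (rule df_op) (use adef_fm[of "Eq (NVar 2) (NAdd (NVar 1) (NVar 0))"] in auto)

lemma df_mul: "df \<Gamma> f \<Longrightarrow> df \<Gamma> g \<Longrightarrow> df \<Gamma> (\<lambda>\<nu>. f \<nu> * g \<nu>)"
  by (rule df_op) (use adef_fm[of "Eq (NVar 2) (NMul (NVar 1) (NVar 0))"] in auto)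

lemma df_const: "df \<Gamma> (\<lambda>\<nu>. c)"
proof (induction c)
  case 0
  then show ?case unfolding df_def using adef_fm[of "Eq (NVar 0) NZero"] by simp
next
  case (Suc c)
  then show ?case by (rule df_Suc)
qed

text \<open>Doubling removes the division, so that the graph of pairing becomes a polynomial
  equation.\<close>

lemma triangle_double: "triangle n + triangle n = n * Suc n"
  by (induction n) auto

lemma df_pair:
  assumes "df \<Gamma> f" "df \<Gamma> g"
  shows "df \<Gamma> (\<lambda>\<nu>. prod_encode (f \<nu>, g \<nu>))"
proof (rule df_op[OF assms, of "\<lambda>a b. prod_encode (a, b)"])
  have "c + c = (a + b) * Suc (a + b) + (a + a) \<longleftrightarrow> c = prod_encode (a, b)" for a b c :: nat
    using triangle_double[of "a + b"] by (auto simp: prod_encode_def)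
  then show "adef \<Gamma> (\<lambda>\<nu> V. \<nu> 2 = prod_encode (\<nu> 1, \<nu> 0))"
    using adef_fm[of "Eq (NAdd (NVar 2) (NVar 2))
      (NAdd (NMul (NAdd (NVar 1) (NVar 0)) (NSuc (NAdd (NVar 1) (NVar 0)))) (NAdd (NVar 1) (NVar 1)))" \<Gamma>]
    by simp
qed

lemmas adef_intros = adef_not adef_and adef_or adef_imp adef_iff adef_all adef_ex adef_eq adef_mem
  df_var df_Suc df_add df_mul df_pair df_const

section \<open>List lookup\<close>

definition lnth :: "nat \<Rightarrow> nat \<Rightarrow> nat \<Rightarrow> bool" where
  "lnth l i y \<longleftrightarrow> i < length (list_decode l) \<and> list_decode l ! i = y"

text \<open>
  List lookup is determined by its recursion equations, so a formula may quantify over its table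
  (set variable \<open>0\<close>); Goedel's beta function is not needed.
\<close>

definition NTH :: "nat set" where
  "NTH = {prod_encode (l, prod_encode (i, y)) | l i y. lnth l i y}"

lemma NTH_iff: "prod_encode (l, prod_encode (i, y)) \<in> NTH \<longleftrightarrow> lnth l i y"
  by (auto simp: NTH_def)

definition is_NTH :: "nat set \<Rightarrow> bool" where
  "is_NTH N \<longleftrightarrow> (\<forall>l i y. prod_encode (l, prod_encode (i, y)) \<in> N \<longleftrightarrow>
     (\<exists>h t. l = Suc (prod_encode (h, t)) \<and>
        (i = 0 \<and> y = h \<or> (\<exists>j. i = Suc j \<and> prod_encode (t, prod_encode (j, y)) \<in> N))))"

lemma list_decode_Suc_pair: "list_decode (Suc (prod_encode (h, t))) = h # list_decode t"
  by simp

lemma lnth_rec: "lnth l i y \<longleftrightarrow> (\<exists>h t. l = Suc (prod_encode (h, t)) \<and>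
    (i = 0 \<and> y = h \<or> (\<exists>j. i = Suc j \<and> lnth t j y)))"
proof (cases l)
  case 0
  then show ?thesis by (simp add: lnth_def)
next
  case (Suc m)
  obtain h t where m: "m = prod_encode (h, t)" by (metis prod_decode_inverse surj_pair)
  then show ?thesis unfolding Suc m by (cases i) (auto simp: lnth_def list_decode_Suc_pair)
qed

text \<open>Induction on the index: the equation for \<open>Suc j\<close> refers only to index
  \<open>j\<close> of the tail, so it has exactly one solution.\<close>

lemma is_NTH_iff: "is_NTH N \<longleftrightarrow> N = NTH"
proof
  assume N: "is_NTH N"
  have *: "prod_encode (l, prod_encode (i, y)) \<in> N \<longleftrightarrow> lnth l i y" for l i y
  proof (induction i arbitrary: l)
    case 0
    then show ?case using N[unfolded is_NTH_def, rule_format, of l 0 y] lnth_rec[of l 0 y] by auto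
  next
    case (Suc i)
    show ?case using N[unfolded is_NTH_def, rule_format, of l "Suc i" y] lnth_rec[of l "Suc i" y] Suc by auto
  qed
  show "N = NTH"
  proof (rule set_eqI)
    fix n
    obtain l i y where "n = prod_encode (l, prod_encode (i, y))" by (metis prod_decode_inverse surj_pair)
    then show "n \<in> N \<longleftrightarrow> n \<in> NTH" using * NTH_iff by simp
  qed
next
  assume "N = NTH"
  then show "is_NTH N" unfolding is_NTH_def by (simp only: NTH_iff) (intro allI lnth_rec)
qed

lemma adef_is_NTH: "adef (\<lambda>_. True) (\<lambda>\<nu> V. is_NTH (V 0))"
  unfolding is_NTH_def by (intro adef_intros)

abbreviation "\<Gamma>N \<equiv> \<lambda>V :: nat \<Rightarrow> nat set. V 0 = NTH"

lemma adef_lnth: "adef \<Gamma>N (\<lambda>\<nu> V. lnth (\<nu> a) (\<nu> b) (\<nu> c))"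
proof (rule adef_cong)
  show "adef \<Gamma>N (\<lambda>\<nu> V. prod_encode (\<nu> a, prod_encode (\<nu> b, \<nu> c)) \<in> V 0)" by (intro adef_intros)
qed (simp add: NTH_iff)

definition lmem :: "nat \<Rightarrow> nat \<Rightarrow> bool" where
  "lmem y l \<longleftrightarrow> (\<exists>i. lnth l i y)"

lemma adef_lmem: "adef \<Gamma>N (\<lambda>\<nu> V. lmem (\<nu> a) (\<nu> b))"
  unfolding lmem_def by (intro adef_intros adef_lnth)

lemma lmem_iff: "lmem y l \<longleftrightarrow> y \<in> set (list_decode l)"
  by (auto simp: lmem_def lnth_def in_set_conv_nth)

lemma lmem_list_encode [simp]: "lmem y (list_encode xs) \<longleftrightarrow> y \<in> set xs"
  by (simp add: lmem_iff)

lemma lnth_map [simp]: "lnth (list_encode (map f xs)) i y \<longleftrightarrow> i < length xs \<and> f (xs ! i) = y"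
  by (auto simp: lnth_def)

lemma lnth_ext:
  assumes "\<And>i y. lnth l i y \<longleftrightarrow> lnth l' i y"
  shows "l = l'"
proof -
  have "i < length (list_decode l) \<longleftrightarrow> i < length (list_decode l')" for i
    using assms[of i] unfolding lnth_def by blast
  then have len: "length (list_decode l) = length (list_decode l')" by (meson linorder_neqE_nat nat_less_le)
  have "list_decode l = list_decode l'"
    by (rule nth_equalityI[OF len]) (use assms in \<open>auto simp: lnth_def\<close>)
  then show ?thesis by (metis list_decode_inverse)
qed

subsection \<open>Surjectivity of the codes\<close>

text \<open>Every number codes a term, hence also an atom, a rule and a knowledge base, so formulas
  quantify over codes without testing for well-formedness.\<close>

lemma trm_encode_surj: "\<exists>t. n = trm_encode t"
proof -
  consider "n mod 3 = 0" | "n mod 3 = 1" | "n mod 3 = 2" by linarith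
  then show ?thesis
  proof cases
    case 1
    then have "n = trm_encode (Var (n div 3))" by (simp add: minus_mod_eq_mult_div[symmetric])
    then show ?thesis by blast
  next
    case 2
    then have "n = trm_encode (Const (n div 3))" using mult_div_mod_eq[of 3 n] by simp
    then show ?thesis by blast
  next
    case 3
    then have "n = trm_encode (Null (n div 3))" using mult_div_mod_eq[of 3 n] by simp
    then show ?thesis by blast
  qed
qed

lemma list_encode_surj:
  assumes "\<And>n. \<exists>t. n = f t"
  shows "\<exists>xs. l = list_encode (map f xs)"
proof -
  have "\<exists>xs. list_decode l = map f xs" using assms by (simp add: ex_map_conv)
  then show ?thesis by (metis list_decode_inverse)
qed

lemma prod_encode_surj: "\<exists>a b. n = prod_encode (a, b)"
  by (metis prod_decode_inverse surj_pair)

lemma atom_encode_surj: "\<exists>a. n = atom_encode a"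
proof -
  obtain p l where n: "n = prod_encode (p, l)" using prod_encode_surj by blast
  obtain ts where "l = list_encode (map trm_encode ts)" using list_encode_surj[OF trm_encode_surj] by blast
  then have "n = atom_encode (Atom p ts)" using n by (simp add: atom_encode_def)
  then show ?thesis by blast
qed

lemma rule_encode_surj: "\<exists>r. n = rule_encode r"
proof -
  obtain b h where n: "n = prod_encode (b, h)" using prod_encode_surj by blast
  obtain bs hs where "b = list_encode (map atom_encode bs)" "h = list_encode (map atom_encode hs)"
    using list_encode_surj[OF atom_encode_surj] by meson
  then have "n = rule_encode (Rule bs hs)" using n by (simp add: rule_encode_def)
  then show ?thesis by blast
qed

lemma kb_encode_surj: "\<exists>rs fs. n = kb_encode rs fs"
proof -
  obtain b h where n: "n = prod_encode (b, h)" using prod_encode_surj by blast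
  obtain rs fs where "b = list_encode (map rule_encode rs)" "h = list_encode (map atom_encode fs)"
    using list_encode_surj[OF rule_encode_surj] list_encode_surj[OF atom_encode_surj] by meson
  then have "n = kb_encode rs fs" using n by (simp add: kb_encode_def)
  then show ?thesis by blast
qed

subsection \<open>Arithmetisation of the chase\<close>

text \<open>A list of term codes read as a total substitution. A rule has finitely many variables,
  so such lists represent all substitutions that matter.\<close>

definition stot :: "nat \<Rightarrow> nat \<Rightarrow> trm" where
  "stot c x = (if x < length (list_decode c) then inv trm_encode (list_decode c ! x) else Const 0)"

text \<open>\<open>1\<close> is the code of \<open>Const 0\<close>, the default of
  \<open>stot\<close>.\<close>

definition valN :: "nat \<Rightarrow> nat \<Rightarrow> nat \<Rightarrow> bool" where
  "valN c x y \<longleftrightarrow> lnth c x y \<or> \<not> (\<exists>z. lnth c x z) \<and> y = 1"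

lemma adef_valN: "adef \<Gamma>N (\<lambda>\<nu> V. valN (\<nu> a) (\<nu> b) (\<nu> c))"
  unfolding valN_def by (intro adef_intros adef_lnth)

lemma valN_iff: "valN c x y \<longleftrightarrow> y = trm_encode (stot c x)"
proof -
  have "trm_encode (inv trm_encode n) = n" for n using trm_encode_surj by (metis f_inv_into_f rangeI)
  then show ?thesis by (auto simp: valN_def stot_def lnth_def)
qed

text \<open>Variables are exactly the terms whose codes are multiples of \<open>3\<close>.\<close>

definition tsub :: "nat \<Rightarrow> nat \<Rightarrow> nat \<Rightarrow> bool" where
  "tsub c t u \<longleftrightarrow> (\<exists>x. t = 3 * x \<and> valN c x u) \<or> \<not> (\<exists>x. t = 3 * x) \<and> u = t"

lemma adef_tsub: "adef \<Gamma>N (\<lambda>\<nu> V. tsub (\<nu> a) (\<nu> b) (\<nu> c))"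
  unfolding tsub_def by (intro adef_intros adef_valN)

lemma tsub_iff: "tsub c (trm_encode t) u \<longleftrightarrow> u = trm_encode (tsubst (stot c) t)"
proof -
  have "3 * n + 1 \<noteq> 3 * m" "3 * n + 2 \<noteq> 3 * m" for n m :: nat by presburger+
  then show ?thesis by (cases t) (auto simp: tsub_def valN_iff)
qed

definition asub :: "nat \<Rightarrow> nat \<Rightarrow> nat \<Rightarrow> bool" where
  "asub c a u \<longleftrightarrow> (\<exists>p l l'. a = prod_encode (p, l) \<and> u = prod_encode (p, l') \<and>
     (\<forall>i y. lnth l' i y \<longleftrightarrow> (\<exists>z. lnth l i z \<and> tsub c z y)))"

lemma adef_asub: "adef \<Gamma>N (\<lambda>\<nu> V. asub (\<nu> a) (\<nu> b) (\<nu> c))"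
  unfolding asub_def by (intro adef_intros adef_lnth adef_tsub)

lemma asub_iff: "asub c (atom_encode a) u \<longleftrightarrow> u = atom_encode (asubst (stot c) a)"
proof -
  let ?l = "list_encode (map trm_encode (args a))"
  let ?l' = "list_encode (map (\<lambda>t. trm_encode (tsubst (stot c) t)) (args a))"
  have *: "(\<exists>z. lnth ?l i z \<and> tsub c z y) \<longleftrightarrow> lnth ?l' i y" for i y
    by (auto simp: tsub_iff)
  have "(\<forall>i y. lnth l' i y \<longleftrightarrow> lnth ?l' i y) \<longleftrightarrow> l' = ?l'" for l'
    using lnth_ext by blast
  then have "asub c (atom_encode a) u \<longleftrightarrow> u = prod_encode (pred a, ?l')"
    unfolding asub_def atom_encode_def by (auto simp: * simp del: lnth_map)
  also have "prod_encode (pred a, ?l') = atom_encode (asubst (stot c) a)"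
    by (simp add: atom_encode_def asubst_def comp_def)
  finally show ?thesis .
qed

definition varN :: "nat \<Rightarrow> nat \<Rightarrow> bool" where
  "varN x b \<longleftrightarrow> (\<exists>a p l y. lmem a b \<and> a = prod_encode (p, l) \<and> y = 3 * x \<and> lmem y l)"

definition nullN :: "nat \<Rightarrow> nat \<Rightarrow> bool" where
  "nullN x b \<longleftrightarrow> (\<exists>a p l y. lmem a b \<and> a = prod_encode (p, l) \<and> y = 3 * x + 2 \<and> lmem y l)"

lemma adef_varN: "adef \<Gamma>N (\<lambda>\<nu> V. varN (\<nu> a) (\<nu> b))"
  unfolding varN_def by (intro adef_intros adef_lmem)

lemma adef_nullN: "adef \<Gamma>N (\<lambda>\<nu> V. nullN (\<nu> a) (\<nu> b))"
  unfolding nullN_def by (intro adef_intros adef_lmem)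

lemma trm_encode_in: "3 * x \<in> trm_encode ` A \<longleftrightarrow> Var x \<in> A" "3 * x + 2 \<in> trm_encode ` A \<longleftrightarrow> Null x \<in> A"
  using inj_image_mem_iff[OF inj_trm_encode, of "Var x" A] inj_image_mem_iff[OF inj_trm_encode, of "Null x" A]
  by simp_all

lemma varN_iff: "varN x (list_encode (map atom_encode as)) \<longleftrightarrow> x \<in> vars (set as)"
  using trm_encode_in(1) by (auto simp: varN_def vars_def atom_encode_def)

lemma nullN_iff: "nullN x (list_encode (map atom_encode as)) \<longleftrightarrow> x \<in> nulls (set as)"
  using trm_encode_in(2) by (auto simp: nullN_def nulls_def atom_encode_def)

definition loadsN :: "nat set \<Rightarrow> nat \<Rightarrow> nat \<Rightarrow> nat \<Rightarrow> bool" where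
  "loadsN S b c i \<longleftrightarrow> (\<forall>a. lmem a b \<longrightarrow> (\<exists>u. asub c a u \<and> prod_encode (i, u) \<in> S))"

lemma adef_loadsN: "adef \<Gamma>N (\<lambda>\<nu> V. loadsN (V 1) (\<nu> a) (\<nu> b) (\<nu> c))"
  unfolding loadsN_def by (intro adef_intros adef_lmem adef_asub)

text \<open>One set of numbers codes a whole sequence of fact sets, by pairs of an index and an atom
  code.\<close>

definition facts :: "nat set \<Rightarrow> nat \<Rightarrow> atom set" where
  "facts S i = {a. prod_encode (i, atom_encode a) \<in> S}"

lemma loadsN_iff:
  "loadsN S (list_encode (map atom_encode as)) c i \<longleftrightarrow> asubst (stot c) ` set as \<subseteq> facts S i"
  by (auto simp: loadsN_def asub_iff facts_def)

definition agreeN :: "nat \<Rightarrow> nat \<Rightarrow> nat \<Rightarrow> bool" where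
  "agreeN b c c' \<longleftrightarrow> (\<forall>x. varN x b \<longrightarrow> (\<forall>y. valN c x y \<longleftrightarrow> valN c' x y))"

lemma adef_agreeN: "adef \<Gamma>N (\<lambda>\<nu> V. agreeN (\<nu> a) (\<nu> b) (\<nu> c))"
  unfolding agreeN_def by (intro adef_intros adef_varN adef_valN)

lemma agreeN_iff:
  "agreeN (list_encode (map atom_encode as)) c c' \<longleftrightarrow> (\<forall>x\<in>vars (set as). stot c x = stot c' x)"
  using inj_trm_encode by (auto simp: agreeN_def varN_iff valN_iff inj_def)

definition blockedN :: "nat set \<Rightarrow> nat \<Rightarrow> nat \<Rightarrow> nat \<Rightarrow> nat \<Rightarrow> bool" where
  "blockedN S b h c i \<longleftrightarrow> (\<exists>c'. agreeN b c c' \<and> loadsN S h c' i)"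

lemma adef_blockedN: "adef \<Gamma>N (\<lambda>\<nu> V. blockedN (V 1) (\<nu> a) (\<nu> b) (\<nu> c) (\<nu> d))"
  unfolding blockedN_def by (intro adef_intros adef_agreeN adef_loadsN)

lemma finite_vars: "finite (vars (set as))"
proof -
  have "vars (set as) \<subseteq> (\<lambda>t. case t of Var x \<Rightarrow> x | _ \<Rightarrow> 0) ` (\<Union>a\<in>set as. set (args a))"
    by (force simp: vars_def)
  then show ?thesis by (rule finite_subset) simp
qed

lemma stot_ex: "finite U \<Longrightarrow> \<exists>c. \<forall>x\<in>U. stot c x = s x"
proof -
  assume U: "finite U"
  define c where "c = list_encode (map (\<lambda>x. trm_encode (s x)) [0..<Suc (Max U)])"
  have "stot c x = s x" if "x \<in> U" for x
  proof -
    have "x < Suc (Max U)" using U that by (simp add: less_Suc_eq_le)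
    then show ?thesis using inj_trm_encode by (simp add: stot_def c_def del: upt_Suc)
  qed
  then show ?thesis by blast
qed

text \<open>An arbitrary witness can be replaced by a coded one that agrees with it on the finitely
  many variables of the rule.\<close>

lemma blockedN_iff:
  "blockedN S (list_encode (map atom_encode bs)) (list_encode (map atom_encode hs)) c i \<longleftrightarrow>
     blocked (Rule bs hs) (stot c) (facts S i)"
proof
  assume "blocked (Rule bs hs) (stot c) (facts S i)"
  then obtain s where s: "\<forall>x\<in>vars (set bs). s x = stot c x" "asubst s ` set hs \<subseteq> facts S i"
    by (auto simp: blocked_def uvars_def)
  obtain c' where c': "\<forall>x\<in>vars (set bs) \<union> vars (set hs). stot c' x = s x"
    using stot_ex[of "vars (set bs) \<union> vars (set hs)" s] finite_vars by auto
  have "asubst (stot c') ` set hs = asubst s ` set hs"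
    by (rule image_cong[OF refl], rule asubst_cong) (use c' in \<open>auto simp: vars_def\<close>)
  then show "blockedN S (list_encode (map atom_encode bs)) (list_encode (map atom_encode hs)) c i"
    unfolding blockedN_def agreeN_iff loadsN_iff using s c' by (intro exI[of _ c']) auto
qed (auto simp: blockedN_def agreeN_iff loadsN_iff blocked_def uvars_def)

text \<open>Unlike a body or head, \<open>facts S i\<close> has no list code, so its nulls are
  searched for in \<open>S\<close> directly.\<close>

definition nullS :: "nat set \<Rightarrow> nat \<Rightarrow> nat \<Rightarrow> bool" where
  "nullS S x i \<longleftrightarrow> (\<exists>a p l y. prod_encode (i, a) \<in> S \<and> a = prod_encode (p, l) \<and> y = 3 * x + 2 \<and> lmem y l)"

lemma adef_nullS: "adef \<Gamma>N (\<lambda>\<nu> V. nullS (V 1) (\<nu> a) (\<nu> b))"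
  unfolding nullS_def by (intro adef_intros adef_lmem)

lemma nullS_iff: "nullS S x i \<longleftrightarrow> x \<in> nulls (facts S i)"
proof
  assume "nullS S x i"
  then obtain p l where pl: "prod_encode (i, prod_encode (p, l)) \<in> S" "lmem (3 * x + 2) l"
    by (auto simp: nullS_def)
  obtain a where a: "prod_encode (p, l) = atom_encode a" using atom_encode_surj by blast
  then have "l = list_encode (map trm_encode (args a))" by (simp add: atom_encode_def)
  then have "Null x \<in> set (args a)" using pl(2) trm_encode_in(2) by simp
  then show "x \<in> nulls (facts S i)" using pl(1) a by (auto simp: nulls_def facts_def)
next
  assume "x \<in> nulls (facts S i)"
  then obtain a where a: "prod_encode (i, atom_encode a) \<in> S" "Null x \<in> set (args a)"
    by (auto simp: nulls_def facts_def)
  then have "lmem (3 * x + 2) (list_encode (map trm_encode (args a)))" using trm_encode_in(2) by simp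
  then show "nullS S x i" using a(1) unfolding nullS_def atom_encode_def by blast
qed

definition freshN :: "nat set \<Rightarrow> nat \<Rightarrow> nat \<Rightarrow> nat \<Rightarrow> nat \<Rightarrow> bool" where
  "freshN S b h c i \<longleftrightarrow>
    (\<forall>x x' y. (varN x h \<and> \<not> varN x b) \<and> (varN x' h \<and> \<not> varN x' b) \<and> valN c x y \<and> valN c x' y \<longrightarrow> x = x') \<and>
    (\<forall>x. varN x h \<and> \<not> varN x b \<longrightarrow> (\<exists>n y. y = 3 * n + 2 \<and> valN c x y \<and> \<not> nullS S n i))"

lemma adef_freshN: "adef \<Gamma>N (\<lambda>\<nu> V. freshN (V 1) (\<nu> a) (\<nu> b) (\<nu> c) (\<nu> d))"
  unfolding freshN_def by (intro adef_intros adef_varN adef_valN adef_nullS)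

lemma freshN_iff:
  "freshN S (list_encode (map atom_encode bs)) (list_encode (map atom_encode hs)) c i \<longleftrightarrow>
     fresh (Rule bs hs) (stot c) (facts S i)"
proof -
  have e: "evars (Rule bs hs) = {x. x \<in> vars (set hs) \<and> x \<notin> vars (set bs)}"
    by (auto simp: evars_def uvars_def)
  have n: "3 * n + 2 = trm_encode t \<longleftrightarrow> t = Null n" for n t
    using inj_trm_encode[unfolded inj_def, rule_format, of "Null n" t] by auto
  have i: "trm_encode s = trm_encode t \<longleftrightarrow> s = t" for s t
    using inj_trm_encode by (auto simp: inj_def)
  show ?thesis
    unfolding freshN_def fresh_def e inj_on_def varN_iff valN_iff nullS_iff
    using n i by (simp only: n i mem_Collect_eq ex_simps simp_thms) (auto simp: i n)
qed

definition stepN :: "nat set \<Rightarrow> nat \<Rightarrow> nat \<Rightarrow> bool" where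
  "stepN S rs i \<longleftrightarrow> (\<exists>r b h c. lmem r rs \<and> r = prod_encode (b, h) \<and> loadsN S b c i \<and>
     \<not> blockedN S b h c i \<and> freshN S b h c i \<and>
     (\<forall>a. prod_encode (Suc i, a) \<in> S \<longleftrightarrow> prod_encode (i, a) \<in> S \<or> (\<exists>a'. lmem a' h \<and> asub c a' a)))"

lemma adef_stepN: "adef \<Gamma>N (\<lambda>\<nu> V. stepN (V 1) (\<nu> a) (\<nu> b))"
  unfolding stepN_def
  by (intro adef_intros adef_lmem adef_loadsN adef_blockedN adef_freshN adef_asub)

definition chaseN :: "nat set \<Rightarrow> nat \<Rightarrow> bool" where
  "chaseN S x \<longleftrightarrow> (\<exists>rs fs. x = prod_encode (rs, fs) \<and>
     (\<forall>a. prod_encode (0, a) \<in> S \<longleftrightarrow> lmem a fs) \<and> (\<forall>i. stepN S rs i) \<and>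
     (\<forall>r b h c i. lmem r rs \<and> r = prod_encode (b, h) \<and> loadsN S b c i \<longrightarrow>
        (\<exists>j d. j = i + d \<and> blockedN S b h c j)))"

lemma adef_chaseN: "adef \<Gamma>N (\<lambda>\<nu> V. chaseN (V 1) (\<nu> a))"
  unfolding chaseN_def
  by (intro adef_intros adef_lmem adef_loadsN adef_blockedN adef_stepN)

text \<open>Codes list finitely many rules and facts, so finiteness is automatic; a head is nonempty
  iff its code is not \<open>0\<close>.\<close>

definition validN :: "nat \<Rightarrow> bool" where
  "validN x \<longleftrightarrow> (\<exists>rs fs. x = prod_encode (rs, fs) \<and>
     (\<forall>r. lmem r rs \<longrightarrow> (\<exists>b h. r = prod_encode (b, h) \<and> h \<noteq> 0 \<and> (\<forall>n. \<not> nullN n b \<and> \<not> nullN n h))) \<and>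
     (\<forall>n. \<not> varN n fs \<and> \<not> nullN n fs))"

lemma adef_validN: "adef \<Gamma>N (\<lambda>\<nu> V. validN (\<nu> a))"
  unfolding validN_def
  by (intro adef_intros adef_lmem adef_varN adef_nullN)

lemma validN_iff: "validN (kb_encode rs fs) \<longleftrightarrow> is_kb (set rs, set fs)"
proof -
  have h: "list_encode (map f hs) = 0 \<longleftrightarrow> hs = []" for f :: "atom \<Rightarrow> nat" and hs by (cases hs) auto
  have r: "(\<exists>b h. rule_encode R = prod_encode (b, h) \<and> h \<noteq> 0 \<and> (\<forall>n. \<not> nullN n b \<and> \<not> nullN n h)) \<longleftrightarrow> is_rule R" for R
    using h[of atom_encode "head R"] by (auto simp: rule_encode_def is_rule_def nullN_iff)
  have "validN (kb_encode rs fs) \<longleftrightarrow>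
    (\<forall>R\<in>set rs. \<exists>b h. rule_encode R = prod_encode (b, h) \<and> h \<noteq> 0 \<and> (\<forall>n. \<not> nullN n b \<and> \<not> nullN n h)) \<and>
    (\<forall>n. \<not> varN n (list_encode (map atom_encode fs)) \<and> \<not> nullN n (list_encode (map atom_encode fs)))"
    unfolding validN_def kb_encode_def prod_encode_eq prod.inject
    by (simp only: lmem_list_encode set_map conj_assoc ex_simps simp_thms) blast
  then show ?thesis
    unfolding r varN_iff nullN_iff by (auto simp: is_kb_def is_database_def)
qed

lemma stepN_iff: "stepN S (list_encode (map rule_encode rs)) i \<longleftrightarrow> step (set rs) (facts S i) (facts S (Suc i))"
proof -
  have u: "(\<forall>a. prod_encode (Suc i, a) \<in> S \<longleftrightarrow> prod_encode (i, a) \<in> S \<or>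
       (\<exists>a'. lmem a' (list_encode (map atom_encode hs)) \<and> asub c a' a)) \<longleftrightarrow>
     facts S (Suc i) = facts S i \<union> asubst (stot c) ` set hs" (is "?l \<longleftrightarrow> ?r") for c hs
  proof -
    have "?l \<longleftrightarrow> (\<forall>a. prod_encode (Suc i, atom_encode a) \<in> S \<longleftrightarrow> prod_encode (i, atom_encode a) \<in> S \<or>
       (\<exists>a'. lmem a' (list_encode (map atom_encode hs)) \<and> asub c a' (atom_encode a)))"
      using atom_encode_surj by metis
    also have "\<dots> \<longleftrightarrow> (\<forall>a. a \<in> facts S (Suc i) \<longleftrightarrow> a \<in> facts S i \<or> a \<in> asubst (stot c) ` set hs)"
    proof -
      have "(\<exists>a'. lmem a' (list_encode (map atom_encode hs)) \<and> asub c a' (atom_encode a)) \<longleftrightarrow>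
          (\<exists>a'\<in>set hs. asub c (atom_encode a') (atom_encode a))" for a by auto
      then show ?thesis using inj_atom_encode by (simp add: facts_def asub_iff inj_eq image_iff)
    qed
    also have "\<dots> \<longleftrightarrow> ?r" by blast
    finally show ?thesis .
  qed
  have "stepN S (list_encode (map rule_encode rs)) i \<longleftrightarrow>
    (\<exists>R\<in>set rs. \<exists>c. loads R (stot c) (facts S i) \<and> \<not> blocked R (stot c) (facts S i) \<and>
       fresh R (stot c) (facts S i) \<and> facts S (Suc i) = facts S i \<union> asubst (stot c) ` set (head R))"
  proof -
    have "(\<exists>b h c. rule_encode R = prod_encode (b, h) \<and> loadsN S b c i \<and>
     \<not> blockedN S b h c i \<and> freshN S b h c i \<and>
     (\<forall>a. prod_encode (Suc i, a) \<in> S \<longleftrightarrow> prod_encode (i, a) \<in> S \<or> (\<exists>a'. lmem a' h \<and> asub c a' a))) \<longleftrightarrow>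
     (\<exists>c. loads R (stot c) (facts S i) \<and> \<not> blocked R (stot c) (facts S i) \<and>
       fresh R (stot c) (facts S i) \<and> facts S (Suc i) = facts S i \<union> asubst (stot c) ` set (head R))" for R
    proof -
      have e: "rule_encode R = prod_encode (b, h) \<longleftrightarrow>
        b = list_encode (map atom_encode (body R)) \<and> h = list_encode (map atom_encode (head R))" for b h
        by (auto simp: rule_encode_def)
      have R: "R = Rule (body R) (head R)" by simp
      show ?thesis
        unfolding e using u[of "head R"]
        by (simp add: loadsN_iff blockedN_iff freshN_iff loads_def)
    qed
    then show ?thesis unfolding stepN_def by simp
  qed
  also have "\<dots> \<longleftrightarrow> step (set rs) (facts S i) (facts S (Suc i))"
    unfolding step_def
  proof (rule bex_cong[OF refl], rule iffI)
    fix R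
    assume "\<exists>s. loads R s (facts S i) \<and> \<not> blocked R s (facts S i) \<and> fresh R s (facts S i) \<and>
      facts S (Suc i) = facts S i \<union> asubst s ` set (head R)"
    then obtain s where s: "loads R s (facts S i)" "\<not> blocked R s (facts S i)" "fresh R s (facts S i)"
      "facts S (Suc i) = facts S i \<union> asubst s ` set (head R)" by blast
    obtain c where c: "\<forall>x\<in>vars (set (body R)) \<union> vars (set (head R)). stot c x = s x"
      using stot_ex[of "vars (set (body R)) \<union> vars (set (head R))" s] finite_vars by auto
    have "asubst (stot c) ` set (head R) = asubst s ` set (head R)"
      by (rule image_cong[OF refl], rule asubst_cong) (use c in \<open>auto simp: vars_def\<close>)
    moreover have "loads R (stot c) (facts S i) = loads R s (facts S i)"
      "blocked R (stot c) (facts S i) = blocked R s (facts S i)"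
      using c loads_cong[of R "stot c" s] blocked_cong[of R "stot c" s] by (simp_all add: uvars_def)
    moreover have "fresh R (stot c) (facts S i) = fresh R s (facts S i)"
      unfolding fresh_def using c by (auto simp: evars_def inj_on_def)
    ultimately show "\<exists>c. loads R (stot c) (facts S i) \<and> \<not> blocked R (stot c) (facts S i) \<and>
      fresh R (stot c) (facts S i) \<and> facts S (Suc i) = facts S i \<union> asubst (stot c) ` set (head R)"
      using s by (intro exI[of _ c]) simp
  qed blast
  finally show ?thesis .
qed

lemma chaseN_iff: "chaseN S (kb_encode rs fs) \<longleftrightarrow> infinite_chase (set rs, set fs) (facts S)"
proof -
  have z: "(\<forall>a. prod_encode (0, a) \<in> S \<longleftrightarrow> lmem a (list_encode (map atom_encode fs))) \<longleftrightarrow> facts S 0 = set fs"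
    (is "?l \<longleftrightarrow> _")
  proof -
    have "?l \<longleftrightarrow> (\<forall>a. prod_encode (0, atom_encode a) \<in> S \<longleftrightarrow> lmem (atom_encode a) (list_encode (map atom_encode fs)))"
      using atom_encode_surj by metis
    also have "\<dots> \<longleftrightarrow> (\<forall>a. a \<in> facts S 0 \<longleftrightarrow> a \<in> set fs)"
      using inj_atom_encode by (auto simp: facts_def inj_eq image_iff)
    finally show ?thesis by blast
  qed
  have f: "(\<forall>b h c i. rule_encode R = prod_encode (b, h) \<and> loadsN S b c i \<longrightarrow>
      (\<exists>j d. j = i + d \<and> blockedN S b h c j)) \<longleftrightarrow>
    (\<forall>s i. loads R s (facts S i) \<longrightarrow> (\<exists>j\<ge>i. blocked R s (facts S j)))" for R
  proof -
    have e: "rule_encode R = prod_encode (b, h) \<longleftrightarrow>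
      b = list_encode (map atom_encode (body R)) \<and> h = list_encode (map atom_encode (head R))" for b h
      by (auto simp: rule_encode_def)
    have "(\<forall>b h c i. rule_encode R = prod_encode (b, h) \<and> loadsN S b c i \<longrightarrow>
      (\<exists>j d. j = i + d \<and> blockedN S b h c j)) \<longleftrightarrow>
      (\<forall>c i. loads R (stot c) (facts S i) \<longrightarrow> (\<exists>j\<ge>i. blocked R (stot c) (facts S j)))"
      unfolding e le_iff_add by (auto simp: loadsN_iff blockedN_iff loads_def)
    also have "\<dots> \<longleftrightarrow> (\<forall>s i. loads R s (facts S i) \<longrightarrow> (\<exists>j\<ge>i. blocked R s (facts S j)))"
    proof (intro iffI allI impI)
      fix s i
      assume a: "\<forall>c i. loads R (stot c) (facts S i) \<longrightarrow> (\<exists>j\<ge>i. blocked R (stot c) (facts S j))"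
        and l: "loads R s (facts S i)"
      obtain c where c: "\<forall>x\<in>uvars R. stot c x = s x"
        using stot_ex[of "uvars R" s] finite_vars by (auto simp: uvars_def)
      have "loads R (stot c) (facts S i)" using loads_cong[of R "stot c" s] c l by blast
      then obtain j where "j \<ge> i" "blocked R (stot c) (facts S j)" using a by blast
      then show "\<exists>j\<ge>i. blocked R s (facts S j)" using blocked_cong[of R "stot c" s] c by blast
    qed blast
    finally show ?thesis .
  qed
  have "chaseN S (kb_encode rs fs) \<longleftrightarrow>
    (\<forall>a. prod_encode (0, a) \<in> S \<longleftrightarrow> lmem a (list_encode (map atom_encode fs))) \<and>
    (\<forall>i. stepN S (list_encode (map rule_encode rs)) i) \<and>
    (\<forall>R\<in>set rs. \<forall>b h c i. rule_encode R = prod_encode (b, h) \<and> loadsN S b c i \<longrightarrow>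
        (\<exists>j d. j = i + d \<and> blockedN S b h c j))"
  proof -
    have q: "(\<forall>R\<in>set rs. \<forall>b h c i. rule_encode R = prod_encode (b, h) \<and> loadsN S b c i \<longrightarrow>
        (\<exists>j d. j = i + d \<and> blockedN S b h c j)) \<longleftrightarrow>
      (\<forall>r b h c i. lmem r (list_encode (map rule_encode rs)) \<and> r = prod_encode (b, h) \<and> loadsN S b c i \<longrightarrow>
        (\<exists>j d. j = i + d \<and> blockedN S b h c j))"
      unfolding lmem_list_encode set_map by blast
    show ?thesis unfolding chaseN_def kb_encode_def q prod_encode_eq prod.inject by blast
  qed
  then show ?thesis unfolding z f stepN_iff infinite_chase_def by simp
qed

lemma facts_surj: "\<exists>S. F = facts S"
proof
  show "F = facts {prod_encode (i, atom_encode a) | i a. a \<in> F i}"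
    using inj_atom_encode by (auto simp: facts_def inj_eq fun_eq_iff)
qed

lemma kb_codes_iff: "x \<in> kb_codes CT_rest_all \<longleftrightarrow> validN x \<and> (\<forall>S. \<not> chaseN S x)"
proof -
  obtain rs fs where x: "x = kb_encode rs fs" using kb_encode_surj by blast
  have "x \<in> kb_codes CT_rest_all \<longleftrightarrow> (set rs, set fs) \<in> CT_rest_all"
    unfolding x kb_codes_def by auto
  also have "\<dots> \<longleftrightarrow> validN x \<and> (\<forall>S. \<not> chaseN S x)"
    unfolding CT_rest_all_iff x validN_iff chaseN_iff using facts_surj by metis
  finally show ?thesis .
qed

lemma pi11_CT: "pi11 (kb_codes CT_rest_all)"
proof -
  have "adef \<Gamma>N (\<lambda>\<nu> V. validN (\<nu> 0) \<and> \<not> chaseN (V 1) (\<nu> 0))"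
    by (intro adef_intros adef_validN adef_chaseN)
  then obtain \<phi> where \<phi>: "arithmetical \<phi>"
    "\<And>\<nu> V. V 0 = NTH \<Longrightarrow> arith_sat \<nu> V \<phi> \<longleftrightarrow> validN (\<nu> 0) \<and> \<not> chaseN (V 1) (\<nu> 0)"
    unfolding adef_def by blast
  obtain \<theta> where \<theta>: "arithmetical \<theta>" "\<And>\<nu> V. arith_sat \<nu> V \<theta> \<longleftrightarrow> V 0 = NTH"
    using adef_is_NTH unfolding adef_def is_NTH_iff by blast
  \<comment> \<open>Being the lookup table is a premise under the universal quantifier, and the
    table is unique, so introducing it stays within the class.\<close>
  let ?\<chi> = "Neg (Conj \<theta> (Neg \<phi>))"
  have "pi11_fm (AllSet 0 (AllSet 1 ?\<chi>))"
    using \<phi>(1) \<theta>(1) by (intro pi11_fm.intros) simp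
  moreover have "\<nu> 0 \<in> kb_codes CT_rest_all \<longleftrightarrow> arith_sat \<nu> V (AllSet 0 (AllSet 1 ?\<chi>))" for \<nu> V
  proof -
    have "arith_sat \<nu> V' ?\<chi> \<longleftrightarrow> (V' 0 = NTH \<longrightarrow> validN (\<nu> 0) \<and> \<not> chaseN (V' 1) (\<nu> 0))" for V'
      using \<theta>(2)[of \<nu> V'] \<phi>(2)[of V' \<nu>] by auto
    then have "arith_sat \<nu> V (AllSet 0 (AllSet 1 ?\<chi>)) \<longleftrightarrow>
      (\<forall>A B. A = NTH \<longrightarrow> validN (\<nu> 0) \<and> \<not> chaseN B (\<nu> 0))"
      unfolding arith_sat.simps(6) by simp
    then show ?thesis unfolding kb_codes_iff by blast
  qed
  ultimately show ?thesis unfolding pi11_def by blast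
qed

section \<open>Completeness\<close>

lemma nulls_simps [simp]:
  "nulls {} = {}" "nulls (insert a A) = {n. Null n \<in> set (args a)} \<union> nulls A"
  "nulls (A \<union> B) = nulls A \<union> nulls B"
  by (auto simp: nulls_def)

lemma nulls_flat: "nulls (set (flat t)) = {}"
  by (induction t) auto

lemma nulls_input_body: "nulls (set (input_body x)) = {}"
  by (induction x) auto

lemma is_rule_rules: "R \<in> rules G x \<Longrightarrow> is_rule R"
proof -
  assume R: "R \<in> rules G x"
  have c: "is_rule (clause_rule c)" for c
  proof -
    have "nulls (set (body (clause_rule c))) = {}"
      using nulls_flat by (fastforce simp: clause_rule_def nulls_def)
    then show ?thesis by (simp add: is_rule_def clause_rule_def)
  qed
  have i: "is_rule (input_rule x)" by (simp add: is_rule_def input_rule_def nulls_input_body)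
  have b: "is_rule R" if "R \<in> set base_rules"
    using that unfolding base_rules_def
    by (simp only: list.set insert_iff empty_iff, elim disjE FalseE) (simp_all add: is_rule_def)
  have "is_rule (choice_rule q)" "is_rule (phase_rule q)" "is_rule brake_rule" for q
    by (simp_all add: is_rule_def choice_rule_def phase_rule_def brake_rule_def)
  with R c i b show ?thesis unfolding rules_eq datalog_def by auto
qed

lemma is_database_dbase: "is_database (set dbase)"
proof -
  have "vars (set dbase) = {}" by (auto simp: vars_def dbase_def)
  moreover have "nulls (set dbase) = {}" by (simp add: dbase_def)
  ultimately show ?thesis by (simp add: is_database_def)
qed

lemma hardness:
  assumes "pi11 B"
  shows "many_one_reducible B (kb_codes CT_rest_all)"
proof -
  obtain G where G: "pair_patterns G" "\<And>x. x \<notin> B \<longleftrightarrow> solvable G x"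
    using pi11_solvable[OF assms] by blast
  have "x \<in> B \<longleftrightarrow> kb_encode (input_rule x # fixed_rules G) dbase \<in> kb_codes CT_rest_all" for x
  proof -
    have "is_kb (rules G x, set dbase)"
      using is_rule_rules is_database_dbase by (auto simp: is_kb_def rules_def)
    then have "x \<in> B \<longleftrightarrow> (rules G x, set dbase) \<in> CT_rest_all"
      using infinite_chase_iff_solvable[OF G(1), of x] G(2)[of x] by (simp add: CT_rest_all_iff) blast
    also have "\<dots> \<longleftrightarrow> kb_encode (input_rule x # fixed_rules G) dbase \<in> kb_codes CT_rest_all"
      unfolding kb_codes_def rules_def by auto
    finally show ?thesis .
  qed
  then show ?thesis unfolding many_one_reducible_def using computable_kb by blast
qed

theorem theorem4p1:
  shows "pi11_complete (kb_codes CT_rest_all)"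
  unfolding pi11_complete_def using pi11_CT hardness by blast

end
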